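(* Let $d\in\mathbb{N}$, let $f\in\mathcal{R}$, and let $(\sigma_n)_{n\ge1}$ be a sequence of positive integers. Let $(U_n)_{n\ge0}$ be the time-dependent P\'olya urn process with $d$ colors, reinforcement function $f$, addition sequence $(\sigma_n)_{n\ge 1}$ and non-trivial initial composition $U_0$, with total number of balls $\tau_n$ at time $n$. Assume that $$\sum_{n\ge1}\frac{\sigma_n}{\tau_n}=\infty\qquad\text{and}\qquad \sum_{n\ge1}\left(\frac{\sigma_n}{\tau_n}\right)^2<\infty .$$ Then $\mathbb{P}(\mathscr{F})=1$, where $\mathscr{F}$ is the event of fixation $$\mathscr{F}=\Big\{\exists\, N\ge1\ \text{and}\ i\in\{1,\dots,d\}\ \text{such that for all}\ n\ge N,\ U_{n+1,i}=U_{n,i}+\sigma_{n+1}\Big\}.$$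
   Context: Class $\mathcal{R}$: the set of all functions $f:[0,1]\to\mathbb{R}_+$ such that (A) $f$ is strictly increasing and continuous with $f(0)=0$, $f(1)=1$; (B) $f\in C^1((0,1))$ and the limits $\lim_{x\to0^+}f'(x)$ and $\lim_{x\to1^-}f'(x)$ exist (finitely); (C) $\alpha:=\inf_{x\in(0,1)}\frac{x f'(x)}{f(x)}>1$. Urn process: all random variables live on one probability space $(\Omega,\mathcal{F},\mathbb{P})$, and $e_1,\dots,e_d$ is the standard basis of $\mathbb{R}^d$. $U_n=(U_{n,1},\dots,U_{n,d})$ is the composition at time $n$, $U_{n,j}$ being the number of balls of color $j$. The initial composition $U_0$ is given and non-trivial (a nonzero vector of nonnegative integers). Put $\tau_n=\|U_n\|_1=\tau_0+\sum_{j=1}^n\sigma_j$ with $\tau_0=\sum_{j=1}^d U_{0,j}$, and $\theta_{n,k}=U_{n,k}/\tau_n$. For each $n\ge0$, given $U_0,\dots,U_n$, the vectors $X^{(n+1)}_1,\dots,X^{(n+1)}_{\sigma_{n+1}}$ are i.i.d. with $$\mathbb{P}\big(X^{(n+1)}_i=e_j\mid U_0,\dots,U_n\big)=\frac{f(\theta_{n,j})}{\sum_{k=1}^d f(\theta_{n,k})},\qquad 1\le j\le d,$$ and $U_{n+1}=U_n+\sum_{i=1}^{\sigma_{n+1}}X^{(n+1)}_i$. *)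

theory Defs
  imports "HOL-Probability.Probability"
begin

text \<open>
  Functions on the unit interval are represented by functions on the reals, of which only the
  values on \<open>{0..1}\<close> matter. In the last clause \<open>Inf\<close> is the genuine infimum: for such
  an \<open>f\<close> the quotient is nonnegative on \<open>(0,1)\<close>, so the set is nonempty and bounded below.
\<close>

definition reinforcement_class :: "(real \<Rightarrow> real) set" where
  "reinforcement_class = {f.
     (\<forall>x\<in>{0..1}. 0 \<le> f x) \<and>
     strict_mono_on {0..1} f \<and> continuous_on {0..1} f \<and> f 0 = 0 \<and> f 1 = 1 \<and>
     f C1_differentiable_on {0<..<1} \<and>
     (\<exists>L. (deriv f \<longlongrightarrow> L) (at_right 0)) \<and> (\<exists>L. (deriv f \<longlongrightarrow> L) (at_left 1)) \<and>
     (INF x\<in>{0<..<1}. x * deriv f x / f x) > 1}"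

text \<open>
  Colours are the elements of a finite type, compositions are vectors of natural numbers, and the
  standard basis vector of colour \<open>j\<close> is \<open>axis j 1\<close>. Only \<open>\<sigma> 1, \<sigma> 2, \<dots>\<close> are used;
  \<open>\<sigma> 0\<close> is irrelevant.
\<close>

definition total_balls :: "nat ^ 'd \<Rightarrow> (nat \<Rightarrow> nat) \<Rightarrow> nat \<Rightarrow> nat" where
  "total_balls u0 \<sigma> n = (\<Sum>j\<in>UNIV. u0 $ j) + (\<Sum>k=1..n. \<sigma> k)"

definition proportion ::
    "nat ^ 'd \<Rightarrow> (nat \<Rightarrow> nat) \<Rightarrow> (nat \<Rightarrow> 'w \<Rightarrow> nat ^ 'd) \<Rightarrow> nat \<Rightarrow> 'd \<Rightarrow> 'w \<Rightarrow> real" where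
  "proportion u0 \<sigma> U n k \<omega> = real (U n \<omega> $ k) / real (total_balls u0 \<sigma> n)"

text \<open>The \<open>\<sigma>\<close>-algebra generated by \<open>U 0, \<dots>, U n\<close>.\<close>

definition history :: "'w measure \<Rightarrow> (nat \<Rightarrow> 'w \<Rightarrow> 'b) \<Rightarrow> nat \<Rightarrow> 'w measure" where
  "history M U n =
     vimage_algebra (space M) (\<lambda>\<omega>. \<lambda>k\<in>{..n}. U k \<omega>) (\<Pi>\<^sub>M k\<in>{..n}. count_space UNIV)"

definition cond_prob_on :: "'w measure \<Rightarrow> 'w measure \<Rightarrow> 'w set \<Rightarrow> 'w \<Rightarrow> real" where
  "cond_prob_on M F A = real_cond_exp M F (indicator A)"

text \<open>
  Conditional independence given \<open>F\<close> of a finite family of discrete random variables. The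
  product formula for proper subfamilies is the case \<open>A i = UNIV\<close> for the remaining indices.
\<close>

definition cond_indep ::
    "'w measure \<Rightarrow> 'w measure \<Rightarrow> ('i \<Rightarrow> 'w \<Rightarrow> 'b) \<Rightarrow> 'i set \<Rightarrow> bool" where
  "cond_indep M F X I \<longleftrightarrow>
     (\<forall>A. AE \<omega> in M. cond_prob_on M F {\<omega>\<in>space M. \<forall>i\<in>I. X i \<omega> \<in> A i} \<omega> =
        (\<Prod>i\<in>I. cond_prob_on M F {\<omega>\<in>space M. X i \<omega> \<in> A i} \<omega>))"

text \<open>
  \<open>X n i\<close> is the \<open>i\<close>-th ball added at time \<open>n\<close>. Given the history, the added balls are
  independent with the stated common law. For \<open>f\<close> in the reinforcement class and \<open>u0 \<noteq> 0\<close>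
  the probabilities in \<open>law\<close> add up to 1, so almost surely each \<open>X (Suc n) i\<close> is a basis
  vector and the number of balls in \<open>U n\<close> is \<open>total_balls u0 \<sigma> n\<close>.
\<close>

locale polya_urn = prob_space M
  for M :: "'w measure" +
  fixes f :: "real \<Rightarrow> real"
    and \<sigma> :: "nat \<Rightarrow> nat"
    and u0 :: "nat ^ 'd::finite"
    and X :: "nat \<Rightarrow> nat \<Rightarrow> 'w \<Rightarrow> nat ^ 'd"
    and U :: "nat \<Rightarrow> 'w \<Rightarrow> nat ^ 'd"
  assumes measurable_X:
      "\<And>n i. i \<in> {1..\<sigma> (Suc n)} \<Longrightarrow> X (Suc n) i \<in> measurable M (count_space UNIV)"
    and nontrivial: "u0 \<noteq> 0"
    and initial: "\<And>\<omega>. \<omega> \<in> space M \<Longrightarrow> U 0 \<omega> = u0"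
    and step: "\<And>n \<omega>. \<omega> \<in> space M \<Longrightarrow>
      U (Suc n) \<omega> = U n \<omega> + (\<Sum>i=1..\<sigma> (Suc n). X (Suc n) i \<omega>)"
    and law: "\<And>n i j. i \<in> {1..\<sigma> (Suc n)} \<Longrightarrow>
      AE \<omega> in M. cond_prob_on M (history M U n) {\<omega>\<in>space M. X (Suc n) i \<omega> = axis j 1} \<omega> =
        f (proportion u0 \<sigma> U n j \<omega>) / (\<Sum>k\<in>UNIV. f (proportion u0 \<sigma> U n k \<omega>))"
    and independent: "\<And>n. cond_indep M (history M U n) (X (Suc n)) {1..\<sigma> (Suc n)}"

definition fixation :: "'w measure \<Rightarrow> (nat \<Rightarrow> nat) \<Rightarrow> (nat \<Rightarrow> 'w \<Rightarrow> nat ^ 'd) \<Rightarrow> 'w set" where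
  "fixation M \<sigma> U =
     {\<omega>\<in>space M. \<exists>N\<ge>1. \<exists>i. \<forall>n\<ge>N. U (Suc n) \<omega> $ i = U n \<omega> $ i + \<sigma> (Suc n)}"

end

theory Submission
  imports Defs
begin

text \<open>
  Write \<open>\<epsilon>\<close> for \<open>\<sigma> / \<tau>\<close> and \<open>\<theta>\<close> for the vector of proportions. Everything rests on functions \<open>W\<close> of time
  and composition that are bounded above and whose expected increment, as long as the process stays in
  some region, is at least \<open>\<delta> - \<eta>\<close> with \<open>\<Sum>\<eta> < \<infinity>\<close>; then the expected sum of \<open>\<delta>\<close> over the time spent
  in the region is finite.

  First, \<open>W = \<Sum>j. \<theta>\<^sub>j\<^sup>2\<close> is convex, so its drift is at least \<open>\<epsilon> w(\<theta>)\<close>, where \<open>w\<close> is nonnegative and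
  vanishes only at the uniform distributions on sets of colours, because \<open>f x / x\<close> is strictly increasing.
  As \<open>\<Sum>\<epsilon> w(\<theta>) < \<infinity>\<close>, \<open>\<Sum>\<epsilon> = \<infinity>\<close> and the steps of \<open>\<theta>\<close> are at most \<open>2\<epsilon>\<close>, the process ends up near one of
  these finitely many points.

  Near a point charging two colours, the difference \<open>D\<close> of these colours has drift at least
  \<open>(1 + \<kappa>) \<epsilon> D\<close>. With \<open>q = 16 + D\<^sup>2 / \<tau>\<close>, the function \<open>W = ln (q / \<tau>) - b / q\<close> has drift
  \<open>2 \<kappa> \<epsilon> - O(\<epsilon>\<^sup>2)\<close>; since \<open>\<Sum>\<epsilon> = \<infinity>\<close>, the process almost surely leaves the neighbourhood.

  Near a vertex, \<open>W = - U\<^sub>j\<^sup>2 \<tau> powr (1 - \<beta>)\<close> shows for every other colour \<open>j\<close> that the expected number of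
  balls of colour \<open>j\<close> added while the process stays there is finite.
\<close>

declare One_nat_def [simp del]

section \<open>Adding independent balls\<close>

text \<open>Expectation of \<open>\<phi>\<close> after \<open>k\<close> independent balls of fixed
  law \<open>p\<close> have been added to \<open>u\<close>: within one time step the law does not
  react to balls already added. The recursion peels off one ball at a time, so moments follow by
  induction without a probability space.\<close>

primrec avg :: "('d::finite \<Rightarrow> real) \<Rightarrow> nat \<Rightarrow> (nat ^ 'd \<Rightarrow> real) \<Rightarrow> nat ^ 'd \<Rightarrow> real" where
  "avg p 0 \<phi> u = \<phi> u"
| "avg p (Suc k) \<phi> u = (\<Sum>j\<in>UNIV. p j * avg p k (\<lambda>w. \<phi> (w + axis j 1)) u)"

lemma avg_add: "avg p k (\<lambda>w. \<phi> w + \<psi> w) u = avg p k \<phi> u + avg p k \<psi> u"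
  by (induction k arbitrary: \<phi> \<psi>) (simp_all add: algebra_simps sum.distrib)

lemma avg_cmult: "avg p k (\<lambda>w. c * \<phi> w) u = c * avg p k \<phi> u"
  by (induction k arbitrary: \<phi>) (simp_all add: sum_distrib_left algebra_simps)

lemma avg_diff: "avg p k (\<lambda>w. \<phi> w - \<psi> w) u = avg p k \<phi> u - avg p k \<psi> u"
  using avg_add[of p k \<phi> "\<lambda>w. (-1) * \<psi> w" u] avg_cmult[of p k "-1" \<psi> u] by simp

lemma avg_sum: "finite A \<Longrightarrow> avg p k (\<lambda>w. \<Sum>a\<in>A. \<phi> a w) u = (\<Sum>a\<in>A. avg p k (\<phi> a) u)"
proof (induction A rule: finite_induct)
  case empty
  then show ?case using avg_cmult[of p k 0 "\<lambda>_. 0" u] by simp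
next
  case (insert x F)
  then show ?case by (simp add: avg_add)
qed

lemma avg_const: "sum p UNIV = 1 \<Longrightarrow> avg p k (\<lambda>w. c) u = c"
  by (induction k) (simp_all flip: sum_distrib_right)

definition ball_count :: "nat ^ 'd::finite \<Rightarrow> nat" where
  "ball_count u = (\<Sum>j\<in>UNIV. u $ j)"

lemma ball_count_add: "ball_count (u + v) = ball_count u + ball_count v"
  by (simp add: ball_count_def sum.distrib)

lemma ball_count_axis: "ball_count (axis j 1) = 1"
  by (simp add: ball_count_def axis_def)

lemma avg_mono:
  assumes "\<And>j. p j \<ge> 0" "\<And>w. ball_count w = ball_count u + k \<Longrightarrow> \<phi> w \<le> \<psi> w"
  shows "avg p k \<phi> u \<le> avg p k \<psi> u"
  using assms(2)
proof (induction k arbitrary: \<phi> \<psi>)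
  case (Suc k)
  show ?case
    by (auto intro!: sum_mono mult_left_mono assms(1) Suc simp: ball_count_add ball_count_axis)
qed simp

text \<open>The link to the process: conditional independence gives every colour sequence
  \<open>x\<close> the product weight that appears here.\<close>

lemma avg_eq_PiE:
  "avg p k \<phi> u =
     (\<Sum>x\<in>PiE {1..k} (\<lambda>_. UNIV). (\<Prod>i=1..k. p (x i)) * \<phi> (u + (\<Sum>i=1..k. axis (x i) 1)))"
proof (induction k arbitrary: \<phi>)
  case (Suc k)
  let ?P = "PiE {1..k} (\<lambda>_. UNIV :: 'a set)"
  let ?h = "\<lambda>(j, x). x(Suc k := j)"
  \<comment> \<open>A sequence of length \<open>Suc k\<close> is one of length \<open>k\<close> with
    a last colour appended; this last ball is the one peeled off by the recursion.\<close>
  have "PiE {1..Suc k} (\<lambda>_. UNIV) = ?h ` (UNIV \<times> ?P)"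
    using PiE_insert_eq[of "Suc k" "{1..k}" "\<lambda>_. UNIV :: 'a set"]
    by (simp add: atLeastAtMostSuc_conv)
  moreover have "inj_on ?h (UNIV \<times> ?P)"
    using inj_combinator[of "Suc k" "{1..k}" "\<lambda>_. UNIV"] by simp
  moreover have "(\<Prod>i=1..k. p ((x(Suc k := j)) i)) = (\<Prod>i=1..k. p (x i))"
     "(\<Sum>i=1..k. axis ((x(Suc k := j)) i) (1::nat)) = (\<Sum>i=1..k. axis (x i) 1)" for x j
    by (auto intro!: prod.cong sum.cong)
  ultimately have "(\<Sum>x\<in>PiE {1..Suc k} (\<lambda>_. UNIV). (\<Prod>i=1..Suc k. p (x i)) *
        \<phi> (u + (\<Sum>i=1..Suc k. axis (x i) 1))) =
      (\<Sum>y\<in>UNIV \<times> ?P. p (fst y) * ((\<Prod>i=1..k. p (snd y i)) *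
        \<phi> (u + (\<Sum>i=1..k. axis (snd y i) 1) + axis (fst y) 1)))"
    by (simp add: sum.reindex case_prod_unfold mult_ac add_ac del: fun_upd_apply)
      (simp add: mult_ac add_ac)
  also have "\<dots> = avg p (Suc k) \<phi> u"
    by (simp add: Suc sum.cartesian_product case_prod_unfold sum_distrib_left)
  finally show ?case by simp
qed simp

definition lin :: "('d::finite \<Rightarrow> real) \<Rightarrow> nat ^ 'd \<Rightarrow> real" where
  "lin \<xi> u = (\<Sum>j\<in>UNIV. \<xi> j * real (u $ j))"

lemma lin_add_axis: "lin \<xi> (w + axis j 1) = lin \<xi> w + \<xi> j"
proof -
  have "lin \<xi> (w + axis j 1) = (\<Sum>i\<in>UNIV. \<xi> i * real (w $ i) + (if i = j then \<xi> i else 0))"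
    by (auto simp: lin_def axis_def algebra_simps intro!: sum.cong)
  then show ?thesis by (simp add: lin_def sum.distrib)
qed

text \<open>The free constant \<open>c\<close> carries the induction: a ball of colour
  \<open>j\<close> raises \<open>lin \<xi>\<close> by \<open>\<xi> j\<close>, which is absorbed by
  passing to \<open>c - \<xi> j\<close>. The next two moments use the same device.\<close>

lemma avg_lin:
  assumes "sum p UNIV = 1"
  shows "avg p k (\<lambda>w. lin \<xi> w - c) u = lin \<xi> u + k * (\<Sum>j\<in>UNIV. p j * \<xi> j) - c"
proof (induction k arbitrary: c)
  case (Suc k)
  have "avg p (Suc k) (\<lambda>w. lin \<xi> w - c) u =
      (\<Sum>j\<in>UNIV. p j * avg p k (\<lambda>w. lin \<xi> w - (c - \<xi> j)) u)"
    by (simp add: lin_add_axis algebra_simps)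
  also have "\<dots> = (\<Sum>j\<in>UNIV. p j * (lin \<xi> u + k * (\<Sum>j\<in>UNIV. p j * \<xi> j) - c) + p j * \<xi> j)"
    unfolding Suc by (simp add: algebra_simps)
  also have "\<dots> = lin \<xi> u + k * (\<Sum>j\<in>UNIV. p j * \<xi> j) - c + (\<Sum>j\<in>UNIV. p j * \<xi> j)"
    by (simp add: sum.distrib assms flip: sum_distrib_right)
  finally show ?case by (simp add: algebra_simps)
qed simp

text \<open>Bias-variance decomposition; the variances of independent balls add up.\<close>

lemma avg_lin_square:
  fixes p :: "'d::finite \<Rightarrow> real"
  assumes p: "sum p UNIV = 1"
  defines "m \<equiv> \<lambda>\<xi>. \<Sum>j\<in>UNIV. p j * \<xi> j"
  shows "avg p k (\<lambda>w. (lin \<xi> w - c)\<^sup>2) u =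
    (lin \<xi> u + k * m \<xi> - c)\<^sup>2 + k * (\<Sum>j\<in>UNIV. p j * (\<xi> j - m \<xi>)\<^sup>2)"
proof (induction k arbitrary: c)
  case (Suc k)
  define v where "v = (\<Sum>j\<in>UNIV. p j * (\<xi> j - m \<xi>)\<^sup>2)"
  define y where "y = lin \<xi> u + Suc k * m \<xi> - c"
  define d where "d = (\<lambda>j. \<xi> j - m \<xi>)"
  have d1: "(\<Sum>j\<in>UNIV. p j * d j) = 0"
    by (simp add: d_def right_diff_distrib sum_subtractf sum_distrib_right[symmetric] p m_def)
  have "avg p (Suc k) (\<lambda>w. (lin \<xi> w - c)\<^sup>2) u =
      (\<Sum>j\<in>UNIV. p j * avg p k (\<lambda>w. (lin \<xi> w - (c - \<xi> j))\<^sup>2) u)"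
    by (simp add: lin_add_axis algebra_simps)
  also have "\<dots> = (\<Sum>j\<in>UNIV. p j * ((y + d j)\<^sup>2 + k * v))"
    unfolding Suc by (simp add: v_def d_def y_def algebra_simps)
  also have "\<dots> = (\<Sum>j\<in>UNIV. p j * (y\<^sup>2 + k * v) + 2 * y * (p j * d j) + p j * (d j)\<^sup>2)"
    by (intro sum.cong) (auto simp: algebra_simps power2_eq_square)
  also have "\<dots> = (\<Sum>j\<in>UNIV. p j) * (y\<^sup>2 + k * v) + 2 * y * (\<Sum>j\<in>UNIV. p j * d j) + v"
    by (simp add: sum.distrib sum_distrib_left sum_distrib_right v_def d_def)
  also have "\<dots> = y\<^sup>2 + Suc k * v"
    by (simp add: p d1) (simp add: algebra_simps)
  finally show ?case unfolding y_def v_def .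
qed simp

text \<open>If \<open>c\<close> is the mean, only \<open>k * \<mu> \<xi> 4\<close> and the
  contribution of pairs of balls survive, so the central fourth moment has order
  \<open>k\<^sup>2\<close>.\<close>

lemma avg_lin_pow4:
  fixes p :: "'d::finite \<Rightarrow> real"
  assumes p: "sum p UNIV = 1"
  defines "m \<equiv> \<lambda>\<xi>. \<Sum>j\<in>UNIV. p j * \<xi> j"
  defines "\<mu> \<equiv> \<lambda>\<xi> r. \<Sum>j\<in>UNIV. p j * (\<xi> j - m \<xi>) ^ r"
  shows "avg p k (\<lambda>w. (lin \<xi> w - c) ^ 4) u =
    (lin \<xi> u + k * m \<xi> - c) ^ 4 + 6 * (lin \<xi> u + k * m \<xi> - c)\<^sup>2 * (k * \<mu> \<xi> 2)
    + 4 * (lin \<xi> u + k * m \<xi> - c) * (k * \<mu> \<xi> 3) + k * \<mu> \<xi> 4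
    + 3 * (real k * (real k - 1)) * (\<mu> \<xi> 2)\<^sup>2"
proof (induction k arbitrary: c)
  case (Suc k)
  define v where "v = \<mu> \<xi> 2"
  define t where "t = \<mu> \<xi> 3"
  define s where "s = \<mu> \<xi> 4"
  define y where "y = lin \<xi> u + Suc k * m \<xi> - c"
  define d where "d = (\<lambda>j. \<xi> j - m \<xi>)"
  have d: "(\<Sum>j\<in>UNIV. p j * d j) = 0" "(\<Sum>j\<in>UNIV. p j * (d j)\<^sup>2) = v"
    "(\<Sum>j\<in>UNIV. p j * (d j) ^ 3) = t" "(\<Sum>j\<in>UNIV. p j * (d j) ^ 4) = s"
    by (simp_all add: d_def v_def s_def t_def \<mu>_def)
      (simp add: right_diff_distrib sum_subtractf sum_distrib_right[symmetric] p m_def)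
  define R where "R = y ^ 4 + 6 * y\<^sup>2 * (k * v) + 4 * y * (k * t) + k * s
    + 3 * (real k * (real k - 1)) * v\<^sup>2"
  have "avg p (Suc k) (\<lambda>w. (lin \<xi> w - c) ^ 4) u =
      (\<Sum>j\<in>UNIV. p j * avg p k (\<lambda>w. (lin \<xi> w - (c - \<xi> j)) ^ 4) u)"
    by (simp add: lin_add_axis algebra_simps)
  also have "\<dots> = (\<Sum>j\<in>UNIV. p j * ((y + d j) ^ 4 + 6 * (y + d j)\<^sup>2 * (k * v)
    + 4 * (y + d j) * (k * t) + k * s + 3 * (real k * (real k - 1)) * v\<^sup>2))"
    unfolding Suc by (simp add: v_def s_def t_def d_def y_def algebra_simps)
  \<comment> \<open>Sorted by powers of \<open>d j\<close>: the first-order terms cancel because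
    \<open>d\<close> is centred under \<open>p\<close>, the higher ones produce \<open>v\<close>,
    \<open>t\<close> and \<open>s\<close>.\<close>
  also have "\<dots> = (\<Sum>j\<in>UNIV. p j * R + (4 * y ^ 3 + 12 * y * k * v + 4 * k * t) * (p j * d j)
      + (6 * y\<^sup>2 + 6 * k * v) * (p j * (d j)\<^sup>2) + 4 * y * (p j * (d j) ^ 3) + p j * (d j) ^ 4)"
    by (intro sum.cong) (auto simp: R_def algebra_simps power2_eq_square power3_eq_cube power4_eq_xxxx)
  also have "\<dots> = R + (6 * y\<^sup>2 + 6 * k * v) * v + 4 * y * t + s"
    by (simp add: sum.distrib sum_distrib_left[symmetric] sum_distrib_right[symmetric] d p)
  also have "\<dots> = y ^ 4 + 6 * y\<^sup>2 * (Suc k * v) + 4 * y * (Suc k * t) + Suc k * s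
    + 3 * (real (Suc k) * (real (Suc k) - 1)) * v\<^sup>2"
    by (simp add: R_def algebra_simps power2_eq_square)
  finally show ?case unfolding v_def t_def s_def y_def .
qed simp

section \<open>Reinforcement functions\<close>

text \<open>Young's inequality with second argument 1: by concavity the power lies below its tangent
  at 1.\<close>

lemma powr_le_linear:
  assumes "0 < (z::real)" "0 \<le> a" "a \<le> 1"
  shows "z powr a \<le> 1 + a * (z - 1)"
  using Youngs_inequality_0[of a "1 - a" z 1] assms by (simp add: algebra_simps)

lemma linear_le_powr:
  assumes "0 < (z::real)" "1 \<le> b"
  shows "1 + b * (z - 1) \<le> z powr b"
proof -
  \<comment> \<open>Bernoulli's inequality is the concave case with exponent \<open>1 / b\<close>,
    applied to \<open>z powr b\<close>.\<close>
  have "(z powr b) powr (1 / b) \<le> 1 + 1 / b * (z powr b - 1)"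
    using assms by (intro powr_le_linear) auto
  then show ?thesis using assms by (simp add: powr_powr field_simps)
qed

text \<open>The quotient \<open>x * deriv f x / f x\<close> is the slope of \<open>f\<close> in
  logarithmic coordinates; a lower bound \<beta> for it makes \<open>f x / x powr \<beta>\<close>
  nondecreasing.\<close>

lemma reinforcement_powr:
  assumes "f \<in> reinforcement_class"
  obtains \<beta> where "1 < \<beta>" "\<beta> \<le> 2"
    "\<And>x y. 0 < x \<Longrightarrow> x \<le> y \<Longrightarrow> y \<le> 1 \<Longrightarrow> f x * y powr \<beta> \<le> f y * x powr \<beta>"
proof -
  from assms have mono: "strict_mono_on {0..1} f" and cont: "continuous_on {0..1} f"
    and f0: "f 0 = 0" and C1: "f C1_differentiable_on {0<..<1}"
    and inf: "(INF x\<in>{0<..<1}. x * deriv f x / f x) > 1"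
    by (auto simp: reinforcement_class_def)
  have pos: "f x > 0" if "0 < x" "x \<le> 1" for x
    using strict_mono_onD[OF mono, of 0 x] that f0 by simp
  have der: "(f has_real_derivative deriv f x) (at x)" if "x \<in> {0<..<1}" for x
    using C1 that by (metis C1_differentiable_on_eq DERIV_deriv_iff_real_differentiable)
  have der0: "deriv f x \<ge> 0" if x: "x \<in> {0<..<1}" for x
  proof (rule ccontr)
    assume "\<not> deriv f x \<ge> 0"
    then obtain d where d: "d > 0" "\<And>h. 0 < h \<Longrightarrow> h < d \<Longrightarrow> f x > f (x + h)"
      using DERIV_neg_dec_right[OF der[OF x]] by force
    define h where "h = min (d / 2) ((1 - x) / 2)"
    have "0 < h" "h < d" "x + h \<le> 1" using d x by (auto simp: h_def min_def field_simps)
    then show False using d(2)[of h] strict_mono_onD[OF mono, of x "x + h"] x by simp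
  qed
  define \<alpha> where "\<alpha> = (INF x\<in>{0<..<1}. x * deriv f x / f x)"
  \<comment> \<open>The cap at 2 serves later: it gives
    \<open>(\<beta> - 1) / 2 \<le> 1 / 2\<close>, puts \<open>\<beta> - 1\<close> into the range of
    \<open>powr_le_linear\<close>, and bounds \<open>y powr \<beta>\<close> by
    \<open>y\<^sup>2\<close> for numbers of balls \<open>y\<close>.\<close>
  define \<beta> where "\<beta> = min \<alpha> 2"
  have "\<beta> > 1" "\<beta> \<le> 2" using inf by (auto simp: \<beta>_def \<alpha>_def)
  \<comment> \<open>A real infimum is known to be a lower bound only for a set that is bounded
    below; nonnegativity of the derivative provides this.\<close>
  have "bdd_below ((\<lambda>x. x * deriv f x / f x) ` {0<..<1})"
    by (rule bdd_belowI2[of _ 0]) (use der0 less_imp_le[OF pos] in \<open>auto intro!: divide_nonneg_nonneg mult_nonneg_nonneg\<close>)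
  then have le: "\<beta> * f x \<le> x * deriv f x" if "x \<in> {0<..<1}" for x
  proof -
    have "\<beta> \<le> x * deriv f x / f x"
      using cINF_lower[OF \<open>bdd_below _\<close> that] by (simp add: \<beta>_def \<alpha>_def)
    then show ?thesis using pos[of x] that by (simp add: field_simps)
  qed
  have "f x * y powr \<beta> \<le> f y * x powr \<beta>" if xy: "0 < x" "x \<le> y" "y \<le> 1" for x y
  proof (cases "x = y")
    case False
    then have "x < y" using xy by simp
    \<comment> \<open>Derivatives are available only in the open interval; continuity covers the end
      point \<open>y = 1\<close>.\<close>
    have "f x * x powr (- \<beta>) \<le> f y * y powr (- \<beta>)"
    proof (rule DERIV_nonneg_imp_increasing_open[OF \<open>x \<le> y\<close>])
      fix t assume t: "x < t" "t < y"
      then have t01: "t \<in> {0<..<1}" using xy by auto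
      have "((\<lambda>t. f t * t powr (- \<beta>)) has_real_derivative
          (deriv f t * t powr (- \<beta>) + f t * (- \<beta> * t powr (- \<beta> - 1)))) (at t)"
        using t01 by (auto intro!: derivative_eq_intros der)
      moreover have "deriv f t * t powr (- \<beta>) + f t * (- \<beta> * t powr (- \<beta> - 1)) =
          t powr (- \<beta> - 1) * (t * deriv f t - \<beta> * f t)"
        using t01 by (simp add: powr_diff field_simps)
      ultimately show "\<exists>z. ((\<lambda>t. f t * t powr (- \<beta>)) has_real_derivative z) (at t) \<and> 0 \<le> z"
        using le[OF t01] by (metis diff_ge_0_iff_ge mult_nonneg_nonneg powr_ge_zero)
    next
      show "continuous_on {x..y} (\<lambda>t. f t * t powr (- \<beta>))"
        using xy by (intro continuous_intros continuous_on_subset[OF cont]) auto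
    qed
    then show ?thesis using xy by (simp add: powr_minus field_simps)
  qed simp
  then show ?thesis using that \<open>\<beta> > 1\<close> \<open>\<beta> \<le> 2\<close> by blast
qed

text \<open>From here on \<open>powr_mono\<close>, the integrated form of the slope condition,
  stands in for derivatives.\<close>

locale reinforcement =
  fixes f :: "real \<Rightarrow> real" and \<beta> :: real
  assumes cont: "continuous_on {0..1} f" and f0: "f 0 = 0" and f1: "f 1 = 1"
    and pos: "\<And>x. 0 < x \<Longrightarrow> x \<le> 1 \<Longrightarrow> 0 < f x"
    and \<beta>1: "1 < \<beta>" and \<beta>2: "\<beta> \<le> 2"
    and powr_mono: "\<And>x y. 0 < x \<Longrightarrow> x \<le> y \<Longrightarrow> y \<le> 1 \<Longrightarrow> f x * y powr \<beta> \<le> f y * x powr \<beta>"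
begin

lemma nonneg: "0 \<le> x \<Longrightarrow> x \<le> 1 \<Longrightarrow> 0 \<le> f x"
  using pos[of x] f0 by (cases "x = 0") auto

lemma le_powr: "0 \<le> x \<Longrightarrow> x \<le> 1 \<Longrightarrow> f x \<le> x powr \<beta>"
  using powr_mono[of x 1] f0 f1 by (cases "x = 0") auto

lemma le_self: "0 \<le> x \<Longrightarrow> x \<le> 1 \<Longrightarrow> f x \<le> x"
  using le_powr[of x] powr_mono'[of 1 \<beta> x] \<beta>1 by auto

text \<open>Bernoulli's inequality for \<open>(y / x) powr \<beta>\<close>.\<close>
lemma diff_ge:
  assumes "0 < x" "x \<le> y" "y \<le> 1"
  shows "\<beta> * f x * (y - x) \<le> x * (f y - f x)"
proof -
  have "f x * (y / x) powr \<beta> \<le> f y"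
    using powr_mono[OF assms] assms by (simp add: powr_divide field_simps)
  moreover have "1 + \<beta> * (y / x - 1) \<le> (y / x) powr \<beta>"
    using assms \<beta>1 by (intro linear_le_powr) auto
  then have "f x * (1 + \<beta> * (y / x - 1)) \<le> f x * (y / x) powr \<beta>"
    using pos[of x] assms by (intro mult_left_mono) auto
  ultimately have "f x * (1 + \<beta> * (y / x - 1)) \<le> f y" by linarith
  then have "x * (f x * (1 + \<beta> * (y / x - 1))) \<le> x * f y"
    using assms by (intro mult_left_mono) auto
  moreover have "x * (f x * (1 + \<beta> * (y / x - 1))) = x * f x + \<beta> * f x * (y - x)"
    using assms by (simp add: field_simps)
  ultimately show ?thesis by (simp add: algebra_simps)
qed

lemma mono: "0 \<le> x \<Longrightarrow> x \<le> y \<Longrightarrow> y \<le> 1 \<Longrightarrow> f x \<le> f y"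
proof (cases "x = 0")
  case False
  assume a: "0 \<le> x" "x \<le> y" "y \<le> 1"
  then have "0 \<le> \<beta> * f x * (y - x)" using nonneg \<beta>1 by auto
  then have "0 \<le> x * (f y - f x)" using diff_ge[of x y] a False by auto
  then show ?thesis using a False by (auto simp: zero_le_mult_iff)
qed (use nonneg f0 in auto)

lemma quotient_strict_mono:
  assumes "0 < x" "x < y" "y \<le> 1"
  shows "f x * y < f y * x"
proof -
  have "f x * (y - x) < \<beta> * f x * (y - x)"
    using assms pos[of x] \<beta>1 by simp
  also have "\<dots> \<le> x * (f y - f x)" using diff_ge assms by simp
  finally show ?thesis by (simp add: algebra_simps)
qed

text \<open>For positive arguments the second factor is \<open>x * y\<close> times the difference of
  the quotients \<open>f x / x\<close> and \<open>f y / y\<close>, so it has the sign of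
  \<open>x - y\<close>.\<close>

lemma pair_term:
  assumes "0 \<le> x" "x \<le> 1" "0 \<le> y" "y \<le> 1"
  shows "0 \<le> (x - y) * (f x * y - f y * x)"
    and "(x - y) * (f x * y - f y * x) = 0 \<longleftrightarrow> x = 0 \<or> y = 0 \<or> x = y"
proof -
  consider "x = 0 \<or> y = 0 \<or> x = y" | "0 < x" "x < y" | "0 < y" "y < x"
    using assms by linarith
  then have "0 \<le> (x - y) * (f x * y - f y * x) \<and>
    ((x - y) * (f x * y - f y * x) = 0 \<longleftrightarrow> x = 0 \<or> y = 0 \<or> x = y)"
  proof cases
    case 2
    then show ?thesis using quotient_strict_mono[of x y] assms
      by (auto intro!: mult_nonpos_nonpos)
  next
    case 3
    then show ?thesis using quotient_strict_mono[of y x] assms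
      by (auto intro!: mult_nonneg_nonneg)
  qed (auto simp: f0)
  then show "0 \<le> (x - y) * (f x * y - f y * x)"
    and "(x - y) * (f x * y - f y * x) = 0 \<longleftrightarrow> x = 0 \<or> y = 0 \<or> x = y" by auto
qed

end

lemma reinforcement_classD:
  assumes "f \<in> reinforcement_class"
  obtains \<beta> where "reinforcement f \<beta>"
proof -
  obtain \<beta> where "1 < \<beta>" "\<beta> \<le> 2"
    "\<And>x y. 0 < x \<Longrightarrow> x \<le> y \<Longrightarrow> y \<le> 1 \<Longrightarrow> f x * y powr \<beta> \<le> f y * x powr \<beta>"
    using reinforcement_powr[OF assms] by blast
  moreover from assms have "strict_mono_on {0..1} f" "f 0 = 0"
    by (auto simp: reinforcement_class_def)
  then have "0 < f x" if "0 < x" "x \<le> 1" for x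
    using strict_mono_onD[of "{0..1}" f 0 x] that by simp
  ultimately show ?thesis
    using assms by (intro that[of \<beta>], unfold_locales) (auto simp: reinforcement_class_def)
qed

section \<open>Repulsion of two colours\<close>

text \<open>Averages a quartic majorant centred at the mean \<open>B\<close>: the linear term
  vanishes and the square yields the variance. Without a cubic term, third moments do not arise. The
  constant 19 is 16, from \<open>\<bar>\<xi> j - m\<bar> \<le> 2\<close>, plus 3 from the pairs of
  balls.\<close>

lemma avg_quartic_le:
  fixes p :: "'d::finite \<Rightarrow> real" and u :: "nat ^ 'd" and k :: nat and m v B :: real
  assumes p: "\<And>j. p j \<ge> 0" "sum p UNIV = 1" and \<xi>: "\<And>j. \<bar>\<xi> j\<bar> \<le> 1"
  defines "m \<equiv> \<Sum>j\<in>UNIV. p j * \<xi> j"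
  defines "v \<equiv> \<Sum>j\<in>UNIV. p j * (\<xi> j - m)\<^sup>2"
  defines "B \<equiv> lin \<xi> u + k * m"
  assumes \<phi>: "\<And>w. \<phi> w \<le> a0 + a1 * (lin \<xi> w - B) + a2 * (lin \<xi> w - B)\<^sup>2 + a4 * (lin \<xi> w - B) ^ 4"
    and a4: "a4 \<ge> 0"
  shows "avg p k \<phi> u \<le> a0 + a2 * (k * v) + a4 * (19 * (real k)\<^sup>2)" and "v \<le> 1"
proof -
  have m1: "\<bar>m\<bar> \<le> 1"
  proof -
    have "\<bar>m\<bar> \<le> (\<Sum>j\<in>UNIV. \<bar>p j * \<xi> j\<bar>)" unfolding m_def by (rule sum_abs)
    also have "\<dots> \<le> (\<Sum>j\<in>UNIV. p j)"
      by (intro sum_mono) (use p(1) \<xi> in \<open>simp add: abs_mult mult_left_le\<close>)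
    finally show ?thesis using p by simp
  qed
  show v1: "v \<le> 1"
  proof -
    have "v = (\<Sum>j\<in>UNIV. p j * (\<xi> j)\<^sup>2 - 2 * m * (p j * \<xi> j) + p j * m\<^sup>2)"
      unfolding v_def by (intro sum.cong) (auto simp: power2_eq_square algebra_simps)
    also have "\<dots> = (\<Sum>j\<in>UNIV. p j * (\<xi> j)\<^sup>2) - 2 * m * m + m\<^sup>2"
      by (simp add: sum.distrib sum_subtractf sum_distrib_left[symmetric]
          sum_distrib_right[symmetric] p flip: m_def)
    also have "\<dots> \<le> (\<Sum>j\<in>UNIV. p j * 1)"
    proof -
      have "(\<Sum>j\<in>UNIV. p j * (\<xi> j)\<^sup>2) \<le> (\<Sum>j\<in>UNIV. p j * 1)"
        by (intro sum_mono mult_left_mono p) (use \<xi> in \<open>simp add: abs_square_le_1\<close>)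
      moreover have "- 2 * m * m + m\<^sup>2 \<le> 0" by (simp add: power2_eq_square)
      ultimately show ?thesis by linarith
    qed
    finally show ?thesis using p by simp
  qed
  have v0: "v \<ge> 0" unfolding v_def by (intro sum_nonneg mult_nonneg_nonneg p) auto
  define s where "s = (\<Sum>j\<in>UNIV. p j * (\<xi> j - m) ^ 4)"
  have s: "s \<le> 16"
  proof -
    have "s \<le> (\<Sum>j\<in>UNIV. p j * 16)"
      unfolding s_def
    proof (intro sum_mono mult_left_mono)
      fix j have "\<bar>\<xi> j - m\<bar> \<le> 2" using \<xi>[of j] m1 by linarith
      then have "\<bar>\<xi> j - m\<bar> ^ 4 \<le> 2 ^ 4" by (intro power_mono) auto
      then show "(\<xi> j - m) ^ 4 \<le> 16" by simp
    qed (use p in auto)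
    then show ?thesis using p by (simp flip: sum_distrib_right)
  qed
  have "avg p k (\<lambda>w. (lin \<xi> w - B) ^ 4) u = k * s + 3 * (real k * (real k - 1)) * v\<^sup>2"
    using avg_lin_pow4[OF p(2), of k \<xi> B u] by (simp add: B_def s_def v_def flip: m_def)
  also have "\<dots> \<le> 16 * (real k)\<^sup>2 + 3 * (real k)\<^sup>2"
  proof (intro add_mono)
    have "real k \<le> (real k)\<^sup>2" by (cases "k = 0") (auto simp: power2_eq_square)
    moreover have "k * s \<le> real k * 16" using s by (intro mult_left_mono) auto
    ultimately show "k * s \<le> 16 * (real k)\<^sup>2" by linarith
    have "v\<^sup>2 \<le> 1" using v0 v1 by (simp add: power_le_one)
    moreover have "0 \<le> real k * (real k - 1)" by (cases "k = 0") auto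
    ultimately have "(real k * (real k - 1)) * v\<^sup>2 \<le> (real k * (real k - 1)) * 1"
      by (intro mult_left_mono)
    then show "3 * (real k * (real k - 1)) * v\<^sup>2 \<le> 3 * (real k)\<^sup>2"
      by (simp add: power2_eq_square algebra_simps) 
  qed
  finally have 4: "avg p k (\<lambda>w. (lin \<xi> w - B) ^ 4) u \<le> 19 * (real k)\<^sup>2" by simp
  have 2: "avg p k (\<lambda>w. (lin \<xi> w - B)\<^sup>2) u = k * v"
    using avg_lin_square[OF p(2), of k \<xi> B u] by (simp add: B_def v_def flip: m_def)
  have 1: "avg p k (\<lambda>w. lin \<xi> w - B) u = 0"
    using avg_lin[OF p(2), of k \<xi> B u] by (simp add: B_def flip: m_def)
  have "avg p k \<phi> u \<le> avg p k (\<lambda>w. a0 + a1 * (lin \<xi> w - B) + a2 * (lin \<xi> w - B)\<^sup>2 + a4 * (lin \<xi> w - B) ^ 4) u"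
    by (intro avg_mono p \<phi>)
  also have "\<dots> = a0 + a2 * (k * v) + a4 * avg p k (\<lambda>w. (lin \<xi> w - B) ^ 4) u"
    by (simp add: avg_add avg_cmult avg_const[OF p(2)] 1 2)
  also have "\<dots> \<le> a0 + a2 * (k * v) + a4 * (19 * (real k)\<^sup>2)"
    using 4 a4 by (intro add_left_mono mult_left_mono)
  finally show "avg p k \<phi> u \<le> a0 + a2 * (k * v) + a4 * (19 * (real k)\<^sup>2)" .
qed

text \<open>Exact second-order expansion of \<open>1 / Q\<close> at \<open>R\<close>: the remainder
  is \<open>z\<^sup>2 / (R\<^sup>2 * Q)\<close> with \<open>z = Q - R\<close>, and there
  \<open>Q\<close> is bounded below by \<open>A\<close>.\<close>

lemma inverse_quadratic_le:
  fixes B S A :: real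
  assumes "A > 0"
  defines "R \<equiv> A + B\<^sup>2"
  shows "1 / (A + (B + S)\<^sup>2) \<le>
    1 / R + (- (2 * B / R\<^sup>2)) * S + (8 * B\<^sup>2 / A - 1) / R\<^sup>2 * S\<^sup>2 + 2 / (R\<^sup>2 * A) * S ^ 4"
proof -
  define Q where "Q = A + (B + S)\<^sup>2"
  define z where "z = 2 * B * S + S\<^sup>2"
  have R: "R > 0" and Q: "Q > 0" "Q \<ge> A"
    using assms by (auto simp: Q_def add_pos_nonneg)
  have Qz: "z = Q - R" by (simp add: Q_def R_def z_def power2_eq_square algebra_simps)
  have "1 / Q = 1 / R - z / R\<^sup>2 + z\<^sup>2 / (R\<^sup>2 * Q)"
    using R Q unfolding Qz by (simp add: field_simps power2_eq_square)
  moreover have "z\<^sup>2 / (R\<^sup>2 * Q) \<le> (8 * B\<^sup>2 * S\<^sup>2 + 2 * S ^ 4) / (R\<^sup>2 * A)"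
  proof (rule frac_le)
    \<comment> \<open>This square removes the cubic term of \<open>z\<^sup>2\<close> at the price of
      doubling the other two.\<close>
    have "0 \<le> (2 * B * S - S\<^sup>2)\<^sup>2" by simp
    then show "z\<^sup>2 \<le> 8 * B\<^sup>2 * S\<^sup>2 + 2 * S ^ 4"
      by (simp add: z_def power2_eq_square power4_eq_xxxx algebra_simps)
  qed (use R Q assms in auto)
  moreover have "1 / R - z / R\<^sup>2 + (8 * B\<^sup>2 * S\<^sup>2 + 2 * S ^ 4) / (R\<^sup>2 * A) =
      1 / R + (- (2 * B / R\<^sup>2)) * S + (8 * B\<^sup>2 / A - 1) / R\<^sup>2 * S\<^sup>2 + 2 / (R\<^sup>2 * A) * S ^ 4"
  proof -
    define P where "P = R\<^sup>2"
    then have "P \<noteq> 0" using R by simp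
    then show ?thesis unfolding P_def[symmetric] using assms(1) by (simp add: z_def field_simps)
  qed
  ultimately show ?thesis unfolding Q_def[symmetric] by linarith
qed

text \<open>Follows from \<open>ln y \<le> y - 1\<close> at \<open>y = R / Q\<close>. Bounding
  \<open>Q\<close> below by \<open>A\<close> throughout would leave a factor
  \<open>B\<^sup>2 / A\<close> in the quadratic coefficient; instead
  \<open>(2 * B + S)\<^sup>2\<close> is compared with \<open>Q\<close> itself, which keeps this
  coefficient at \<open>6 / R\<close>.\<close>

lemma minus_ln_quadratic_le:
  fixes B S A :: real
  assumes "A > 0"
  defines "R \<equiv> A + B\<^sup>2"
  shows "- ln (A + (B + S)\<^sup>2) \<le>
    - ln R + (- (2 * B / R)) * S + 6 / R * S\<^sup>2 + 4 / (R * A) * S ^ 4"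
proof -
  define Q where "Q = A + (B + S)\<^sup>2"
  define z where "z = 2 * B * S + S\<^sup>2"
  have R: "R > 0" and Q: "Q > 0" "Q \<ge> A" "Q \<ge> (B + S)\<^sup>2"
    using assms by (auto simp: Q_def R_def add_pos_nonneg)
  have Qz: "z = Q - R" by (simp add: Q_def R_def z_def power2_eq_square algebra_simps)
  have "ln R - ln Q \<le> R / Q - 1"
    using ln_le_minus_one[of "R / Q"] R Q by (simp add: ln_div)
  also have "R / Q - 1 = - z / R + z\<^sup>2 / (R * Q)"
    using R Q unfolding Qz by (simp add: field_simps power2_eq_square)
  also have "z\<^sup>2 / (R * Q) \<le> 6 / R * S\<^sup>2 + 4 / (R * A) * S ^ 4"
  proof -
    have "6 * (B + S)\<^sup>2 + 4 * S\<^sup>2 - (2 * B + S)\<^sup>2 = 2 * (B + 2 * S)\<^sup>2 + S\<^sup>2"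
      by (simp add: power2_eq_square algebra_simps)
    moreover have "0 \<le> 2 * (B + 2 * S)\<^sup>2 + S\<^sup>2" by simp
    ultimately have "(2 * B + S)\<^sup>2 \<le> 6 * (B + S)\<^sup>2 + 4 * S\<^sup>2" by linarith
    then have "(2 * B + S)\<^sup>2 \<le> 6 * Q + 4 * S\<^sup>2" using Q by linarith
    then have "S\<^sup>2 * (2 * B + S)\<^sup>2 / (R * Q) \<le> S\<^sup>2 * (6 * Q + 4 * S\<^sup>2) / (R * Q)"
      using R Q by (intro divide_right_mono mult_left_mono) auto
    also have "\<dots> = 6 / R * S\<^sup>2 + 4 * S ^ 4 / (R * Q)"
      using R Q by (simp add: field_simps power2_eq_square power4_eq_xxxx)
    also have "4 * S ^ 4 / (R * Q) \<le> 4 * S ^ 4 / (R * A)"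
      using R Q assms by (intro divide_left_mono) auto
    finally show ?thesis by (simp add: z_def power2_eq_square algebra_simps)
  qed
  also have "- z / R + (6 / R * S\<^sup>2 + 4 / (R * A) * S ^ 4) \<le>
      (- (2 * B / R)) * S + 6 / R * S\<^sup>2 + 4 / (R * A) * S ^ 4"
    using R by (simp add: z_def field_simps)
  finally show ?thesis unfolding Q_def[symmetric] by simp
qed

text \<open>Here \<open>D\<close> is the difference of two colours among \<open>t\<close> balls, and \<open>D + k * m\<close> its expectation after
  the addition of \<open>k\<close> balls.\<close>

lemma expanding_drift:
  fixes t k D m \<kappa> :: real
  assumes "t > 0" "k \<ge> 0" "\<kappa> \<ge> 0" and m: "(1 + \<kappa>) * D\<^sup>2 \<le> t * (m * D)"
  shows "D\<^sup>2 / t * ((t + k) / t + 2 * \<kappa> * (k / (t + k))) \<le> (D + k * m)\<^sup>2 / (t + k)"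
proof -
  \<comment> \<open>The hypothesis forces \<open>\<bar>D\<bar> \<le> t * \<bar>m\<bar>\<close>; this
    controls the term quadratic in \<open>k\<close>, while the hypothesis itself controls the linear
    one.\<close>
  have "D\<^sup>2 \<le> (t * m)\<^sup>2"
  proof (cases "D = 0")
    case False
    have "1 * D\<^sup>2 \<le> (1 + \<kappa>) * D\<^sup>2" using assms by (intro mult_right_mono) auto
    then have "D\<^sup>2 \<le> \<bar>t * (m * D)\<bar>" using m by linarith
    then have "\<bar>D\<bar> * \<bar>D\<bar> \<le> \<bar>t * m\<bar> * \<bar>D\<bar>" by (simp add: abs_mult power2_eq_square mult_ac)
    then have "\<bar>D\<bar> \<le> \<bar>t * m\<bar>" by (rule mult_right_le_imp_le) (use False in simp)
    then show ?thesis by (simp add: abs_le_square_iff)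
  qed simp
  then have "k\<^sup>2 * D\<^sup>2 \<le> k\<^sup>2 * (t * m)\<^sup>2" by (intro mult_left_mono) auto
  moreover have "2 * k * t * ((1 + \<kappa>) * D\<^sup>2) \<le> 2 * k * t * (t * (m * D))"
    using m assms by (intro mult_left_mono) auto
  \<comment> \<open>The factor of \<open>D\<^sup>2\<close> equals
    \<open>(t + k)\<^sup>2 + 2 * \<kappa> * k * t\<close>; dividing by
    \<open>t\<^sup>2 * (t + k)\<close> gives the claimed form.\<close>
  ultimately have "D\<^sup>2 * (t\<^sup>2 + 2 * (1 + \<kappa>) * k * t + k\<^sup>2) \<le> (D + k * m)\<^sup>2 * t\<^sup>2"
  proof -
    have "(D + k * m)\<^sup>2 * t\<^sup>2 - D\<^sup>2 * (t\<^sup>2 + 2 * (1 + \<kappa>) * k * t + k\<^sup>2) =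
        (k\<^sup>2 * (t * m)\<^sup>2 - k\<^sup>2 * D\<^sup>2) +
        (2 * k * t * (t * (m * D)) - 2 * k * t * ((1 + \<kappa>) * D\<^sup>2))"
      by algebra
    moreover assume "k\<^sup>2 * D\<^sup>2 \<le> k\<^sup>2 * (t * m)\<^sup>2"
      "2 * k * t * ((1 + \<kappa>) * D\<^sup>2) \<le> 2 * k * t * (t * (m * D))"
    ultimately show ?thesis by linarith
  qed
  then have "D\<^sup>2 * (t\<^sup>2 + 2 * (1 + \<kappa>) * k * t + k\<^sup>2) / (t\<^sup>2 * (t + k)) \<le> (D + k * m)\<^sup>2 * t\<^sup>2 / (t\<^sup>2 * (t + k))"
    using assms by (intro divide_right_mono) auto
  also have "\<dots> = (D + k * m)\<^sup>2 / (t + k)" using assms by simp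
  also have "D\<^sup>2 * (t\<^sup>2 + 2 * (1 + \<kappa>) * k * t + k\<^sup>2) / (t\<^sup>2 * (t + k)) =
     D\<^sup>2 / t * ((t + k) / t + 2 * \<kappa> * (k / (t + k)))"
    using assms by (simp add: field_simps power2_eq_square add_pos_nonneg)
  finally show ?thesis .
qed

text \<open>Here \<beta> is not the exponent: \<open>x\<close> is the squared difference over the
  old total, \<beta> the squared mean difference over the new total, and \<open>v\<close> the
  variance of one ball. Growth from \<open>x\<close> to \<beta> lowers the reciprocal; half of this
  gain pays for the harmful variance term \<open>\<beta> / 2\<close>, the other half and the helpful
  \<open>- 1\<close> remain.\<close>

lemma inverse_drift:
  fixes x \<beta> \<epsilon> v s :: real
  assumes x: "x \<ge> 0" "x \<le> \<beta> * (1 - \<epsilon>)" and \<epsilon>: "0 \<le> \<epsilon>" "\<epsilon> < 1" and v: "s \<le> v" "v \<le> 1" and s: "0 < s"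
  shows "1 / (16 + \<beta>) + ((\<beta> / 2 - 1) * (\<epsilon> * v)) / (16 + \<beta>)\<^sup>2
    \<le> 1 / (16 + x) - s / 64 * \<epsilon> / (16 + x)"
proof -
  have "0 \<le> \<beta> * (1 - \<epsilon>)" using x by linarith
  then have \<beta>: "\<beta> \<ge> 0" using \<epsilon> by (simp add: zero_le_mult_iff)
  then have "\<beta> * (1 - \<epsilon>) \<le> \<beta> * 1" using \<epsilon> by (intro mult_left_mono) auto
  define q where "q = 16 + x"
  define r where "r = 16 + \<beta>"
  have qr: "0 < q" "q \<le> r" "0 < r" "16 \<le> q"
    using x \<epsilon> \<beta> \<open>_ \<le> \<beta> * 1\<close> by (auto simp: q_def r_def)
  have "1 / q - 1 / r = (\<beta> - x) / (q * r)"
    using qr by (simp add: field_simps) (simp add: q_def r_def)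
  also have "\<dots> \<ge> \<epsilon> * \<beta> / (q * r)"
    using x qr by (intro divide_right_mono) (auto simp: algebra_simps)
  finally have 1: "1 / r \<le> 1 / q - \<epsilon> * \<beta> / (q * r)" by simp
  have "(\<beta> / 2) * (\<epsilon> * v) / r\<^sup>2 \<le> (\<beta> / 2) * (\<epsilon> * 1) / (q * r)"
    unfolding power2_eq_square using \<beta> \<epsilon> v s qr
    by (intro frac_le mult_left_mono mult_right_mono mult_pos_pos mult_nonneg_nonneg) auto
  then have 2: "1 / r + (\<beta> / 2 - 1) * (\<epsilon> * v) / r\<^sup>2 \<le> 1 / q - \<epsilon> * \<beta> / (2 * (q * r)) - \<epsilon> * v / r\<^sup>2"
  proof -
    have *: "a + (X - Y) \<le> c - E - Y" if "a \<le> c - 2 * E" "X \<le> E" for a c X Y E :: real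
      using that by linarith
    have eq: "(\<beta> / 2 - 1) * (\<epsilon> * v) / r\<^sup>2 = (\<beta> / 2) * (\<epsilon> * v) / r\<^sup>2 - \<epsilon> * v / r\<^sup>2"
      by (simp add: left_diff_distrib diff_divide_distrib)
    show ?thesis unfolding eq
    proof (rule *)
      show "(\<beta> / 2) * (\<epsilon> * v) / r\<^sup>2 \<le> \<epsilon> * \<beta> / (2 * (q * r))"
        using \<open>(\<beta> / 2) * (\<epsilon> * v) / r\<^sup>2 \<le> _\<close> by (simp add: mult_ac)
    qed (use 1 in simp)
  qed
  \<comment> \<open>For \<open>\<beta> \<ge> 16\<close> the remaining half of the growth suffices,
    since \<open>\<beta> / (2 * r) \<ge> 1 / 4\<close>. Otherwise \<open>r \<le> 32\<close>, and the
    noise suffices because \<open>64 * 16 = 32\<^sup>2\<close>.\<close>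
  have "s / 64 * \<epsilon> / q \<le> \<epsilon> * \<beta> / (2 * (q * r)) + \<epsilon> * v / r\<^sup>2"
  proof (cases "\<beta> \<ge> 16")
    case True
    have "s / 64 * \<epsilon> / q \<le> (\<beta> / (2 * r)) * \<epsilon> / q"
    proof (intro divide_right_mono mult_right_mono)
      have "s / 64 \<le> 1 / 4" using s v by simp
      also have "\<dots> \<le> \<beta> / (2 * r)" using True by (simp add: r_def field_simps)
      finally show "s / 64 \<le> \<beta> / (2 * r)" .
    qed (use \<epsilon> qr in auto)
    also have "\<dots> = \<epsilon> * \<beta> / (2 * (q * r))" by (simp add: mult_ac)
    finally have "s / 64 * \<epsilon> / q \<le> \<epsilon> * \<beta> / (2 * (q * r))" .
    moreover have "\<epsilon> * v / r\<^sup>2 \<ge> 0" using \<epsilon> v s by simp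
    ultimately show ?thesis by linarith
  next
    case False
    have "s / 64 * \<epsilon> / q \<le> s / 64 * \<epsilon> / 16"
      using qr \<epsilon> s by (intro divide_left_mono) auto
    also have "\<dots> = \<epsilon> * s / 32\<^sup>2" by simp
    also have "\<dots> \<le> \<epsilon> * v / r\<^sup>2"
    proof (intro frac_le mult_left_mono)
      show "r\<^sup>2 \<le> 32\<^sup>2" using False \<beta> by (intro power_mono) (auto simp: r_def)
    qed (use \<epsilon> v s qr in auto)
    finally have "s / 64 * \<epsilon> / q \<le> \<epsilon> * v / r\<^sup>2" .
    moreover have "\<epsilon> * \<beta> / (2 * (q * r)) \<ge> 0" using \<epsilon> \<beta> qr by simp
    ultimately show ?thesis by linarith
  qed
  then show ?thesis using 2 unfolding q_def r_def by linarith
qed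

text \<open>The part \<open>x\<close> of \<open>16 + x\<close> grows fast enough for a gain of
  \<open>2 * \<kappa> * \<epsilon>\<close> after division by \<open>a\<close>, while the constant 16
  does not grow and costs at most \<open>32 * \<epsilon> / (16 + x)\<close>. The quadratic errors of
  the logarithm and of \<open>g\<close> stay below \<open>10 * \<epsilon>\<^sup>2\<close>.\<close>

lemma ln_drift:
  fixes x \<beta> \<epsilon> a \<kappa> :: real
  assumes x: "x \<ge> 0" "x * (a + 2 * \<kappa> * \<epsilon>) \<le> \<beta>" and a: "a * (1 - \<epsilon>) = 1" and \<epsilon>: "0 \<le> \<epsilon>" "\<epsilon> \<le> 1 / 4"
    and \<kappa>: "0 \<le> \<kappa>" "\<kappa> \<le> 1 / 2"
  shows "ln (16 + x) + 2 * \<kappa> * \<epsilon> - 32 * \<epsilon> / (16 + x) - 10 * \<epsilon>\<^sup>2 \<le> ln ((16 + \<beta>) / a)"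
proof -
  have "0 < a * (1 - \<epsilon>)" using a by simp
  then have a0: "a > 0" using \<epsilon> by (simp add: zero_less_mult_iff)
  have ia: "1 / a = 1 - \<epsilon>" using a a0 by (simp add: field_simps)
  define q where "q = 16 + x"
  have q: "q \<ge> 16" using x by (simp add: q_def)
  define g where "g = 2 * \<kappa> * \<epsilon> * (1 - \<epsilon>)"
  define c where "c = g + \<epsilon>"
  \<comment> \<open>The relative increase, defined so that \<open>q * (1 + y)\<close> is the lower
    bound for \<open>(16 + \<beta>) / a\<close> obtained from the growth hypothesis.\<close>
  define y where "y = g - 16 * c / q"
  have "g \<le> 1 * \<epsilon> * 1"
    unfolding g_def using \<epsilon> \<kappa> by (intro mult_mono) auto
  then have le: "0 \<le> g" "g \<le> \<epsilon>" using \<epsilon> \<kappa> by (auto simp: g_def)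
  have c: "0 \<le> c" "c \<le> 2 * \<epsilon>" using \<epsilon> \<kappa> le by (auto simp: c_def)
  have "c * 16 \<le> c * q" using q c by (intro mult_left_mono) auto
  then have "16 * c / q \<le> c" using q by (simp add: field_simps)
  moreover have "0 \<le> 16 * c / q" using q c by simp
  ultimately have y: "\<bar>y\<bar> \<le> 2 * \<epsilon>" "- \<epsilon> \<le> y" using c le unfolding y_def c_def by linarith+
  have "q * (1 + y) = (16 + x * (a + 2 * \<kappa> * \<epsilon>)) / a"
  proof -
    have "(16 + x * (a + 2 * \<kappa> * \<epsilon>)) / a = 16 * (1 / a) + x * (a * (1 / a)) + x * 2 * \<kappa> * \<epsilon> * (1 / a)"
      by (simp add: field_simps)
    also have "\<dots> = 16 * (1 - \<epsilon>) + x + x * g"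
      unfolding ia using a by (simp add: g_def)
    also have "\<dots> = q + q * g - 16 * c"
      by (simp add: q_def c_def algebra_simps)
    also have "\<dots> = q * (1 + y)"
      using q by (simp add: y_def right_diff_distrib distrib_left)
    finally show ?thesis by simp
  qed
  also have "\<dots> \<le> (16 + \<beta>) / a" using x a0 by (intro divide_right_mono) auto
  finally have "ln (q * (1 + y)) \<le> ln ((16 + \<beta>) / a)"
    using q y \<epsilon> by (intro ln_mono) (auto intro!: mult_pos_pos)
  moreover have "ln (q * (1 + y)) = ln q + ln (1 + y)"
    using q y \<epsilon> by (simp add: ln_mult)
  moreover have "ln (1 + y) \<ge> y - 2 * y\<^sup>2"
    using abs_ln_one_plus_x_minus_x_bound[of y] y \<epsilon> by simp
  moreover have "y\<^sup>2 \<le> 4 * \<epsilon>\<^sup>2"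
    using power_mono[OF y(1), of 2] by (simp add: power_mult_distrib)
  moreover have "y \<ge> 2 * \<kappa> * \<epsilon> - \<epsilon>\<^sup>2 - 32 * \<epsilon> / q"
  proof -
    have "16 * c / q \<le> 32 * \<epsilon> / q" using c q by (intro divide_right_mono) auto
    moreover have "2 * \<kappa> * \<epsilon>\<^sup>2 \<le> 1 * \<epsilon>\<^sup>2" using \<kappa> by (intro mult_right_mono) auto
    moreover have "g = 2 * \<kappa> * \<epsilon> - 2 * \<kappa> * \<epsilon>\<^sup>2"
      by (simp add: g_def algebra_simps power2_eq_square)
    ultimately show ?thesis unfolding y_def by linarith
  qed
  moreover have "0 \<le> \<epsilon>\<^sup>2" by simp
  ultimately show ?thesis unfolding q_def[symmetric] by linarith
qed

text \<open>With \<open>t\<close> balls, fluctuations of a difference \<open>d\<close> of two colours have size \<open>sqrt t\<close>. The logarithm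
  has positive drift only where \<open>d\<^sup>2 / t\<close> is large; the bounded second term, which has
  positive drift everywhere, compensates this once \<open>b\<close> is large.\<close>
definition repulsion :: "real \<Rightarrow> real \<Rightarrow> real \<Rightarrow> real" where
  "repulsion b t d = ln ((16 + d\<^sup>2 / t) / t) - b / (16 + d\<^sup>2 / t)"

section \<open>Drift of the repulsion function\<close>

definition contrast :: "'d \<Rightarrow> 'd \<Rightarrow> 'd \<Rightarrow> real" where
  "contrast i k j = of_bool (j = i) - of_bool (j = k)"

lemma lin_contrast: "lin (contrast i k) u = real (u $ i) - real (u $ k)"
  by (simp add: lin_def contrast_def left_diff_distrib sum_subtractf of_bool_def if_distrib[of "\<lambda>x. x * _"] cong: if_cong)

lemma sum_contrast: "(\<Sum>j\<in>UNIV. p j * contrast i k j) = p i - p (k :: 'd::finite)"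
  by (simp add: contrast_def right_diff_distrib sum_subtractf of_bool_def if_distrib[of "\<lambda>x. _ * x"] cong: if_cong)

text \<open>The variance is \<open>p i + p k - (p i - p k)\<^sup>2\<close>, and
  \<open>p i + p k \<le> 1\<close>. It bounds the noise from below when both colours are drawn with
  substantial probability.\<close>

lemma variance_contrast:
  fixes p :: "'d::finite \<Rightarrow> real"
  assumes p: "\<And>j. p j \<ge> 0" "sum p UNIV = 1" and "i \<noteq> k"
  shows "p i * p k \<le> (\<Sum>j\<in>UNIV. p j * (contrast i k j - (p i - p k))\<^sup>2)"
proof -
  define m where "m = p i - p k"
  have "p i + p k = sum p {i, k}" using assms by simp
  also have "\<dots> \<le> 1" unfolding p(2)[symmetric] by (intro sum_mono2) (use p in auto)
  finally have "p i + p k \<le> 1" .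
  then have "(p i + p k) * (p i + p k) \<le> p i + p k"
    using p(1)[of i] p(1)[of k] by (intro mult_left_le) auto
  moreover have "m\<^sup>2 = (p i + p k) * (p i + p k) - 4 * (p i * p k)"
    by (simp add: m_def power2_eq_square algebra_simps)
  moreover have "0 \<le> p i * p k" using p by simp
  ultimately have "p i * p k \<le> p i + p k - m\<^sup>2" by linarith
  also have "\<dots> = (\<Sum>j\<in>UNIV. (of_bool (j = i) + of_bool (j = k)) * p j) - 2 * m * m + m\<^sup>2"
    by (simp add: distrib_right sum.distrib power2_eq_square of_bool_def if_distrib[of "\<lambda>x. x * _"] cong: if_cong)
  also have "\<dots> = (\<Sum>j\<in>UNIV. (of_bool (j = i) + of_bool (j = k)) * p j -
      2 * m * (p j * contrast i k j) + p j * m\<^sup>2)"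
    by (simp add: sum.distrib sum_subtractf sum_distrib_left[symmetric]
          sum_distrib_right[symmetric] p sum_contrast flip: m_def)
  also have "\<dots> = (\<Sum>j\<in>UNIV. p j * (contrast i k j - m)\<^sup>2)"
    using \<open>i \<noteq> k\<close> by (intro sum.cong) (auto simp: contrast_def power2_eq_square algebra_simps)
  finally show ?thesis by (simp add: m_def)
qed

text \<open>The logarithm drifts upwards by \<open>2 * \<kappa> * \<epsilon>\<close> up to a loss
  \<open>38 * \<epsilon> / (16 + x)\<close>, where 32 comes from \<open>ln_drift\<close> and 6 from
  the variance. The bounded term regains \<open>b * s / 64 * \<epsilon> / (16 + x)\<close>; the
  choice \<open>b = 38 * 64 / s\<close> makes both cancel exactly.\<close>

lemma avg_repulsion:
  fixes p :: "'d::finite \<Rightarrow> real" and u :: "nat ^ 'd" and k :: nat and t s \<kappa> :: real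
  assumes p: "\<And>j. p j \<ge> 0" "sum p UNIV = 1" and i: "i \<noteq> i'"
    and t: "t > 0" and s: "0 < s" "s \<le> p i * p i'"
    and \<kappa>: "0 \<le> \<kappa>" "\<kappa> \<le> 1 / 2"
  defines "D \<equiv> \<lambda>w. real (w $ i) - real (w $ i')"
  defines "\<epsilon> \<equiv> real k / (t + k)"
  defines "b \<equiv> 2432 / s"
  assumes drift: "(1 + \<kappa>) * (D u)\<^sup>2 \<le> t * ((p i - p i') * D u)"
    and \<epsilon>4: "\<epsilon> \<le> 1 / 4"
  shows "repulsion b t (D u) + 2 * \<kappa> * \<epsilon> - (11 + b) * \<epsilon>\<^sup>2 \<le> avg p k (\<lambda>w. repulsion b (t + k) (D w)) u"
proof -
  define \<xi> where "\<xi> = contrast i i'"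
  define m where "m = p i - p i'"
  define v where "v = (\<Sum>j\<in>UNIV. p j * (\<xi> j - m)\<^sup>2)"
  define B where "B = D u + k * m"
  define t' where "t' = t + k"
  define A where "A = 16 * t'"
  define \<beta> where "\<beta> = B\<^sup>2 / t'"
  define x where "x = (D u)\<^sup>2 / t"
  define R where "R = A + B\<^sup>2"
  have t': "t' > 0" using t by (simp add: t'_def add_pos_nonneg)
  have A: "A > 0" using t' by (simp add: A_def)
  have D: "D w = lin \<xi> w" for w by (simp add: D_def \<xi>_def lin_contrast)
  have mm: "(\<Sum>j\<in>UNIV. p j * \<xi> j) = m" by (simp add: \<xi>_def m_def sum_contrast)
  have \<xi>1: "\<bar>\<xi> j\<bar> \<le> 1" for j by (simp add: \<xi>_def contrast_def)
  have k: "real k = \<epsilon> * t'" using t' by (simp add: \<epsilon>_def t'_def)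
  have R: "R = t' * (16 + \<beta>)" using t' by (simp add: R_def A_def \<beta>_def field_simps)
  have x0: "0 \<le> x" and \<beta>0: "0 \<le> \<beta>" using t t' by (auto simp: x_def \<beta>_def)
  have \<epsilon>0: "0 \<le> \<epsilon>" using t by (simp add: \<epsilon>_def)
  have r: "16 + \<beta> > 0" "16 + \<beta> \<ge> 16" using \<beta>0 by auto
  note quartic = avg_quartic_le[where p = p and \<xi> = \<xi> and k = k and u = u,
      unfolded mm, folded v_def D, folded B_def, OF p \<xi>1]
  have v1: "v \<le> 1" by (rule quartic(2)[of "\<lambda>_. 0" 0 0 0 0]) auto
  have sv: "s \<le> v"
    using variance_contrast[OF p i] s by (simp add: v_def \<xi>_def m_def)
  have "1 - \<epsilon> = t / t'"
    using t' unfolding \<epsilon>_def t'_def[symmetric] by (simp add: field_simps) (simp add: t'_def)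
  then have a: "t' / t * (1 - \<epsilon>) = 1" using t t' by simp
  have drift': "(1 + \<kappa>) * (D u)\<^sup>2 \<le> t * (m * D u)" using drift unfolding m_def .
  have grow: "x * (t' / t + 2 * \<kappa> * \<epsilon>) \<le> \<beta>"
    unfolding x_def \<beta>_def B_def t'_def \<epsilon>_def
    by (rule expanding_drift[OF t _ \<kappa>(1) drift']) simp
  have "x * (t' / t) \<le> x * (t' / t + 2 * \<kappa> * \<epsilon>)" using x0 \<kappa> \<epsilon>0 by (intro mult_left_mono) auto
  with grow have "x * (t' / t) * (1 - \<epsilon>) \<le> \<beta> * (1 - \<epsilon>)"
    using \<epsilon>4 by (intro mult_right_mono) auto
  then have x\<beta>: "x \<le> \<beta> * (1 - \<epsilon>)" by (simp only: mult.assoc a mult_1_right)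
  have "\<beta> * (1 - \<epsilon>) \<le> \<beta> * 1" using \<beta>0 \<epsilon>0 by (intro mult_left_mono) auto
  with x\<beta> have "x \<le> \<beta>" by simp

  have inv: "avg p k (\<lambda>w. 1 / (16 + (D w)\<^sup>2 / t')) u \<le> 1 / (16 + x) - s / 64 * \<epsilon> / (16 + x) + \<epsilon>\<^sup>2"
  proof -
    have "avg p k (\<lambda>w. 1 / (A + (D w)\<^sup>2)) u \<le>
        1 / R + (8 * B\<^sup>2 / A - 1) / R\<^sup>2 * (k * v) + 2 / (R\<^sup>2 * A) * (19 * (real k)\<^sup>2)"
    proof (rule quartic(1))
      fix w
      show "1 / (A + (D w)\<^sup>2) \<le> 1 / R + (- (2 * B / R\<^sup>2)) * (D w - B) +
          (8 * B\<^sup>2 / A - 1) / R\<^sup>2 * (D w - B)\<^sup>2 + 2 / (R\<^sup>2 * A) * (D w - B) ^ 4"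
        using inverse_quadratic_le[OF A, of B "D w - B"] unfolding R_def by simp
    qed (use A in simp)
    \<comment> \<open>Multiplying by \<open>t'\<close> passes to the constant
      \<open>A = 16 * t'\<close>, the form treated by \<open>inverse_quadratic_le\<close>.\<close>
    moreover have "(\<lambda>w. 1 / (16 + (D w)\<^sup>2 / t')) = (\<lambda>w. t' * (1 / (A + (D w)\<^sup>2)))"
      using t' by (simp add: A_def fun_eq_iff field_simps)
    ultimately have "avg p k (\<lambda>w. 1 / (16 + (D w)\<^sup>2 / t')) u \<le>
        t' * (1 / R + (8 * B\<^sup>2 / A - 1) / R\<^sup>2 * (k * v) + 2 / (R\<^sup>2 * A) * (19 * (real k)\<^sup>2))"
      using t' by (simp only: avg_cmult mult_le_cancel_left_pos)
    also have "\<dots> = 1 / (16 + \<beta>) + ((\<beta> / 2 - 1) * (\<epsilon> * v)) / (16 + \<beta>)\<^sup>2 + 38 / (16 * (16 + \<beta>)\<^sup>2) * \<epsilon>\<^sup>2"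
    proof -
      have "B\<^sup>2 = \<beta> * t'" using t' by (simp add: \<beta>_def)
      moreover define \<rho> where "\<rho> = 16 + \<beta>"
      moreover have "\<rho> > 0" using r by (simp add: \<rho>_def)
      ultimately show ?thesis unfolding k R A_def \<rho>_def[symmetric] using t'
        by (simp add: field_simps power2_eq_square)
    qed
    also have "38 / (16 * (16 + \<beta>)\<^sup>2) * \<epsilon>\<^sup>2 \<le> 1 * \<epsilon>\<^sup>2"
    proof (intro mult_right_mono)
      have *: "38 / (16 * X) \<le> 1" if "256 \<le> X" for X :: real using that by simp
      have "16\<^sup>2 \<le> (16 + \<beta>)\<^sup>2" using r by (intro power_mono) auto
      then show "38 / (16 * (16 + \<beta>)\<^sup>2) \<le> 1" by (intro *) simp
    qed simp
    also have "1 / (16 + \<beta>) + ((\<beta> / 2 - 1) * (\<epsilon> * v)) / (16 + \<beta>)\<^sup>2 \<le> 1 / (16 + x) - s / 64 * \<epsilon> / (16 + x)"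
      by (rule inverse_drift[OF x0 x\<beta> \<epsilon>0 _ sv v1 s(1)]) (use \<epsilon>4 in simp)
    finally show ?thesis by simp
  qed

  have ln: "ln ((16 + x) / t) + 2 * \<kappa> * \<epsilon> - 38 * \<epsilon> / (16 + x) - 11 * \<epsilon>\<^sup>2
      \<le> avg p k (\<lambda>w. ln ((16 + (D w)\<^sup>2 / t') / t')) u"
  proof -
    have "avg p k (\<lambda>w. - ln (A + (D w)\<^sup>2)) u \<le>
        - ln R + 6 / R * (k * v) + 4 / (R * A) * (19 * (real k)\<^sup>2)"
    proof (rule quartic(1))
      fix w
      show "- ln (A + (D w)\<^sup>2) \<le> - ln R + (- (2 * B / R)) * (D w - B) +
          6 / R * (D w - B)\<^sup>2 + 4 / (R * A) * (D w - B) ^ 4"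
        using minus_ln_quadratic_le[OF A, of B "D w - B"] unfolding R_def by simp
    qed (use A in \<open>simp add: R_def\<close>)
    also have "6 / R * (k * v) \<le> 6 * \<epsilon> / (16 + x)"
    proof -
      have "6 / R * (k * v) = 6 * \<epsilon> * v / (16 + \<beta>)" unfolding k R using t' r by simp
      also have "\<dots> \<le> 6 * \<epsilon> * 1 / (16 + x)"
        using v1 sv s \<epsilon>0 x0 \<open>x \<le> \<beta>\<close> by (intro frac_le mult_left_mono) auto
      finally show ?thesis by simp
    qed
    also have "4 / (R * A) * (19 * (real k)\<^sup>2) \<le> 1 * \<epsilon>\<^sup>2"
    proof -
      have "4 / (R * A) * (19 * (real k)\<^sup>2) = 76 / (16 * (16 + \<beta>)) * \<epsilon>\<^sup>2"
      proof -
        define \<rho> where "\<rho> = 16 + \<beta>"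
        moreover have "\<rho> > 0" using r by (simp add: \<rho>_def)
        ultimately show ?thesis unfolding k R A_def \<rho>_def[symmetric] using t'
          by (simp add: field_simps power2_eq_square)
      qed
      also have "\<dots> \<le> 1 * \<epsilon>\<^sup>2" using r by (intro mult_right_mono) auto
      finally show ?thesis .
    qed
    finally have 1: "avg p k (\<lambda>w. - ln (A + (D w)\<^sup>2)) u \<le> - ln R + 6 * \<epsilon> / (16 + x) + \<epsilon>\<^sup>2" by simp
    \<comment> \<open>The normalisation contributes \<open>t'\<close> twice, once inside and once
      outside the sum; one of these cancels against
      \<open>ln R = ln t' + ln (16 + \<beta>)\<close>.\<close>
    have "ln ((16 + (D w)\<^sup>2 / t') / t') = (-1) * (- ln (A + (D w)\<^sup>2)) + (- 2 * ln t')" for w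
    proof -
      have "(16 + (D w)\<^sup>2 / t') / t' = (A + (D w)\<^sup>2) / t'\<^sup>2"
        using t' by (simp add: A_def field_simps power2_eq_square)
      moreover have "A + (D w)\<^sup>2 > 0" using A by (simp add: add_pos_nonneg)
      ultimately show ?thesis using t' by (simp add: ln_div ln_realpow)
    qed
    then have "avg p k (\<lambda>w. ln ((16 + (D w)\<^sup>2 / t') / t')) u =
        - avg p k (\<lambda>w. - ln (A + (D w)\<^sup>2)) u - 2 * ln t'"
      by (simp only: avg_add avg_cmult avg_const[OF p(2)])
    moreover have "ln R = ln t' + ln (16 + \<beta>)" unfolding R using t' r by (simp add: ln_mult)
    moreover have "ln (16 + x) + 2 * \<kappa> * \<epsilon> - 32 * \<epsilon> / (16 + x) - 10 * \<epsilon>\<^sup>2 \<le> ln ((16 + \<beta>) / (t' / t))"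
      by (rule ln_drift[OF x0 grow a \<epsilon>0 \<epsilon>4 \<kappa>])
    moreover have "ln ((16 + \<beta>) / (t' / t)) = ln (16 + \<beta>) + ln t - ln t'"
      using r t t' by (simp add: ln_div ln_mult)
    moreover have "ln ((16 + x) / t) = ln (16 + x) - ln t" using x0 t by (simp add: ln_div)
    moreover have "38 * \<epsilon> / (16 + x) = 32 * \<epsilon> / (16 + x) + 6 * \<epsilon> / (16 + x)"
      by (simp flip: add_divide_distrib)
    ultimately show ?thesis using 1 by linarith
  qed
  have b: "b \<ge> 0" using s by (simp add: b_def)
  have "avg p k (\<lambda>w. repulsion b (t + k) (D w)) u =
      avg p k (\<lambda>w. ln ((16 + (D w)\<^sup>2 / t') / t')) u - b * avg p k (\<lambda>w. 1 / (16 + (D w)\<^sup>2 / t')) u"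
    by (simp add: repulsion_def avg_diff t'_def flip: avg_cmult)
  moreover have "b * avg p k (\<lambda>w. 1 / (16 + (D w)\<^sup>2 / t')) u \<le>
      b * (1 / (16 + x) - s / 64 * \<epsilon> / (16 + x) + \<epsilon>\<^sup>2)"
    using inv b by (intro mult_left_mono)
  moreover have "b * (1 / (16 + x) - s / 64 * \<epsilon> / (16 + x) + \<epsilon>\<^sup>2) =
      b / (16 + x) - 38 * \<epsilon> / (16 + x) + b * \<epsilon>\<^sup>2"
  proof -
    have "b * (s / 64) = 38" using s by (simp add: b_def)
    moreover have "b * (1 / q - s / 64 * \<epsilon> / q + \<epsilon>\<^sup>2) = b / q - (b * (s / 64)) * \<epsilon> / q + b * \<epsilon>\<^sup>2" for q
      by (simp add: algebra_simps)
    ultimately show ?thesis by (simp only:)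
  qed
  moreover have "repulsion b t (D u) = ln ((16 + x) / t) - b / (16 + x)"
    by (simp add: repulsion_def x_def)
  ultimately show ?thesis using ln by (simp add: algebra_simps)
qed

text \<open>Subtracting \<open>ln 17\<close> thus yields a nonpositive function, as
  \<open>lyapunov\<close> requires. The number 17 arises from \<open>16 / t \<le> 16\<close> and
  \<open>d\<^sup>2 / t\<^sup>2 \<le> 1\<close>.\<close>

lemma repulsion_le:
  assumes "1 \<le> t" "\<bar>d\<bar> \<le> t" "b \<ge> 0"
  shows "repulsion b t d \<le> ln 17"
proof -
  have "d\<^sup>2 \<le> t\<^sup>2" using power_mono[OF assms(2), of 2] by simp
  moreover have "1 * t \<le> t * t" using assms(1) by (intro mult_right_mono) auto
  ultimately have "d\<^sup>2 + 16 * t \<le> 17 * (t * t)" unfolding power2_eq_square by linarith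
  then have "(16 + d\<^sup>2 / t) / t \<le> 17" using assms(1) by (simp add: field_simps)
  moreover have "(16 + d\<^sup>2 / t) / t > 0" using assms(1) by (simp add: add_pos_nonneg)
  ultimately have "ln ((16 + d\<^sup>2 / t) / t) \<le> ln 17" by (intro ln_mono) auto
  moreover have "b / (16 + d\<^sup>2 / t) \<ge> 0" using assms by simp
  ultimately show ?thesis by (simp add: repulsion_def)
qed

section \<open>The urn as a Markov chain\<close>

definition unit_simplex :: "(real ^ 'd::finite) set" where
  "unit_simplex = {x. (\<forall>j. 0 \<le> x $ j) \<and> (\<Sum>j\<in>UNIV. x $ j) = 1}"

lemma unit_simplex_le_1: "x \<in> unit_simplex \<Longrightarrow> x $ j \<le> 1"
  using member_le_sum[of j UNIV "\<lambda>j. x $ j"] by (auto simp: unit_simplex_def)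

lemma measurable_count_space_add:
  fixes g h :: "'a \<Rightarrow> 'b::{countable, plus}"
  assumes "g \<in> measurable M (count_space UNIV)" "h \<in> measurable M (count_space UNIV)"
  shows "(\<lambda>x. g x + h x) \<in> measurable M (count_space UNIV)"
proof (rule measurable_compose_countable[OF _ assms(1)])
  show "(\<lambda>x. i + h x) \<in> measurable M (count_space UNIV)" for i
    by (rule measurable_compose[OF assms(2)]) simp
qed

lemma measurable_count_space_sum:
  fixes h :: "'i \<Rightarrow> 'a \<Rightarrow> 'b::{countable, comm_monoid_add}"
  assumes "finite I" "\<And>i. i \<in> I \<Longrightarrow> h i \<in> measurable M (count_space UNIV)"
  shows "(\<lambda>x. \<Sum>i\<in>I. h i x) \<in> measurable M (count_space UNIV)"
  using assms by (induction I rule: finite_induct) (auto intro!: measurable_count_space_add)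

locale convex_urn = polya_urn M f \<sigma> u0 X U + rf: reinforcement f \<beta>
  for M :: "'w measure" and f :: "real \<Rightarrow> real" and \<sigma> :: "nat \<Rightarrow> nat"
    and u0 :: "nat ^ 'd::finite" and X :: "nat \<Rightarrow> nat \<Rightarrow> 'w \<Rightarrow> nat ^ 'd"
    and U :: "nat \<Rightarrow> 'w \<Rightarrow> nat ^ 'd" and \<beta> :: real
begin

abbreviation \<tau> :: "nat \<Rightarrow> nat" where "\<tau> \<equiv> total_balls u0 \<sigma>"

definition \<theta> :: "nat \<Rightarrow> nat ^ 'd \<Rightarrow> real ^ 'd" where
  "\<theta> n u = (\<chi> j. real (u $ j) / real (\<tau> n))"

definition total_weight :: "real ^ 'd \<Rightarrow> real" where
  "total_weight x = (\<Sum>k\<in>UNIV. f (x $ k))"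

definition draw :: "real ^ 'd \<Rightarrow> 'd \<Rightarrow> real" where
  "draw x j = f (x $ j) / total_weight x"

definition comps :: "nat \<Rightarrow> (nat ^ 'd) set" where
  "comps n = {u. ball_count u = \<tau> n}"

lemma \<tau>_Suc: "\<tau> (Suc n) = \<tau> n + \<sigma> (Suc n)"
  by (simp add: total_balls_def)

lemma \<tau>_pos: "\<tau> n > 0"
proof -
  have "\<exists>j. u0 $ j \<noteq> 0" using nontrivial by (auto simp: vec_eq_iff)
  then have "(\<Sum>j\<in>UNIV. u0 $ j) > 0" by (auto simp: sum_nonneg_eq_0_iff intro: gr0I)
  then show ?thesis by (simp add: total_balls_def)
qed

lemma \<theta>_unit_simplex: "u \<in> comps n \<Longrightarrow> \<theta> n u \<in> unit_simplex"
  using \<tau>_pos[of n]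
  by (auto simp: unit_simplex_def \<theta>_def comps_def ball_count_def simp flip: sum_divide_distrib of_nat_sum)

lemma f_nonneg: "x \<in> unit_simplex \<Longrightarrow> 0 \<le> f (x $ j)"
  using unit_simplex_le_1[of x j] rf.nonneg by (auto simp: unit_simplex_def)

lemma total_weight_pos:
  assumes "x \<in> unit_simplex" shows "0 < total_weight x"
proof -
  have "\<exists>j. x $ j > 0"
  proof (rule ccontr)
    assume "\<not> (\<exists>j. x $ j > 0)"
    then have "(\<Sum>j\<in>UNIV. x $ j) \<le> 0" by (intro sum_nonpos) (simp add: not_less)
    then show False using assms by (simp add: unit_simplex_def)
  qed
  then obtain j where "x $ j > 0" by blast
  then have "0 < f (x $ j)" using rf.pos unit_simplex_le_1[OF assms] by blast
  also have "\<dots> \<le> total_weight x"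
    unfolding total_weight_def using f_nonneg[OF assms] by (intro member_le_sum) auto
  finally show ?thesis .
qed

lemma total_weight_le_1:
  assumes "x \<in> unit_simplex" shows "total_weight x \<le> 1"
proof -
  have "total_weight x \<le> (\<Sum>j\<in>UNIV. x $ j)"
    unfolding total_weight_def using assms unit_simplex_le_1[OF assms]
    by (intro sum_mono rf.le_self) (auto simp: unit_simplex_def)
  then show ?thesis using assms by (simp add: unit_simplex_def)
qed

lemma draw_nonneg: "x \<in> unit_simplex \<Longrightarrow> 0 \<le> draw x j"
  using f_nonneg total_weight_pos by (fastforce simp: draw_def intro!: divide_nonneg_pos)

lemma sum_draw: "x \<in> unit_simplex \<Longrightarrow> sum (draw x) UNIV = 1"
  using total_weight_pos[of x]
  by (simp add: draw_def sum_divide_distrib[symmetric] flip: total_weight_def)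

lemma finite_comps: "finite (comps n)"
proof -
  have "comps n \<subseteq> (\<lambda>g. \<chi> j. g j) ` (PiE UNIV (\<lambda>_. {..\<tau> n}))"
  proof
    fix u assume "u \<in> comps n"
    then have "u $ j \<le> \<tau> n" for j
      using member_le_sum[of j UNIV "\<lambda>j. u $ j"] by (auto simp: comps_def ball_count_def)
    then show "u \<in> (\<lambda>g. \<chi> j. g j) ` (PiE UNIV (\<lambda>_. {..\<tau> n}))"
      by (intro image_eqI[of _ _ "\<lambda>j. u $ j"]) (auto simp: vec_eq_iff)
  qed
  then show ?thesis by (rule finite_subset) (intro finite_imageI finite_PiE, auto)
qed

section \<open>Measurability and the transition law\<close>

lemma measurable_U [measurable]: "U n \<in> measurable M (count_space UNIV)"
proof (induction n)
  case 0
  then show ?case by (subst measurable_cong[of _ _ "\<lambda>_. u0"]) (auto simp: initial)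
next
  case (Suc n)
  have "(\<lambda>\<omega>. U n \<omega> + (\<Sum>i=1..\<sigma> (Suc n). X (Suc n) i \<omega>)) \<in> measurable M (count_space UNIV)"
    by (intro measurable_count_space_add measurable_count_space_sum Suc measurable_X) auto
  then show ?case by (subst measurable_cong[OF step])
qed

lemma subalgebra_history: "subalgebra M (history M U n)"
proof -
  have "(\<lambda>\<omega>. \<lambda>k\<in>{..n}. U k \<omega>) \<in> measurable M (\<Pi>\<^sub>M k\<in>{..n}. count_space UNIV)"
    by (intro measurable_restrict) simp
  then show ?thesis
    unfolding subalgebra_def history_def
    by (auto simp: sets_vimage_algebra2 space_PiM dest: measurable_sets)
qed

lemma measurable_U_history: "k \<le> n \<Longrightarrow> U k \<in> measurable (history M U n) (count_space UNIV)"
proof -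
  assume k: "k \<le> n"
  have "(\<lambda>\<omega>. \<lambda>k\<in>{..n}. U k \<omega>) \<in> measurable (history M U n) (\<Pi>\<^sub>M k\<in>{..n}. count_space UNIV)"
    unfolding history_def by (rule measurable_vimage_algebra1) (auto simp: space_PiM)
  from measurable_compose[OF this measurable_component_singleton[of k]] k
  show ?thesis by simp
qed

lemma space_history: "space (history M U n) = space M"
  using subalgebra_history by (simp add: subalgebra_def)

lemma sets_history: "H \<in> sets (history M U n) \<Longrightarrow> H \<in> sets M"
  using subalgebra_history by (auto simp: subalgebra_def)

lemma U_in_history: "k \<le> n \<Longrightarrow> {\<omega>\<in>space M. P (U k \<omega>)} \<in> sets (history M U n)"
  using measurable_sets[OF measurable_U_history, of k n "Collect P"]
  by (simp add: space_history vimage_def Int_def conj_commute)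

lemma sets_draws: 
  "{\<omega>\<in>space M. \<forall>i\<in>{1..\<sigma> (Suc n)}. X (Suc n) i \<omega> \<in> A i} \<in> sets M"
proof -
  have "{\<omega>\<in>space M. X (Suc n) i \<omega> \<in> A i} \<in> sets M" if "i \<in> {1..\<sigma> (Suc n)}" for i
    using measurable_sets[OF measurable_X[OF that], of "A i"]
    by (simp add: vimage_def Int_def conj_commute)
  then show ?thesis by (intro sets.sets_Collect_finite_All) auto
qed

text \<open>On a history event where \<open>U n\<close> is constant the conditional probabilities
  are constants; integrating the conditional product formula over this event gives an ordinary
  one.\<close>

lemma prob_draws:
  assumes H: "H \<in> sets (history M U n)" and Hu: "\<And>\<omega>. \<omega> \<in> H \<Longrightarrow> U n \<omega> = u"
  shows "prob (H \<inter> {\<omega>\<in>space M. \<forall>i\<in>{1..\<sigma> (Suc n)}. X (Suc n) i \<omega> = axis (x i) 1}) =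
    prob H * (\<Prod>i=1..\<sigma> (Suc n). draw (\<theta> n u) (x i))"
proof -
  let ?F = "history M U n" and ?I = "{1..\<sigma> (Suc n)}"
  \<comment> \<open>Singletons serve as the sets in \<open>cond_indep\<close>.\<close>
  let ?B = "{\<omega>\<in>space M. \<forall>i\<in>?I. X (Suc n) i \<omega> \<in> {axis (x i) 1}}"
  interpret F: sigma_finite_subalgebra M ?F
    by (rule finite_measure_subalgebra_is_sigma_finite[unfolded finite_measure_subalgebra_def
          finite_measure_subalgebra_axioms_def])
      (auto simp: subalgebra_history finite_measure_axioms)
  have B: "?B \<in> sets M" by (rule sets_draws)
  have HM: "H \<in> sets M" by (rule sets_history[OF H])
  have law': "AE \<omega> in M. \<forall>i\<in>?I. cond_prob_on M ?F {\<omega>\<in>space M. X (Suc n) i \<omega> \<in> {axis (x i) 1}} \<omega> =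
      draw (\<theta> n (U n \<omega>)) (x i)"
    by (intro AE_finite_allI)
      (use law in \<open>auto simp: draw_def total_weight_def \<theta>_def proportion_def\<close>)
  have "AE \<omega> in M. cond_prob_on M ?F ?B \<omega> =
      (\<Prod>i\<in>?I. cond_prob_on M ?F {\<omega>\<in>space M. X (Suc n) i \<omega> \<in> {axis (x i) 1}} \<omega>)"
    using independent[of n, unfolded cond_indep_def] by (rule allE)
  with law' have AE: "AE \<omega> in M. indicator H \<omega> * cond_prob_on M ?F ?B \<omega> =
      indicator H \<omega> * (\<Prod>i\<in>?I. draw (\<theta> n u) (x i))"
    by eventually_elim (auto simp: indicator_def Hu)
  have "prob (H \<inter> ?B) = (\<integral>\<omega>. indicator (H \<inter> ?B) \<omega> \<partial>M)"
    using B HM by simp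
  also have "\<dots> = (LINT \<omega>:H|M. indicator ?B \<omega>)"
    by (simp add: set_lebesgue_integral_def indicator_inter_arith)
  also have "\<dots> = (LINT \<omega>:H|M. cond_prob_on M ?F ?B \<omega>)"
    unfolding cond_prob_on_def using B by (intro F.real_cond_exp_intA H) (auto simp: integrable_indicator_iff simp flip: less_top)
  also have "\<dots> = (\<integral>\<omega>. indicator H \<omega> * (\<Prod>i\<in>?I. draw (\<theta> n u) (x i)) \<partial>M)"
    unfolding set_lebesgue_integral_def real_scaleR_def
    using HM by (intro integral_cong_AE AE) (auto simp: cond_prob_on_def)
  also have "\<dots> = prob H * (\<Prod>i\<in>?I. draw (\<theta> n u) (x i))"
    using HM by simp
  finally show ?thesis by simp
qed


text \<open>The events belonging to different colour sequences are disjoint, and inside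
  \<open>H\<close> their probabilities exhaust \<open>prob H\<close>. So almost surely each added
  ball is a basis vector, and the expectation becomes the finite sum of
  \<open>avg_eq_PiE\<close>.\<close>

lemma step_atom:
  assumes u: "u \<in> comps n" and H: "H \<in> sets (history M U n)" and Hu: "\<And>\<omega>. \<omega> \<in> H \<Longrightarrow> U n \<omega> = u"
  shows "AE \<omega> in M. \<omega> \<in> H \<longrightarrow> ball_count (U (Suc n) \<omega>) = \<tau> (Suc n)"
    and "expectation (\<lambda>\<omega>. indicator H \<omega> * \<phi> (U (Suc n) \<omega>)) =
      prob H * avg (draw (\<theta> n u)) (\<sigma> (Suc n)) \<phi> u"
proof -
  let ?s = "\<sigma> (Suc n)"
  let ?P = "PiE {1..?s} (\<lambda>_. UNIV :: 'd set)"
  define B where "B = (\<lambda>x. {\<omega>\<in>space M. \<forall>i\<in>{1..?s}. X (Suc n) i \<omega> = axis (x i) 1})"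
  define S where "S = (\<lambda>x. u + (\<Sum>i=1..?s. axis (x i) 1))"
  have HM: "H \<in> sets M" by (rule sets_history[OF H])
  have HB: "H \<inter> B x \<in> sets M" for x
    using sets_draws[of n "\<lambda>i. {axis (x i) 1}"] HM unfolding B_def by auto
  have prob: "prob (H \<inter> B x) = prob H * (\<Prod>i=1..?s. draw (\<theta> n u) (x i))" for x
    unfolding B_def by (rule prob_draws[OF H Hu])
  have fin: "finite ?P" by (intro finite_PiE) auto
  have S: "U (Suc n) \<omega> = S x" if "\<omega> \<in> H \<inter> B x" for \<omega> x
    using that step[of \<omega> n] Hu[of \<omega>] by (auto simp: B_def S_def)
  have disj: "x = y" if "x \<in> ?P" "y \<in> ?P" "\<omega> \<in> B x" "\<omega> \<in> B y" for x y \<omega>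
  proof (rule PiE_ext[OF that(1,2)])
    fix i assume "i \<in> {1..?s}"
    then have "axis (x i) (1::nat) = axis (y i) 1" using that(3,4) by (auto simp: B_def)
    then show "x i = y i" by (simp add: axis_eq_axis)
  qed
  have d: "sum (draw (\<theta> n u)) UNIV = 1" by (intro sum_draw \<theta>_unit_simplex u)
  have "prob (\<Union>x\<in>?P. H \<inter> B x) = (\<Sum>x\<in>?P. prob (H \<inter> B x))"
    by (rule finite_measure_finite_Union[OF fin]) (use HB disj in \<open>auto simp: disjoint_family_on_def\<close>)
  \<comment> \<open>Summing the product weights is averaging the constant 1, which gives 1.\<close>
  also have "\<dots> = prob H * avg (draw (\<theta> n u)) ?s (\<lambda>_. 1) u"
    unfolding avg_eq_PiE prob by (simp add: sum_distrib_left)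
  also have "\<dots> = prob H" by (simp add: avg_const[OF d])
  finally have eq: "prob (\<Union>x\<in>?P. H \<inter> B x) = prob H" .
  have V: "(\<Union>x\<in>?P. H \<inter> B x) \<in> sets M" using HB fin by (intro sets.finite_UN) auto
  then have "prob (H - (\<Union>x\<in>?P. H \<inter> B x)) = 0"
    using eq HM by (subst finite_measure_Diff) auto
  moreover have "H - (\<Union>x\<in>?P. H \<inter> B x) \<in> sets M" using V HM by (rule sets.Diff[rotated])
  ultimately have "AE \<omega> in M. \<omega> \<notin> H - (\<Union>x\<in>?P. H \<inter> B x)"
    by (simp only: prob_eq_0)
  then have AE: "AE \<omega> in M. \<omega> \<in> H \<longrightarrow> (\<exists>x\<in>?P. \<omega> \<in> B x)"
    by eventually_elim auto
  have count: "ball_count (\<Sum>i=1..k. axis (x i :: 'd) 1) = k" for k x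
    by (induction k) (auto simp: ball_count_add ball_count_axis ball_count_def[of 0])
  show "AE \<omega> in M. \<omega> \<in> H \<longrightarrow> ball_count (U (Suc n) \<omega>) = \<tau> (Suc n)"
    using AE
  proof eventually_elim
    case (elim \<omega>)
    show ?case
    proof
      assume "\<omega> \<in> H"
      then obtain x where "\<omega> \<in> H \<inter> B x" using elim by blast
      then have "U (Suc n) \<omega> = S x" by (rule S)
      then show "ball_count (U (Suc n) \<omega>) = \<tau> (Suc n)"
        using u by (simp add: S_def ball_count_add count comps_def \<tau>_Suc)
    qed
  qed
  have "indicator H \<omega> * \<phi> (U (Suc n) \<omega>) = (\<Sum>x\<in>?P. \<phi> (S x) * indicator (H \<inter> B x) \<omega>)"
    if "\<omega> \<in> H \<longrightarrow> (\<exists>x\<in>?P. \<omega> \<in> B x)" for \<omega>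
  proof (cases "\<omega> \<in> H")
    case True
    with that have "\<exists>x\<in>?P. \<omega> \<in> B x" by (rule mp)
    then obtain x where x: "x \<in> ?P" "\<omega> \<in> B x" by (rule bexE)
    have "(\<Sum>y\<in>?P. \<phi> (S y) * indicator (H \<inter> B y) \<omega>) = (\<Sum>y\<in>?P. if y = x then \<phi> (S x) else 0)"
    proof (rule sum.cong[OF refl])
      fix y assume y: "y \<in> ?P"
      show "\<phi> (S y) * indicator (H \<inter> B y) \<omega> = (if y = x then \<phi> (S x) else 0)"
      proof (cases "y = x")
        case False
        then have "\<omega> \<notin> B y" using disj[OF y x(1) _ x(2)] by blast
        then show ?thesis using False by simp
      qed (use x True in simp)
    qed
    also have "\<dots> = \<phi> (S x)" using x fin by simp
    also have "S x = U (Suc n) \<omega>" using S[of \<omega> x] x True by simp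
    finally show ?thesis using True by simp
  qed simp
  with AE have "AE \<omega> in M. indicator H \<omega> * \<phi> (U (Suc n) \<omega>) = (\<Sum>x\<in>?P. \<phi> (S x) * indicator (H \<inter> B x) \<omega>)"
    by (auto elim: eventually_mono)
  then have "expectation (\<lambda>\<omega>. indicator H \<omega> * \<phi> (U (Suc n) \<omega>)) =
      expectation (\<lambda>\<omega>. \<Sum>x\<in>?P. \<phi> (S x) * indicator (H \<inter> B x) \<omega>)"
    by (intro integral_cong_AE)
      (use HM HB in \<open>auto intro!: borel_measurable_times borel_measurable_sum measurable_compose[OF measurable_U] borel_measurable_indicator\<close>)
  also have "\<dots> = (\<Sum>x\<in>?P. \<phi> (S x) * prob (H \<inter> B x))"
    by (subst Bochner_Integration.integral_sum)
      (use HB in \<open>auto intro!: integrable_mult_right integrable_real_indicator simp flip: less_top\<close>)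
  also have "\<dots> = prob H * avg (draw (\<theta> n u)) ?s \<phi> u"
    unfolding avg_eq_PiE prob by (simp add: sum_distrib_left S_def mult_ac)
  finally show "expectation (\<lambda>\<omega>. indicator H \<omega> * \<phi> (U (Suc n) \<omega>)) =
      prob H * avg (draw (\<theta> n u)) ?s \<phi> u" .
qed

lemma AE_comps: "AE \<omega> in M. U n \<omega> \<in> comps n"
proof (induction n)
  case 0
  then show ?case
    by (intro AE_I2) (simp add: initial comps_def ball_count_def total_balls_def)
next
  case (Suc n)
  have "AE \<omega> in M. \<forall>u\<in>comps n. \<omega> \<in> {\<omega>\<in>space M. U n \<omega> = u} \<longrightarrow> ball_count (U (Suc n) \<omega>) = \<tau> (Suc n)"
    by (intro AE_finite_allI finite_comps step_atom U_in_history) auto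
  then show ?case
    using Suc AE_space by eventually_elim (auto simp: comps_def)
qed

text \<open>At a fixed time the composition almost surely takes finitely many values, so functions
  of it are bounded and expectations split over atoms. The time \<open>m\<close> of the function and
  the time \<open>n\<close> of the splitting are separate because \<open>expectation_step\<close>
  splits at \<open>n\<close> a function of time \<open>Suc n\<close>.\<close>

lemma expectation_eq_sum:
  fixes \<psi> :: "'w \<Rightarrow> real"
  assumes H: "H \<in> sets M" and \<psi>: "\<psi> \<in> borel_measurable M"
    and bdd: "\<And>\<omega>. \<omega> \<in> space M \<Longrightarrow> \<psi> \<omega> = g (U m \<omega>)"
  shows "integrable M (\<lambda>\<omega>. indicator H \<omega> * \<psi> \<omega>)"
    and "expectation (\<lambda>\<omega>. indicator H \<omega> * \<psi> \<omega>) =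
      (\<Sum>u\<in>comps n. expectation (\<lambda>\<omega>. indicator (H \<inter> {\<omega>\<in>space M. U n \<omega> = u}) \<omega> * \<psi> \<omega>))"
proof -
  have sets: "{\<omega>\<in>space M. U n \<omega> = u} \<in> sets M" for u n
    by (rule sets_history[OF U_in_history[of n n]]) simp
  have int: "integrable M (\<lambda>\<omega>. indicator H \<omega> * \<psi> \<omega>)" if "H \<in> sets M" for H
  proof -
    have "AE \<omega> in M. norm (indicator H \<omega> * \<psi> \<omega>) \<le> (\<Sum>u\<in>comps m. \<bar>g u\<bar>)"
      using AE_comps[of m] AE_space
    proof eventually_elim
      case (elim \<omega>)
      then have "\<bar>g (U m \<omega>)\<bar> \<le> (\<Sum>u\<in>comps m. \<bar>g u\<bar>)"
        by (intro member_le_sum finite_comps) auto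
      moreover have "norm (indicator H \<omega> * \<psi> \<omega>) \<le> \<bar>g (U m \<omega>)\<bar>"
        using elim by (auto simp: bdd indicator_def)
      ultimately show ?case by linarith
    qed
    then show ?thesis
      by (intro integrable_const_bound) (use \<psi> that in auto)
  qed
  from int[OF H] show "integrable M (\<lambda>\<omega>. indicator H \<omega> * \<psi> \<omega>)" .
  have "AE \<omega> in M. indicator H \<omega> * \<psi> \<omega> =
      (\<Sum>u\<in>comps n. indicator (H \<inter> {\<omega>\<in>space M. U n \<omega> = u}) \<omega> * \<psi> \<omega>)"
    using AE_comps[of n] AE_space
  proof eventually_elim
    case (elim \<omega>)
    have "(\<Sum>u\<in>comps n. indicator (H \<inter> {\<omega>\<in>space M. U n \<omega> = u}) \<omega> * \<psi> \<omega>) =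
        (\<Sum>u\<in>comps n. if u = U n \<omega> then indicator H \<omega> * \<psi> \<omega> else 0)"
      using elim by (intro sum.cong) (auto simp: indicator_def)
    also have "\<dots> = indicator H \<omega> * \<psi> \<omega>" using elim by (simp add: finite_comps)
    finally show ?case by (rule sym)
  qed
  then have "expectation (\<lambda>\<omega>. indicator H \<omega> * \<psi> \<omega>) =
    expectation (\<lambda>\<omega>. \<Sum>u\<in>comps n. indicator (H \<inter> {\<omega>\<in>space M. U n \<omega> = u}) \<omega> * \<psi> \<omega>)"
    using \<psi> H sets by (intro integral_cong_AE) (auto intro!: borel_measurable_times borel_measurable_sum borel_measurable_indicator)
  also have "\<dots> = (\<Sum>u\<in>comps n. expectation (\<lambda>\<omega>. indicator (H \<inter> {\<omega>\<in>space M. U n \<omega> = u}) \<omega> * \<psi> \<omega>))"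
    using H sets by (intro Bochner_Integration.integral_sum int) auto
  finally show "expectation (\<lambda>\<omega>. indicator H \<omega> * \<psi> \<omega>) =
      (\<Sum>u\<in>comps n. expectation (\<lambda>\<omega>. indicator (H \<inter> {\<omega>\<in>space M. U n \<omega> = u}) \<omega> * \<psi> \<omega>))" .
qed

lemma measurable_fun_U [measurable]: "(\<lambda>\<omega>. \<phi> (U n \<omega>)) \<in> borel_measurable M"
  by (rule measurable_compose[OF measurable_U]) simp

lemma integrable_U:
  fixes \<phi> :: "nat ^ 'd \<Rightarrow> real"
  assumes "H \<in> sets M" shows "integrable M (\<lambda>\<omega>. indicator H \<omega> * \<phi> (U n \<omega>))"
  using assms by (rule expectation_eq_sum(1)[where g = \<phi> and m = n]) simp_all

text \<open>The Markov property in integrated form: \<open>step_atom\<close> on each atom of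
  \<open>U n\<close> inside \<open>H\<close>, then summed over the atoms.\<close>

lemma expectation_step:
  assumes H: "H \<in> sets (history M U n)"
  shows "expectation (\<lambda>\<omega>. indicator H \<omega> * \<phi> (U (Suc n) \<omega>)) =
    expectation (\<lambda>\<omega>. indicator H \<omega> * avg (draw (\<theta> n (U n \<omega>))) (\<sigma> (Suc n)) \<phi> (U n \<omega>))"
proof -
  have HM: "H \<in> sets M" by (rule sets_history[OF H])
  let ?H = "\<lambda>u. H \<inter> {\<omega>\<in>space M. U n \<omega> = u}"
  have Hu: "?H u \<in> sets (history M U n)" for u using H by (intro sets.Int U_in_history) auto
  have "expectation (\<lambda>\<omega>. indicator H \<omega> * \<phi> (U (Suc n) \<omega>)) =
      (\<Sum>u\<in>comps n. expectation (\<lambda>\<omega>. indicator (?H u) \<omega> * \<phi> (U (Suc n) \<omega>)))"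
    using HM by (rule expectation_eq_sum(2)[where g = \<phi> and m = "Suc n"]) simp_all
  also have "\<dots> = (\<Sum>u\<in>comps n. prob (?H u) * avg (draw (\<theta> n u)) (\<sigma> (Suc n)) \<phi> u)"
    by (intro sum.cong refl step_atom Hu) auto
  also have "\<dots> = (\<Sum>u\<in>comps n. expectation (\<lambda>\<omega>. indicator (?H u) \<omega> *
      avg (draw (\<theta> n (U n \<omega>))) (\<sigma> (Suc n)) \<phi> (U n \<omega>)))"
  proof (intro sum.cong refl)
    fix u
    have "expectation (\<lambda>\<omega>. indicator (?H u) \<omega> * avg (draw (\<theta> n (U n \<omega>))) (\<sigma> (Suc n)) \<phi> (U n \<omega>)) =
      expectation (\<lambda>\<omega>. indicator (?H u) \<omega> * avg (draw (\<theta> n u)) (\<sigma> (Suc n)) \<phi> u)"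
      by (intro Bochner_Integration.integral_cong) (auto simp: indicator_def)
    also have "\<dots> = prob (?H u) * avg (draw (\<theta> n u)) (\<sigma> (Suc n)) \<phi> u"
      using sets_history[OF Hu[of u]] by simp
    finally show "prob (?H u) * avg (draw (\<theta> n u)) (\<sigma> (Suc n)) \<phi> u =
      expectation (\<lambda>\<omega>. indicator (?H u) \<omega> * avg (draw (\<theta> n (U n \<omega>))) (\<sigma> (Suc n)) \<phi> (U n \<omega>))" by simp
  qed
  also have "\<dots> = expectation (\<lambda>\<omega>. indicator H \<omega> * avg (draw (\<theta> n (U n \<omega>))) (\<sigma> (Suc n)) \<phi> (U n \<omega>))"
    using HM
    by (rule expectation_eq_sum(2)[symmetric, where m = n and
          g = "\<lambda>u. avg (draw (\<theta> n u)) (\<sigma> (Suc n)) \<phi> u"])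
      (simp_all add: measurable_fun_U[where \<phi> = "\<lambda>u. avg (draw (\<theta> n u)) (\<sigma> (Suc n)) \<phi> u"])
  finally show ?thesis .
qed

section \<open>Lyapunov functions for the process killed on leaving a region\<close>

definition stay :: "(nat \<Rightarrow> nat ^ 'd \<Rightarrow> bool) \<Rightarrow> nat \<Rightarrow> nat \<Rightarrow> 'w set" where
  "stay N n m = {\<omega>\<in>space M. \<forall>k\<in>{n..m}. N k (U k \<omega>)}"

lemma stay_history: "n \<le> m \<Longrightarrow> stay N n m \<in> sets (history M U m)"
proof -
  have "stay N n m = (\<Inter>k\<in>{n..m}. {\<omega>\<in>space M. N k (U k \<omega>)})" if "n \<le> m"
    using that by (auto simp: stay_def)
  then show ?thesis if "n \<le> m"
    using that by (auto intro!: sets.finite_INT U_in_history)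
qed

lemma stay_sets: "n \<le> m \<Longrightarrow> stay N n m \<in> sets M"
  by (rule sets_history[OF stay_history])

text \<open>Since \<open>W \<le> 0\<close>, the contribution of the paths leaving the region has the right sign.\<close>
lemma lyapunov:
  fixes W \<delta> :: "nat \<Rightarrow> nat ^ 'd \<Rightarrow> real" and \<eta> :: "nat \<Rightarrow> real"
  assumes W: "\<And>m u. n \<le> m \<Longrightarrow> u \<in> comps m \<Longrightarrow> W m u \<le> 0"
    and \<eta>: "\<And>m. 0 \<le> \<eta> m"
    and drift: "\<And>m u. n \<le> m \<Longrightarrow> u \<in> comps m \<Longrightarrow> N m u \<Longrightarrow>
      W m u + \<delta> m u - \<eta> m \<le> avg (draw (\<theta> m u)) (\<sigma> (Suc m)) (W (Suc m)) u"
  shows "\<exists>C. \<forall>M'\<ge>n. (\<Sum>m=n..<M'. expectation (\<lambda>\<omega>. indicator (stay N n m) \<omega> * \<delta> m (U m \<omega>)))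
    \<le> C + (\<Sum>m=n..<M'. \<eta> m)"
proof -
  \<comment> \<open>Two time indices split a step into halves: from \<open>E m m\<close> to
    \<open>E m (Suc m)\<close> the process moves, and from there to \<open>E (Suc m) (Suc m)\<close>
    the paths that have left are discarded.\<close>
  define E where "E = (\<lambda>m m'. expectation (\<lambda>\<omega>. indicator (stay N n m) \<omega> * W m' (U m' \<omega>)))"
  define D where "D = (\<lambda>m. expectation (\<lambda>\<omega>. indicator (stay N n m) \<omega> * \<delta> m (U m \<omega>)))"
  have E0: "E m m \<le> 0" if "n \<le> m" for m
  proof -
    have "AE \<omega> in M. 0 \<le> - (indicator (stay N n m) \<omega> * W m (U m \<omega>))"
      using AE_comps[of m] by eventually_elim (use W[OF that] in \<open>auto simp: indicator_def\<close>)
    then have "0 \<le> expectation (\<lambda>\<omega>. - (indicator (stay N n m) \<omega> * W m (U m \<omega>)))"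
      by (rule integral_nonneg_AE)
    then show ?thesis by (simp add: E_def)
  qed
  have step: "E m m + D m - \<eta> m \<le> E (Suc m) (Suc m)" if nm: "n \<le> m" for m
  proof -
    note sets = stay_sets[OF nm, of N] 
    have sets': "stay N n (Suc m) \<in> sets M" using nm by (intro stay_sets) simp
    have "E m m + D m - \<eta> m * prob (stay N n m) =
        expectation (\<lambda>\<omega>. indicator (stay N n m) \<omega> * W m (U m \<omega>) + indicator (stay N n m) \<omega> * \<delta> m (U m \<omega>)
          - \<eta> m * indicator (stay N n m) \<omega>)"
      using sets by (simp add: E_def D_def integrable_U integrable_real_indicator less_top[symmetric])
    also have "\<dots> \<le> expectation (\<lambda>\<omega>. indicator (stay N n m) \<omega> *
        avg (draw (\<theta> m (U m \<omega>))) (\<sigma> (Suc m)) (W (Suc m)) (U m \<omega>))"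
    proof (rule integral_mono_AE)
      show "AE \<omega> in M. indicator (stay N n m) \<omega> * W m (U m \<omega>) + indicator (stay N n m) \<omega> * \<delta> m (U m \<omega>)
          - \<eta> m * indicator (stay N n m) \<omega> \<le> indicator (stay N n m) \<omega> *
        avg (draw (\<theta> m (U m \<omega>))) (\<sigma> (Suc m)) (W (Suc m)) (U m \<omega>)"
        using AE_comps[of m]
      proof eventually_elim
        case (elim \<omega>)
        show ?case
        proof (cases "\<omega> \<in> stay N n m")
          case True
          then have "N m (U m \<omega>)" using nm by (auto simp: stay_def)
          from drift[OF nm elim this] True show ?thesis by (simp add: algebra_simps)
        qed simp
      qed
    qed (use sets in \<open>auto intro!: integrable_U[of _ "\<lambda>u. avg (draw (\<theta> m u)) (\<sigma> (Suc m)) (W (Suc m)) u"] integrable_U integrable_real_indicator simp flip: less_top\<close>)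
    also have "\<dots> = E m (Suc m)"
      unfolding E_def by (rule expectation_step[symmetric, OF stay_history[OF nm]])
    also have "\<dots> \<le> E (Suc m) (Suc m)"
      unfolding E_def
    proof (rule integral_mono_AE)
      show "AE \<omega> in M. indicator (stay N n m) \<omega> * W (Suc m) (U (Suc m) \<omega>)
          \<le> indicator (stay N n (Suc m)) \<omega> * W (Suc m) (U (Suc m) \<omega>)"
        using AE_comps[of "Suc m"]
        by eventually_elim (use W[of "Suc m"] nm in \<open>auto simp: indicator_def stay_def\<close>)
    qed (use sets sets' in \<open>auto intro!: integrable_U\<close>)
    finally have "E m m + D m - \<eta> m * prob (stay N n m) \<le> E (Suc m) (Suc m)" .
    moreover have "\<eta> m * prob (stay N n m) \<le> \<eta> m" using \<eta> by (intro mult_left_le) auto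
    ultimately show ?thesis by linarith
  qed
  have "E n n + (\<Sum>m=n..<M'. D m) \<le> E M' M' + (\<Sum>m=n..<M'. \<eta> m)" if "n \<le> M'" for M'
    using that
  proof (induction M' rule: dec_induct)
    case (step m)
    then show ?case using \<open>n \<le> m \<Longrightarrow> E m m + D m - \<eta> m \<le> E (Suc m) (Suc m)\<close> by simp
  qed simp
  then have "(\<Sum>m=n..<M'. D m) \<le> - E n n + (\<Sum>m=n..<M'. \<eta> m)" if "n \<le> M'" for M'
    using that E0[of M'] by fastforce
  then show ?thesis unfolding D_def by blast
qed

text \<open>By monotone convergence the sum has finite expectation, hence is almost surely
  finite.\<close>

lemma AE_summable:
  fixes g :: "nat \<Rightarrow> 'w \<Rightarrow> real"
  assumes int: "\<And>m. integrable M (g m)" and nn: "\<And>m. AE \<omega> in M. 0 \<le> g m \<omega>"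
    and bd: "\<And>k. (\<Sum>m<k. expectation (g m)) \<le> C"
  shows "AE \<omega> in M. summable (\<lambda>m. g m \<omega>)"
proof -
  have meas [measurable]: "g m \<in> borel_measurable M" for m using int by auto
  have "(\<integral>\<^sup>+\<omega>. (\<Sum>m. ennreal (g m \<omega>)) \<partial>M) = (\<Sum>m. \<integral>\<^sup>+\<omega>. ennreal (g m \<omega>) \<partial>M)"
    by (intro nn_integral_suminf) auto
  also have "\<dots> = (\<Sum>m. ennreal (expectation (g m)))"
    by (intro suminf_cong nn_integral_eq_integral int nn)
  also have "\<dots> \<le> ennreal C"
  proof (rule suminf_le_const)
    show "(\<Sum>m<k. ennreal (expectation (g m))) \<le> ennreal C" for k
      using bd[of k] by (subst sum_ennreal) (auto intro!: integral_nonneg_AE nn ennreal_leI)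
  qed auto
  also have "\<dots> < \<infinity>" by simp
  finally have "AE \<omega> in M. (\<Sum>m. ennreal (g m \<omega>)) \<noteq> \<infinity>"
    by (intro nn_integral_PInf_AE) auto
  moreover have "AE \<omega> in M. \<forall>m. 0 \<le> g m \<omega>" using nn by (simp add: AE_all_countable)
  ultimately show ?thesis
    by eventually_elim (intro summable_suminf_not_top, auto)
qed

end

section \<open>Convergence to an equilibrium\<close>

text \<open>Away from the finitely many zeros \<open>w\<close> has a positive minimum, so the clock
  \<Sum>\<open>e\<close> advances little during late excursions and \<open>x\<close>, moving at most
  twice as fast, travels little. As the clock never stops, the sequence must come close to the
  zeros, and small steps prevent changing from one zero to another.\<close>

lemma eventually_near_zero:
  fixes x :: "nat \<Rightarrow> 'a::metric_space" and w :: "'a \<Rightarrow> real"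
  assumes S: "compact S" and xS: "\<And>n. x n \<in> S"
    and w: "continuous_on S w" "\<And>y. y \<in> S \<Longrightarrow> 0 \<le> w y"
    and Z: "finite {y\<in>S. w y = 0}" and \<delta>: "\<And>z. z \<in> S \<Longrightarrow> w z = 0 \<Longrightarrow> 0 < \<delta> z"
    and step: "\<And>n. dist (x n) (x (Suc n)) \<le> 2 * e n"
    and e: "\<And>n. 0 \<le> e n" "e \<longlonglongrightarrow> 0" "\<not> summable e"
    and sum: "summable (\<lambda>n. e n * w (x n))"
  shows "\<exists>z\<in>S. w z = 0 \<and> (\<exists>n0. \<forall>n\<ge>n0. dist (x n) z < \<delta> z)"
proof -
  define Z where "Z = {y\<in>S. w y = 0}"
  \<comment> \<open>All distances that \<open>r\<close> has to respect: the tolerances, the gaps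
    between zeros, and 1 so that the set is nonempty.\<close>
  define P where "P = insert 1 (\<delta> ` Z \<union> (\<lambda>(z, z'). dist z z') ` {(z, z') \<in> Z \<times> Z. z \<noteq> z'})"
  have "finite {(z, z') \<in> Z \<times> Z. z \<noteq> z'}"
    by (rule finite_subset[of _ "Z \<times> Z"]) (use Z in \<open>auto simp: Z_def\<close>)
  then have P: "finite P" "P \<noteq> {}" "\<forall>p\<in>P. 0 < p"
    using Z \<delta> by (auto simp: P_def Z_def)
  define r where "r = Min P / 4"
  have "Min P \<in> P" using P by (intro Min_in)
  then have r: "0 < r" using P by (auto simp: r_def)
  have le: "4 * r \<le> p" if "p \<in> P" for p using P that by (simp add: r_def)
  have r1: "r \<le> \<delta> z" if "z \<in> Z" for z using le[of "\<delta> z"] that r by (auto simp: P_def)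
  have r2: "z = z'" if "z \<in> Z" "z' \<in> Z" "dist z z' < 4 * r" for z z'
    using le[of "dist z z'"] that by (force simp: P_def)
  \<comment> \<open>Half the radius is removed: a point at distance \<open>r\<close> from all zeros
    must travel \<open>r / 2\<close> to leave \<open>K\<close>, more than twice the clock bound
    \<open>r / 4\<close> permits.\<close>
  define K where "K = S - (\<Union>z\<in>Z. ball z (r / 2))"
  have K: "compact K" unfolding K_def by (intro compact_diff S) auto
  have "\<exists>w0>0. \<forall>y\<in>K. w0 \<le> w y"
  proof (cases "K = {}")
    case False
    have "continuous_on K w" using w(1) by (rule continuous_on_subset) (auto simp: K_def)
    from continuous_attains_inf[OF K False this] obtain y where y: "y \<in> K" "\<forall>z\<in>K. w y \<le> w z" by auto
    have "w y \<noteq> 0" using y(1) r by (force simp: K_def Z_def)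
    moreover have "0 \<le> w y" using y(1) w(2) by (auto simp: K_def)
    ultimately show ?thesis using y by (intro exI[of _ "w y"]) auto
  qed (auto intro: exI[of _ 1])
  then obtain w0 where w0: "0 < w0" "\<And>y. y \<in> K \<Longrightarrow> w0 \<le> w y" by blast
  have "0 < w0 * r / 4" using w0 r by simp
  with sum[unfolded summable_Cauchy] obtain n1
    where n1: "\<And>m n. n1 \<le> m \<Longrightarrow> norm (\<Sum>k=m..<n. e k * w (x k)) < w0 * r / 4" by blast
  have small: "(\<Sum>k=n..<m. e k) < r / 4" if "n1 \<le> n" "\<And>k. n \<le> k \<Longrightarrow> k < m \<Longrightarrow> x k \<in> K" for n m
  proof -
    have "w0 * (\<Sum>k=n..<m. e k) \<le> (\<Sum>k=n..<m. e k * w (x k))"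
      unfolding sum_distrib_left using w0 that e
      by (intro sum_mono) (auto simp: mult.commute[of w0] intro!: mult_left_mono)
    also have "\<dots> < w0 * (r / 4)" using n1[OF that(1), of m] by simp
    finally show ?thesis using w0 by simp
  qed
  have dist: "dist (x n) (x m) \<le> 2 * (\<Sum>k=n..<m. e k)" if "n \<le> m" for n m
    using that
  proof (induction m rule: dec_induct)
    case (step m)
    then show ?case
      using dist_triangle[of "x n" "x (Suc m)" "x m"] \<open>dist (x m) (x (Suc m)) \<le> _\<close> by simp
  qed simp
  have near: "\<exists>z\<in>Z. dist (x n) z < r" if n: "n1 \<le> n" for n
  proof (rule ccontr)
    assume far: "\<not> (\<exists>z\<in>Z. dist (x n) z < r)"
    \<comment> \<open>A late point far from all zeros would never leave \<open>K\<close>, so the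
      clock would advance by a bounded amount only, against divergence of
      \<Sum>\<open>e\<close>.\<close>
    have xK: "x m \<in> K" if "n \<le> m" for m
      using that
    proof (induction m rule: less_induct)
      case (less m)
      then have "(\<Sum>k=n..<m. e k) < r / 4" using n by (intro small) auto
      then have *: "dist (x n) (x m) < r / 2" using dist[OF less.prems] by linarith
      show ?case
      proof (rule ccontr)
        assume "x m \<notin> K"
        then obtain z where z: "z \<in> Z" "dist z (x m) < r / 2" using xS by (auto simp: K_def)
        then have "dist (x n) z < r"
          using dist_triangle[of "x n" z "x m"] * by (simp add: dist_commute)
        then show False using far z by blast
      qed
    qed
    have "summable (\<lambda>k. e (k + n))"
    proof (rule bounded_imp_summable)
      show "(\<Sum>k\<le>m. e (k + n)) \<le> r / 4" for m
      proof -
        have "(\<Sum>k\<le>m. e (k + n)) = (\<Sum>k=n..<n + Suc m. e k)"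
          using sum.shift_bounds_nat_ivl[of e 0 n "Suc m"] by (simp add: atLeast0LessThan lessThan_Suc_atMost add.commute)
        also have "\<dots> < r / 4" using n xK by (intro small) auto
        finally show ?thesis by simp
      qed
    qed (use e in auto)
    then show False using e(3) by (simp add: summable_iff_shift)
  qed
  obtain n2 where n2: "\<And>n. n2 \<le> n \<Longrightarrow> e n < r"
    using order_tendstoD(2)[OF e(2) r] by (auto simp: eventually_sequentially)
  define n0 where "n0 = max n1 n2"
  obtain z where z: "z \<in> Z" "dist (x n0) z < r" using near[of n0] by (auto simp: n0_def)
  have "dist (x n) z < r" if "n0 \<le> n" for n
    using that
  proof (induction n rule: dec_induct)
    case (step n)
    obtain z' where z': "z' \<in> Z" "dist (x (Suc n)) z' < r" using near[of "Suc n"] step by (auto simp: n0_def)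
    have "dist z z' \<le> dist (x n) z + dist (x n) (x (Suc n)) + dist (x (Suc n)) z'"
      using dist_triangle[of z z' "x n"] dist_triangle[of "x n" z' "x (Suc n)"] by (simp add: dist_commute)
    \<comment> \<open>Two distances below \<open>r\<close> and one step below \<open>2 * r\<close>;
      distinct zeros are at least \<open>4 * r\<close> apart.\<close>
    also have "\<dots> < 4 * r" using step z' n2[of n] \<open>dist (x n) (x (Suc n)) \<le> _\<close> by (simp add: n0_def)
    finally have "z = z'" using z z' r2 by blast
    then show ?case using z' by simp
  qed (use z in simp)
  then have "\<forall>n\<ge>n0. dist (x n) z < \<delta> z" using r1[OF z(1)] by fastforce
  then show ?thesis using z by (auto simp: Z_def)
qed

lemma compact_unit_simplex: "compact (unit_simplex :: (real ^ 'd::finite) set)"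
proof -
  have "norm x \<le> 1" if "x \<in> unit_simplex" for x :: "real ^ 'd"
    using norm_le_l1_cart[of x] that by (auto simp: unit_simplex_def)
  then have "bounded (unit_simplex :: (real ^ 'd) set)" by (auto simp: bounded_iff)
  moreover have "closed (unit_simplex :: (real ^ 'd) set)"
    unfolding unit_simplex_def
    by (intro closed_Collect_conj closed_Collect_all closed_Collect_le closed_Collect_eq continuous_intros)
  ultimately show ?thesis by (simp add: compact_eq_bounded_closed)
qed

context convex_urn
begin

definition e :: "nat \<Rightarrow> real" where
  "e n = real (\<sigma> (Suc n)) / real (\<tau> (Suc n))"

lemma e_nonneg: "0 \<le> e n" by (simp add: e_def)

text \<open>A lower bound for the drift of \<open>\<Sum>j. (\<theta> $ j)\<^sup>2\<close>; its zeros are the equilibria of the drift.\<close>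
definition imbalance :: "real ^ 'd \<Rightarrow> real" where
  "imbalance x = (\<Sum>i\<in>UNIV. \<Sum>j\<in>UNIV. (x $ i - x $ j) * (f (x $ i) * x $ j - f (x $ j) * x $ i))"

lemma imbalance_nonneg: "x \<in> unit_simplex \<Longrightarrow> 0 \<le> imbalance x"
  unfolding imbalance_def
  by (intro sum_nonneg rf.pair_term(1)) (auto simp: unit_simplex_le_1, auto simp: unit_simplex_def)

lemma imbalance_zero:
  assumes "x \<in> unit_simplex" "imbalance x = 0"
  shows "x $ i = 0 \<or> x $ j = 0 \<or> x $ i = x $ j"
proof -
  have x: "0 \<le> x $ i" "x $ i \<le> 1" for i
    using assms(1) unit_simplex_le_1 by (auto simp: unit_simplex_def)
  have "\<forall>i\<in>UNIV. (\<Sum>j\<in>UNIV. (x $ i - x $ j) * (f (x $ i) * x $ j - f (x $ j) * x $ i)) = 0"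
    using assms(2) unfolding imbalance_def
    by (subst (asm) sum_nonneg_eq_0_iff) (auto intro!: sum_nonneg rf.pair_term(1) x)
  then have "(\<Sum>j\<in>UNIV. (x $ i - x $ j) * (f (x $ i) * x $ j - f (x $ j) * x $ i)) = 0" by simp
  then have "\<forall>j\<in>UNIV. (x $ i - x $ j) * (f (x $ i) * x $ j - f (x $ j) * x $ i) = 0"
    by (subst (asm) sum_nonneg_eq_0_iff) (auto intro!: rf.pair_term(1) x)
  then show ?thesis using rf.pair_term(2)[OF x x, of i j] by simp
qed

lemma continuous_f_component: "continuous_on unit_simplex (\<lambda>x :: real ^ 'd. f (x $ i))"
  by (rule continuous_on_compose2[OF rf.cont])
    (auto intro!: continuous_intros simp: unit_simplex_le_1, auto simp: unit_simplex_def)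

text \<open>An equilibrium is determined by its support: all nonzero components agree and sum to
  1.\<close>

lemma finite_equilibria: "finite {x \<in> unit_simplex. imbalance x = 0}"
proof -
  let ?g = "\<lambda>A :: 'd set. (\<chi> i. if i \<in> A then 1 / real (card A) else 0) :: real ^ 'd"
  have "x = ?g {i. x $ i \<noteq> 0}" if x: "x \<in> unit_simplex" "imbalance x = 0" for x
  proof -
    define A where "A = {i. x $ i \<noteq> 0}"
    have "x $ i = 1 / real (card A)" if "i \<in> A" for i
    proof -
      have "1 = (\<Sum>j\<in>UNIV. x $ j)" using x by (simp add: unit_simplex_def)
      also have "\<dots> = (\<Sum>j\<in>A. x $ j)" by (intro sum.mono_neutral_right) (auto simp: A_def)
      also have "\<dots> = (\<Sum>j\<in>A. x $ i)"
      proof (rule sum.cong[OF refl])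
        fix j assume "j \<in> A"
        then show "x $ j = x $ i" using imbalance_zero[OF x, of i j] that by (auto simp: A_def)
      qed
      finally have "1 = real (card A) * x $ i" by simp
      then show ?thesis by (metis mult_zero_left nonzero_eq_divide_eq mult.commute zero_neq_one)
    qed
    then show ?thesis unfolding A_def[symmetric] by (auto simp: vec_eq_iff A_def)
  qed
  then have "{x \<in> unit_simplex. imbalance x = 0} \<subseteq> range ?g" by (blast intro: range_eqI)
  then show ?thesis by (rule finite_subset) simp
qed

section \<open>Drift and step size of the proportions\<close>

lemma lin_unit: "lin (\<lambda>k. of_bool (k = j)) u = real (u $ j)"
  by (simp add: lin_def of_bool_def if_distrib[of "\<lambda>x. x * _"] cong: if_cong)

lemma avg_count:
  assumes "u \<in> comps n"
  shows "avg (draw (\<theta> n u)) k (\<lambda>w. real (w $ j)) u = real (u $ j) + k * draw (\<theta> n u) j"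
proof -
  have "(\<Sum>k\<in>UNIV. p k * of_bool (k = j)) = p j" for p :: "'d \<Rightarrow> real"
    by (simp add: of_bool_def if_distrib[of "\<lambda>x. _ * x"] cong: if_cong)
  then show ?thesis
  using avg_lin[OF sum_draw[OF \<theta>_unit_simplex[OF assms]], of k "\<lambda>k. of_bool (k = j)" 0 u]
    by (simp add: lin_unit)
qed

text \<open>The urn as a stochastic approximation with step size \<open>e n\<close> and mean field
  \<open>draw x - x\<close>.\<close>

lemma avg_proportion:
  assumes "u \<in> comps n"
  shows "avg (draw (\<theta> n u)) (\<sigma> (Suc n)) (\<lambda>w. \<theta> (Suc n) w $ j) u =
    \<theta> n u $ j + e n * (draw (\<theta> n u) j - \<theta> n u $ j)"
proof -
  have "(\<lambda>w. \<theta> (Suc n) w $ j) = (\<lambda>w. 1 / real (\<tau> (Suc n)) * real (w $ j))"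
    by (simp add: \<theta>_def)
  then have "avg (draw (\<theta> n u)) (\<sigma> (Suc n)) (\<lambda>w. \<theta> (Suc n) w $ j) u =
      1 / real (\<tau> (Suc n)) * (real (u $ j) + \<sigma> (Suc n) * draw (\<theta> n u) j)"
    by (simp only: avg_cmult avg_count[OF assms])
  also have "\<dots> = \<theta> n u $ j + e n * (draw (\<theta> n u) j - \<theta> n u $ j)"
  proof -
    have "real (u $ j) = \<theta> n u $ j * (real (\<tau> (Suc n)) - real (\<sigma> (Suc n)))"
      using \<tau>_pos[of n] by (simp add: \<theta>_def \<tau>_Suc)
    then show ?thesis using \<tau>_pos[of "Suc n"] by (simp add: e_def field_simps)
  qed
  finally show ?thesis .
qed

text \<open>Expanding the double sum gives \<open>total_weight x\<close> times the right-hand side;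
  as \<open>total_weight x \<le> 1\<close> and the drift is nonnegative, the factor may be
  dropped.\<close>

lemma drift_imbalance:
  assumes x: "x \<in> unit_simplex"
  shows "imbalance x \<le> 2 * (\<Sum>j\<in>UNIV. x $ j * (draw x j - x $ j))"
proof -
  have s: "(\<Sum>j\<in>UNIV. x $ j) = 1" using x by (simp add: unit_simplex_def)
  have "imbalance x = (\<Sum>i\<in>UNIV. \<Sum>j\<in>UNIV. (x $ i * f (x $ i)) * x $ j + x $ i * (x $ j * f (x $ j))
      - (x $ i * x $ i) * f (x $ j) - f (x $ i) * (x $ j * x $ j))"
    unfolding imbalance_def by (intro sum.cong) (auto simp: algebra_simps)
  also have "\<dots> = 2 * ((\<Sum>i\<in>UNIV. x $ i * f (x $ i)) - (\<Sum>i\<in>UNIV. x $ i * x $ i) * total_weight x)"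
    by (simp add: sum.distrib sum_subtractf sum_distrib_left[symmetric] sum_distrib_right[symmetric] s
        total_weight_def mult.commute)
  also have "\<dots> = total_weight x * (2 * (\<Sum>j\<in>UNIV. x $ j * (draw x j - x $ j)))"
    using total_weight_pos[OF x]
    by (simp add: draw_def right_diff_distrib sum_subtractf sum_divide_distrib[symmetric] mult.commute)
  finally have eq: "imbalance x = total_weight x * (2 * (\<Sum>j\<in>UNIV. x $ j * (draw x j - x $ j)))" .
  then have "0 \<le> 2 * (\<Sum>j\<in>UNIV. x $ j * (draw x j - x $ j))"
    using imbalance_nonneg[OF x] total_weight_pos[OF x] by (simp add: zero_le_mult_iff)
  then show ?thesis unfolding eq
    using total_weight_le_1[OF x] total_weight_pos[OF x] by (intro mult_left_le_one_le) auto
qed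

text \<open>The Lyapunov argument with no restriction of the region: convexity of the square means
  that noise only increases the expected sum of squares, so there is no error term.\<close>

lemma summable_imbalance: "AE \<omega> in M. summable (\<lambda>m. e m * imbalance (\<theta> m (U m \<omega>)))"
proof -
  define W where "W = (\<lambda>m u. (\<Sum>j\<in>UNIV. (\<theta> m u $ j)\<^sup>2) - 1)"
  have "\<exists>C. \<forall>k\<ge>0. (\<Sum>m=0..<k. expectation (\<lambda>\<omega>. indicator (stay (\<lambda>_ _. True) 0 m) \<omega> *
      (e m * imbalance (\<theta> m (U m \<omega>))))) \<le> C + (\<Sum>m=0..<k. 0)"
  proof (rule lyapunov[where W = W])
    fix m u assume u: "u \<in> comps m"
    then have x: "\<theta> m u \<in> unit_simplex" by (rule \<theta>_unit_simplex)
    have "(\<Sum>j\<in>UNIV. (\<theta> m u $ j)\<^sup>2) \<le> (\<Sum>j\<in>UNIV. \<theta> m u $ j)"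
      using x unit_simplex_le_1[OF x]
      by (intro sum_mono) (auto simp: power2_eq_square unit_simplex_def intro!: mult_left_le)
    then show "W m u \<le> 0" using x by (simp add: W_def unit_simplex_def)
    have d: "sum (draw (\<theta> m u)) UNIV = 1" by (rule sum_draw[OF x])
    let ?A = "avg (draw (\<theta> m u)) (\<sigma> (Suc m))"
    have "W m u + e m * imbalance (\<theta> m u) \<le>
        W m u + e m * (2 * (\<Sum>j\<in>UNIV. \<theta> m u $ j * (draw (\<theta> m u) j - \<theta> m u $ j)))"
      using drift_imbalance[OF x] by (intro add_left_mono mult_left_mono e_nonneg)
    also have "\<dots> = (\<Sum>j\<in>UNIV. 2 * \<theta> m u $ j *
        (\<theta> m u $ j + e m * (draw (\<theta> m u) j - \<theta> m u $ j)) - (\<theta> m u $ j)\<^sup>2) - 1"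
    proof -
      have "(\<Sum>j\<in>UNIV. 2 * \<theta> m u $ j * (\<theta> m u $ j + e m * (draw (\<theta> m u) j - \<theta> m u $ j)) - (\<theta> m u $ j)\<^sup>2) =
        (\<Sum>j\<in>UNIV. (\<theta> m u $ j)\<^sup>2 + e m * 2 * (\<theta> m u $ j * (draw (\<theta> m u) j - \<theta> m u $ j)))"
        by (intro sum.cong) (auto simp: power2_eq_square algebra_simps)
      then show ?thesis by (simp add: W_def sum.distrib sum_distrib_left mult.assoc)
    qed
    also have "\<dots> = ?A (\<lambda>w. (\<Sum>j\<in>UNIV. 2 * \<theta> m u $ j * \<theta> (Suc m) w $ j - (\<theta> m u $ j)\<^sup>2) - 1) u"
      by (simp only: avg_diff avg_sum[OF finite] avg_cmult avg_const[OF d] avg_proportion[OF u])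
    also have "\<dots> \<le> ?A (W (Suc m)) u"
    proof (rule avg_mono)
      fix w
      \<comment> \<open>The square lies above its tangent at the current proportion, and the average
        of the tangent is given by \<open>avg_proportion\<close>.\<close>
      have "2 * a * b - a\<^sup>2 \<le> b\<^sup>2" for a b :: real
        using zero_le_power2[of "a - b"] by (simp add: power2_diff)
      then show "(\<Sum>j\<in>UNIV. 2 * \<theta> m u $ j * \<theta> (Suc m) w $ j - (\<theta> m u $ j)\<^sup>2) - 1 \<le> W (Suc m) w"
        unfolding W_def by (intro diff_right_mono sum_mono)
    qed (rule draw_nonneg[OF x])
    finally show "W m u + e m * imbalance (\<theta> m u) - 0 \<le> ?A (W (Suc m)) u" by simp
  qed simp
  then obtain C where C: "(\<Sum>m<k. expectation (\<lambda>\<omega>. indicator (stay (\<lambda>_ _. True) 0 m) \<omega> *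
      (e m * imbalance (\<theta> m (U m \<omega>))))) \<le> C" for k
    by (auto simp: atLeast0LessThan)
  have "AE \<omega> in M. summable (\<lambda>m. indicator (stay (\<lambda>_ _. True) 0 m) \<omega> * (e m * imbalance (\<theta> m (U m \<omega>))))"
  proof (rule AE_summable[OF _ _ C])
    show "integrable M (\<lambda>\<omega>. indicator (stay (\<lambda>_ _. True) 0 m) \<omega> * (e m * imbalance (\<theta> m (U m \<omega>))))" for m
      by (rule integrable_U[where \<phi> = "\<lambda>u. e m * imbalance (\<theta> m u)"]) (simp add: stay_sets)
    show "AE \<omega> in M. 0 \<le> indicator (stay (\<lambda>_ _. True) 0 m) \<omega> * (e m * imbalance (\<theta> m (U m \<omega>)))" for m
      using AE_comps[of m] by eventually_elim (simp add: e_nonneg imbalance_nonneg \<theta>_unit_simplex)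
  qed
  then show ?thesis
    using AE_space by eventually_elim (simp add: stay_def)
qed

lemma U_mono: "\<omega> \<in> space M \<Longrightarrow> U n \<omega> $ j \<le> U (Suc n) \<omega> $ j"
  by (simp add: step)

text \<open>One step removes the fraction \<open>e n\<close> of the old proportions and adds new
  mass \<open>e n\<close>; each change has size \<open>e n\<close> in the sum norm.\<close>

lemma dist_proportion:
  assumes \<omega>: "\<omega> \<in> space M" and c: "U n \<omega> \<in> comps n" "U (Suc n) \<omega> \<in> comps (Suc n)"
  shows "dist (\<theta> n (U n \<omega>)) (\<theta> (Suc n) (U (Suc n) \<omega>)) \<le> 2 * e n"
proof -
  define x where "x = \<theta> n (U n \<omega>)"
  define y where "y = \<theta> (Suc n) (U (Suc n) \<omega>)"
  define v where "v = (\<lambda>j. (real (U (Suc n) \<omega> $ j) - real (U n \<omega> $ j)) / \<tau> (Suc n))"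
  have x: "x \<in> unit_simplex" using \<theta>_unit_simplex[OF c(1)] by (simp add: x_def)
  have v: "0 \<le> v j" for j using U_mono[OF \<omega>, of n j] by (simp add: v_def)
  have "(\<Sum>j\<in>UNIV. v j) = e n"
    using c by (simp add: v_def e_def comps_def ball_count_def sum_subtractf \<tau>_Suc
        flip: sum_divide_distrib of_nat_sum)
  have "y $ j - x $ j = v j - e n * x $ j" for j
  proof -
    have "real (U n \<omega> $ j) = x $ j * (real (\<tau> (Suc n)) - real (\<sigma> (Suc n)))"
      using \<tau>_pos[of n] by (simp add: x_def \<theta>_def \<tau>_Suc)
    then have "real (U n \<omega> $ j) / real (\<tau> (Suc n)) = x $ j - e n * x $ j"
      using \<tau>_pos[of "Suc n"] by (simp add: e_def field_simps)
    then show ?thesis by (simp add: v_def y_def \<theta>_def diff_divide_distrib)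
  qed
  then have "\<bar>(y - x) $ j\<bar> \<le> v j + e n * x $ j" for j
    using v[of j] e_nonneg[of n] x by (simp add: abs_le_iff unit_simplex_def)
  then have "norm (y - x) \<le> (\<Sum>j\<in>UNIV. v j + e n * x $ j)"
    by (intro order.trans[OF norm_le_l1_cart] sum_mono)
  also have "\<dots> = 2 * e n"
    using \<open>sum v UNIV = e n\<close> x by (simp add: sum.distrib unit_simplex_def flip: sum_distrib_left)
  finally show ?thesis by (simp add: dist_norm norm_minus_commute x_def y_def)
qed

end

lemma continuous_pos_near:
  fixes g :: "'a::metric_space \<Rightarrow> real"
  assumes "continuous_on S g" "z \<in> S" "0 < g z"
  shows "\<exists>d>0. \<forall>x\<in>S. dist x z < d \<longrightarrow> 0 < g x"
proof -
  from assms obtain d where "0 < d" "\<forall>x\<in>S. dist x z < d \<longrightarrow> dist (g x) (g z) < g z"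
    unfolding continuous_on_iff by blast
  then show ?thesis by (intro exI[of _ d]) (auto simp: dist_real_def abs_less_iff)
qed

context convex_urn
begin

text \<open>The tolerance may depend on the equilibrium, so each one can later be given the
  neighbourhood that its type requires.\<close>

lemma AE_eventually_near_equilibrium:
  assumes e: "\<not> summable e" "summable (\<lambda>n. (e n)\<^sup>2)"
    and \<delta>: "\<And>z. z \<in> unit_simplex \<Longrightarrow> imbalance z = 0 \<Longrightarrow> 0 < \<delta> z"
  shows "AE \<omega> in M. \<exists>z\<in>unit_simplex. imbalance z = 0 \<and> (\<exists>n0. \<forall>n\<ge>n0. dist (\<theta> n (U n \<omega>)) z < \<delta> z)"
proof -
  have "(\<lambda>n. sqrt ((e n)\<^sup>2)) \<longlonglongrightarrow> sqrt 0"
    by (intro tendsto_real_sqrt summable_LIMSEQ_zero e)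
  then have e0: "e \<longlonglongrightarrow> 0" using e_nonneg by simp
  have "AE \<omega> in M. \<forall>n. U n \<omega> \<in> comps n" by (simp add: AE_all_countable AE_comps)
  then show ?thesis using summable_imbalance AE_space
  proof eventually_elim
    case (elim \<omega>)
    have cont: "continuous_on unit_simplex imbalance"
      unfolding imbalance_def by (intro continuous_intros continuous_f_component)
    show ?case
      by (rule eventually_near_zero[OF compact_unit_simplex _ cont _ finite_equilibria \<delta> _ e_nonneg e0 e(1)])
        (use elim in \<open>auto intro: \<theta>_unit_simplex imbalance_nonneg dist_proportion\<close>)
  qed
qed

section \<open>Mixed equilibria are avoided\<close>

text \<open>By \<open>rf.diff_ge\<close>, weights differ at least by
  \<open>\<beta> * f (x $ k) / x $ k\<close> times the difference of the proportions; hypothesis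
  \<open>c\<close> turns this slope into \<open>c\<close> after normalisation.\<close>

lemma draw_expanding:
  assumes x: "x \<in> unit_simplex" and y: "0 < x $ k" "x $ k \<le> x $ i"
    and c: "c * (total_weight x * x $ k) \<le> \<beta> * f (x $ k)"
  shows "c * (x $ i - x $ k)\<^sup>2 \<le> (draw x i - draw x k) * (x $ i - x $ k)"
proof -
  define S where "S = total_weight x"
  have S: "S > 0" unfolding S_def by (rule total_weight_pos[OF x])
  have "x $ k * (c * S * (x $ i - x $ k)) = c * (S * x $ k) * (x $ i - x $ k)" by simp
  also have "\<dots> \<le> \<beta> * f (x $ k) * (x $ i - x $ k)"
    using c y by (intro mult_right_mono) (auto simp: S_def)
  also have "\<dots> \<le> x $ k * (f (x $ i) - f (x $ k))"
    using rf.diff_ge[of "x $ k" "x $ i"] y unit_simplex_le_1[OF x] by auto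
  finally have "c * S * (x $ i - x $ k) \<le> f (x $ i) - f (x $ k)" using y by simp
  then have "c * (x $ i - x $ k) \<le> draw x i - draw x k"
    using S by (simp add: draw_def field_simps flip: S_def)
  then have "c * (x $ i - x $ k) * (x $ i - x $ k) \<le> (draw x i - draw x k) * (x $ i - x $ k)"
    using y by (intro mult_right_mono) auto
  then show ?thesis by (simp add: power2_eq_square mult.assoc)
qed

text \<open>At \<open>z\<close> each positive component is a common value \<open>a\<close>, and
  \<open>total_weight z * a = f a\<close>. So the condition of \<open>draw_expanding\<close> holds
  there strictly for any factor below \<beta>, and by continuity also nearby.\<close>

lemma expanding_near_mixed:
  assumes z: "z \<in> unit_simplex" "imbalance z = 0" and ik: "0 < z $ i" "0 < z $ k"
  obtains \<delta> s where "0 < \<delta>" "0 < s"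
    "\<And>x. x \<in> unit_simplex \<Longrightarrow> dist x z < \<delta> \<Longrightarrow> s \<le> draw x i * draw x k \<and>
      (1 + (\<beta> - 1) / 2) * (x $ i - x $ k)\<^sup>2 \<le> (draw x i - draw x k) * (x $ i - x $ k)"
proof -
  define a where "a = z $ i"
  \<comment> \<open>Halfway between 1 and \<beta>: the gap to \<beta> is spent on continuity, the
    excess over 1 is the expansion rate.\<close>
  define c where "c = 1 + (\<beta> - 1) / 2"
  have c: "0 < c" "c < \<beta>" using rf.\<beta>1 by (auto simp: c_def field_simps)
  have k: "z $ k = a" using imbalance_zero[OF z, of i k] ik by (simp add: a_def)
  have a: "0 < a" "a \<le> 1" using ik unit_simplex_le_1[OF z(1)] by (auto simp: a_def)
  have fa: "0 < f a" using rf.pos a by simp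
  have "f (z $ j) * a = z $ j * f a" for j
    using imbalance_zero[OF z, of i j] ik rf.f0 by (auto simp: a_def)
  then have "total_weight z * a = (\<Sum>j\<in>UNIV. z $ j * f a)"
    by (simp add: total_weight_def sum_distrib_right)
  also have "\<dots> = f a" using z by (simp add: unit_simplex_def flip: sum_distrib_right)
  finally have eq: "total_weight z * a = f a" .
  \<comment> \<open>Positivity of \<open>g\<close> is the condition of
    \<open>draw_expanding\<close>, for both colours because either may be the smaller one.
    Positivity of \<open>h\<close> bounds the draw probabilities below and keeps both proportions
    positive.\<close>
  define g where "g = (\<lambda>l (x :: real ^ 'd). \<beta> * f (x $ l) - c * (total_weight x * x $ l))"
  define h where "h = (\<lambda>l (x :: real ^ 'd). f (x $ l) - f a / 2)"
  have cont: "continuous_on unit_simplex (g l)" "continuous_on unit_simplex (h l)" for l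
    unfolding g_def h_def total_weight_def by (intro continuous_intros continuous_f_component)+
  have "\<exists>d>0. \<forall>x\<in>unit_simplex. dist x z < d \<longrightarrow> 0 < g l x" if "z $ l = a" for l
    by (rule continuous_pos_near[OF cont(1) z(1)]) (use that c fa in \<open>simp add: g_def eq\<close>)
  from this[of i] this[of k] obtain d1 d2 where
    d: "0 < d1" "0 < d2" "\<And>x. x \<in> unit_simplex \<Longrightarrow> dist x z < d1 \<Longrightarrow> 0 < g i x"
      "\<And>x. x \<in> unit_simplex \<Longrightarrow> dist x z < d2 \<Longrightarrow> 0 < g k x"
    using k by (auto simp: a_def)
  have "\<exists>d>0. \<forall>x\<in>unit_simplex. dist x z < d \<longrightarrow> 0 < h l x" if "z $ l = a" for l
    by (rule continuous_pos_near[OF cont(2) z(1)]) (use that fa in \<open>simp add: h_def\<close>)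
  from this[of i] this[of k] obtain d3 d4 where
    d': "0 < d3" "0 < d4" "\<And>x. x \<in> unit_simplex \<Longrightarrow> dist x z < d3 \<Longrightarrow> 0 < h i x"
      "\<And>x. x \<in> unit_simplex \<Longrightarrow> dist x z < d4 \<Longrightarrow> 0 < h k x"
    using k by (auto simp: a_def)
  define \<delta> where "\<delta> = min (min d1 d2) (min d3 d4)"
  show ?thesis
  proof (rule that[of \<delta> "f a / 2 * (f a / 2)"])
    fix x assume x: "x \<in> unit_simplex" "dist x z < \<delta>"
    then have g: "0 < g i x" "0 < g k x" and h: "0 < h i x" "0 < h k x"
      using d d' by (auto simp: \<delta>_def)
    have ge: "f (x $ l) \<le> draw x l" for l
      using total_weight_pos[OF x(1)] total_weight_le_1[OF x(1)] f_nonneg[OF x(1)]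
      by (simp add: draw_def field_simps mult_left_le_one_le)
    have "f a / 2 \<le> draw x i" "f a / 2 \<le> draw x k" using h ge[of i] ge[of k] by (auto simp: h_def)
    then have "f a / 2 * (f a / 2) \<le> draw x i * draw x k" using fa by (intro mult_mono) auto
    moreover have "0 < x $ l" if "0 < h l x" for l
    proof -
      have "f (x $ l) \<noteq> 0" using that fa by (auto simp: h_def)
      then have "x $ l \<noteq> 0" using rf.f0 by auto
      then show ?thesis using x(1) by (auto simp: unit_simplex_def less_le)
    qed
    with h have pos: "0 < x $ i" "0 < x $ k" by auto
    have "c * (x $ i - x $ k)\<^sup>2 \<le> (draw x i - draw x k) * (x $ i - x $ k)"
    proof (cases "x $ k \<le> x $ i")
      case True
      then show ?thesis using g by (intro draw_expanding x pos) (auto simp: g_def)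
    next
      case False
      have "c * (x $ k - x $ i)\<^sup>2 \<le> (draw x k - draw x i) * (x $ k - x $ i)"
        using g False by (intro draw_expanding x pos) (auto simp: g_def)
      then show ?thesis by (simp add: power2_commute[of "x $ k"] algebra_simps)
    qed
    ultimately show "f a / 2 * (f a / 2) \<le> draw x i * draw x k \<and>
      (1 + (\<beta> - 1) / 2) * (x $ i - x $ k)\<^sup>2 \<le> (draw x i - draw x k) * (x $ i - x $ k)"
      by (simp add: c_def)
  qed (use d d' fa in \<open>auto simp: \<delta>_def\<close>)
qed

lemma component_le: "u \<in> comps n \<Longrightarrow> u $ j \<le> \<tau> n"
  using member_le_sum[of j UNIV "\<lambda>j. u $ j"] by (auto simp: comps_def ball_count_def)

text \<open>The expected drift accumulated while staying is finite. If staying forever had positive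
  probability, it would dominate a positive multiple of the divergent sum
  \<Sum>\<open>e\<close>.\<close>

lemma prob_stay_mixed:
  fixes N :: "nat \<Rightarrow> nat ^ 'd \<Rightarrow> bool"
  assumes e: "\<not> summable e" "summable (\<lambda>n. (e n)\<^sup>2)" and e4: "\<And>m. n \<le> m \<Longrightarrow> e m \<le> 1 / 4"
    and ik: "i \<noteq> k" and s: "0 < s"
    and N: "\<And>m u. u \<in> comps m \<Longrightarrow> N m u \<Longrightarrow> s \<le> draw (\<theta> m u) i * draw (\<theta> m u) k"
      "\<And>m u. u \<in> comps m \<Longrightarrow> N m u \<Longrightarrow> (1 + (\<beta> - 1) / 2) * (\<theta> m u $ i - \<theta> m u $ k)\<^sup>2 \<le>
        (draw (\<theta> m u) i - draw (\<theta> m u) k) * (\<theta> m u $ i - \<theta> m u $ k)"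
  shows "AE \<omega> in M. \<not> (\<forall>m\<ge>n. N m (U m \<omega>))"
proof -
  define b where "b = 2432 / s"
  define \<kappa> where "\<kappa> = (\<beta> - 1) / 2"
  have \<kappa>: "0 < \<kappa>" "\<kappa> \<le> 1 / 2" using rf.\<beta>1 rf.\<beta>2 by (auto simp: \<kappa>_def)
  have b: "0 \<le> b" using s by (simp add: b_def)
  define D where "D = (\<lambda>w :: nat ^ 'd. real (w $ i) - real (w $ k))"
  define W where "W = (\<lambda>m w. repulsion b (real (\<tau> m)) (D w) - ln 17)"
  define \<eta> where "\<eta> = (\<lambda>m. (11 + b) * (e m)\<^sup>2)"
  have "\<exists>C. \<forall>M'\<ge>n. (\<Sum>m=n..<M'. expectation (\<lambda>\<omega>. indicator (stay N n m) \<omega> * (2 * \<kappa> * e m))) \<le> C + (\<Sum>m=n..<M'. \<eta> m)"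
  proof (rule lyapunov[where W = W])
    fix m u assume nm: "n \<le> m" and u: "u \<in> comps m"
    have t: "1 \<le> real (\<tau> m)" using \<tau>_pos[of m] by simp
    have "\<bar>D u\<bar> \<le> real (\<tau> m)" using component_le[OF u, of i] component_le[OF u, of k] by (simp add: D_def)
    then show "W m u \<le> 0" using repulsion_le[OF t _ b] by (simp add: W_def)
    assume Nu: "N m u"
    have x: "\<theta> m u \<in> unit_simplex" by (rule \<theta>_unit_simplex[OF u])
    let ?p = "draw (\<theta> m u)"
    have em: "real (\<sigma> (Suc m)) / (real (\<tau> m) + real (\<sigma> (Suc m))) = e m" by (simp add: e_def \<tau>_Suc)
    have Dx: "D u = real (\<tau> m) * (\<theta> m u $ i - \<theta> m u $ k)"
      using t by (simp add: D_def \<theta>_def right_diff_distrib)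
    have "real (\<tau> m) * real (\<tau> m) * ((1 + \<kappa>) * (\<theta> m u $ i - \<theta> m u $ k)\<^sup>2) \<le>
        real (\<tau> m) * real (\<tau> m) * ((?p i - ?p k) * (\<theta> m u $ i - \<theta> m u $ k))"
      using N(2)[OF u Nu] unfolding \<kappa>_def by (intro mult_left_mono) auto
    then have drift: "(1 + \<kappa>) * (D u)\<^sup>2 \<le> real (\<tau> m) * ((?p i - ?p k) * D u)"
      unfolding Dx by (simp add: power2_eq_square mult_ac)
    have "repulsion b (\<tau> m) (D u) + 2 * \<kappa> * e m - (11 + b) * (e m)\<^sup>2 \<le>
        avg ?p (\<sigma> (Suc m)) (\<lambda>w. repulsion b (real (\<tau> m) + real (\<sigma> (Suc m))) (D w)) u"
      using avg_repulsion[OF draw_nonneg[OF x] sum_draw[OF x] ik _ s N(1)[OF u Nu] less_imp_le[OF \<kappa>(1)] \<kappa>(2),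
          of "real (\<tau> m)" u "\<sigma> (Suc m)"] t drift e4[OF nm]
      unfolding em b_def D_def by simp
    then show "W m u + 2 * \<kappa> * e m - \<eta> m \<le> avg ?p (\<sigma> (Suc m)) (W (Suc m)) u"
      by (simp add: W_def avg_diff avg_const[OF sum_draw[OF x]] \<eta>_def \<tau>_Suc)
  qed (use b in \<open>simp add: \<eta>_def\<close>)
  then obtain C where C: "\<And>k. n \<le> k \<Longrightarrow>
      (\<Sum>m=n..<k. expectation (\<lambda>\<omega>. indicator (stay N n m) \<omega> * (2 * \<kappa> * e m))) \<le> C + (\<Sum>m=n..<k. \<eta> m)" by blast
  have \<eta>: "(\<Sum>m=n..<k. \<eta> m) \<le> suminf \<eta>" for k
    by (rule sum_le_suminf) (use e(2) b in \<open>auto simp: \<eta>_def intro: summable_mult\<close>)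
  define A where "A = {\<omega>\<in>space M. \<forall>m\<in>{n..}. N m (U m \<omega>)}"
  have A: "A \<in> sets M"
  proof -
    have "A = (\<Inter>m\<in>{n..}. stay N n m)"
      by (auto simp: A_def stay_def)
    then show ?thesis by (auto intro!: sets.countable_INT' stay_sets)
  qed
  have "prob A = 0"
  proof (rule ccontr)
    assume "prob A \<noteq> 0"
    then have pA: "0 < prob A" by (simp add: less_le)
    have "summable (\<lambda>m. e (m + n))"
    proof (rule bounded_imp_summable)
      fix l
      have "2 * \<kappa> * prob A * (\<Sum>m\<le>l. e (m + n)) = (\<Sum>m=n..<n + Suc l. 2 * \<kappa> * prob A * e m)"
        using sum.shift_bounds_nat_ivl[of "\<lambda>m. 2 * \<kappa> * prob A * e m" 0 n "Suc l"]
        by (simp add: atLeast0LessThan lessThan_Suc_atMost add.commute sum_distrib_left)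
      also have "\<dots> \<le> (\<Sum>m=n..<n + Suc l. expectation (\<lambda>\<omega>. indicator (stay N n m) \<omega> * (2 * \<kappa> * e m)))"
      proof (intro sum_mono)
        fix m assume "m \<in> {n..<n + Suc l}"
        then have m: "n \<le> m" by simp
        \<comment> \<open>The event of staying forever lies in every finite-time event, so its
          probability bounds all terms below.\<close>
        have "prob A \<le> prob (stay N n m)"
          using stay_sets[OF m] by (intro finite_measure_mono) (auto simp: A_def stay_def)
        then have "prob A * (2 * \<kappa> * e m) \<le> prob (stay N n m) * (2 * \<kappa> * e m)"
          using \<kappa> e_nonneg by (intro mult_right_mono) auto
        then show "2 * \<kappa> * prob A * e m \<le> expectation (\<lambda>\<omega>. indicator (stay N n m) \<omega> * (2 * \<kappa> * e m))"
          using stay_sets[OF m, of N] by (simp add: mult_ac)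
      qed
      also have "\<dots> \<le> C + suminf \<eta>" using C[of "n + Suc l"] \<eta>[of "n + Suc l"] by simp
      finally show "(\<Sum>m\<le>l. e (m + n)) \<le> (C + suminf \<eta>) / (2 * \<kappa> * prob A)"
        using pA \<kappa> by (simp add: field_simps)
    qed (rule e_nonneg)
    then show False using e(1) by (simp add: summable_iff_shift)
  qed
  then have "AE \<omega> in M. \<omega> \<notin> A" using A by (simp add: prob_eq_0)
  then show ?thesis using AE_space by eventually_elim (auto simp: A_def)
qed

lemma eventually_e_le:
  assumes "summable (\<lambda>n. (e n)\<^sup>2)"
  obtains n1 where "\<And>m. n1 \<le> m \<Longrightarrow> e m \<le> 1 / 4"
proof -
  have "\<forall>\<^sub>F m in sequentially. (e m)\<^sup>2 < (1 / 4)\<^sup>2"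
    by (intro order_tendstoD[OF summable_LIMSEQ_zero[OF assms]]) simp
  then obtain n1 where "\<And>m. n1 \<le> m \<Longrightarrow> (e m)\<^sup>2 < (1 / 4)\<^sup>2" by (auto simp: eventually_sequentially)
  then show ?thesis using that power2_le_imp_le[of "e _" "1 / 4"] by force
qed

lemma AE_avoid_mixed:
  assumes e: "\<not> summable e" "summable (\<lambda>n. (e n)\<^sup>2)"
    and z: "z \<in> unit_simplex" "imbalance z = 0" and ik: "0 < z $ i" "0 < z $ k" "i \<noteq> k"
  shows "\<exists>\<delta>>0. AE \<omega> in M. \<not> (\<exists>n0. \<forall>n\<ge>n0. dist (\<theta> n (U n \<omega>)) z < \<delta>)"
proof -
  obtain n1 where n1: "\<And>m. n1 \<le> m \<Longrightarrow> e m \<le> 1 / 4" using eventually_e_le[OF e(2)] by blast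
  obtain \<delta> s where \<delta>: "0 < \<delta>" and s: "0 < s" and *:
    "\<And>x. x \<in> unit_simplex \<Longrightarrow> dist x z < \<delta> \<Longrightarrow> s \<le> draw x i * draw x k \<and>
      (1 + (\<beta> - 1) / 2) * (x $ i - x $ k)\<^sup>2 \<le> (draw x i - draw x k) * (x $ i - x $ k)"
    using expanding_near_mixed[OF z ik(1,2)] by blast
  have "AE \<omega> in M. \<not> (\<forall>m\<ge>max n0 n1. dist (\<theta> m (U m \<omega>)) z < \<delta>)" for n0
    by (rule prob_stay_mixed[OF e _ ik(3) s, where N = "\<lambda>m u. dist (\<theta> m u) z < \<delta>"])
      (use n1 * in \<open>auto simp: \<theta>_unit_simplex\<close>)
  then have "AE \<omega> in M. \<forall>n0. \<not> (\<forall>m\<ge>max n0 n1. dist (\<theta> m (U m \<omega>)) z < \<delta>)"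
    by (simp only: AE_all_countable) blast
  then have "AE \<omega> in M. \<not> (\<exists>n0. \<forall>n\<ge>n0. dist (\<theta> n (U n \<omega>)) z < \<delta>)"
    by eventually_elim (meson max.boundedE)
  then show ?thesis using \<delta> by blast
qed


section \<open>Fixation near a vertex\<close>

text \<open>The number of added balls of colour \<open>j\<close> is binomial, and its variance is at
  most its mean.\<close>

lemma avg_count_square:
  assumes u: "u \<in> comps n"
  shows "avg (draw (\<theta> n u)) k (\<lambda>w. (real (w $ j))\<^sup>2) u \<le>
    (real (u $ j) + k * draw (\<theta> n u) j)\<^sup>2 + k * draw (\<theta> n u) j"
proof -
  define p where "p = draw (\<theta> n u)"
  have x: "\<theta> n u \<in> unit_simplex" by (rule \<theta>_unit_simplex[OF u])
  have p: "sum p UNIV = 1" "\<And>j. 0 \<le> p j" using sum_draw[OF x] draw_nonneg[OF x] by (auto simp: p_def)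
  have delta: "(\<Sum>k\<in>UNIV. q k * of_bool (k = j)) = q j" for q :: "'d \<Rightarrow> real"
    by (simp add: of_bool_def if_distrib[of "\<lambda>x. _ * x"] cong: if_cong)
  have "(\<Sum>l\<in>UNIV. p l * (of_bool (l = j) - p j)\<^sup>2) =
      (\<Sum>l\<in>UNIV. (p l * (1 - 2 * p j)) * of_bool (l = j) + p l * (p j)\<^sup>2)"
    by (intro sum.cong) (auto simp: power2_eq_square algebra_simps)
  also have "\<dots> = p j - (p j)\<^sup>2"
    by (simp add: sum.distrib delta p flip: sum_distrib_right) (simp add: power2_eq_square algebra_simps)
  also have "\<dots> \<le> p j" by simp
  finally have "k * (\<Sum>l\<in>UNIV. p l * (of_bool (l = j) - p j)\<^sup>2) \<le> k * p j"
    by (intro mult_left_mono) auto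
  then show ?thesis
    using avg_lin_square[OF p(1), of k "\<lambda>k. of_bool (k = j)" 0 u]
    by (simp add: lin_unit delta p_def)
qed

text \<open>In relative terms the expected \<open>U\<^sub>j\<^sup>2\<close> grows by at most
  \<open>8 * \<kappa> * e m\<close>, while \<open>\<tau> powr (1 - \<beta>)\<close> shrinks by at
  least \<open>16 * \<kappa> * e m\<close>; hence the expected sum of \<open>e m * W m\<close> is
  finite. By \<open>N1\<close> this sum controls the expected number of balls of colour
  \<open>j\<close> added, and a convergent sum of integers has only finitely many nonzero
  terms.\<close>

lemma AE_minority_stops:
  fixes N :: "nat \<Rightarrow> nat ^ 'd \<Rightarrow> bool" and j :: 'd
  assumes e4: "\<And>m. n \<le> m \<Longrightarrow> e m \<le> 1 / 4" and c: "0 < c"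
    and N1: "\<And>m u. u \<in> comps m \<Longrightarrow> N m u \<Longrightarrow> draw (\<theta> m u) j \<le> (\<theta> m u $ j) powr \<beta> / c"
    and N2: "\<And>m u. u \<in> comps m \<Longrightarrow> N m u \<Longrightarrow> draw (\<theta> m u) j \<le> (\<beta> - 1) / 16 * \<theta> m u $ j"
  shows "AE \<omega> in M. (\<forall>m\<ge>n. N m (U m \<omega>)) \<longrightarrow> (\<exists>n1. \<forall>m\<ge>n1. U (Suc m) \<omega> $ j = U m \<omega> $ j)"
proof -
  define \<kappa> where "\<kappa> = (\<beta> - 1) / 16"
  have \<kappa>: "0 < \<kappa>" "\<kappa> \<le> 1 / 16" "\<beta> - 1 = 16 * \<kappa>" using rf.\<beta>1 rf.\<beta>2 by (auto simp: \<kappa>_def)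
  define W where "W = (\<lambda>m (u :: nat ^ 'd). (real (u $ j))\<^sup>2 * real (\<tau> m) powr (1 - \<beta>))"
  have W0: "0 \<le> W m u" for m u by (simp add: W_def)
  \<comment> \<open>Since \<open>e m \<le> 1 / 4\<close>, dividing by the old total instead of the
    new one costs less than a factor 2.\<close>
  have ratio: "real (\<sigma> (Suc m)) / real (\<tau> m) \<le> 2 * e m" if "n \<le> m" for m
  proof -
    have "4 * real (\<sigma> (Suc m)) \<le> real (\<tau> m) + real (\<sigma> (Suc m))"
      using e4[OF that] \<tau>_pos[of m] by (simp add: e_def \<tau>_Suc field_simps)
    then have "real (\<sigma> (Suc m)) / real (\<tau> m) \<le> real (\<sigma> (Suc m)) / ((real (\<tau> m) + real (\<sigma> (Suc m))) / 2)"
      using \<tau>_pos[of m] by (intro divide_left_mono mult_pos_pos) auto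
    then show ?thesis by (simp add: e_def \<tau>_Suc mult.commute)
  qed
  have "\<exists>C. \<forall>k\<ge>n. (\<Sum>m=n..<k. expectation (\<lambda>\<omega>. indicator (stay N n m) \<omega> * (8 * \<kappa> * e m * W m (U m \<omega>)))) \<le>
      C + (\<Sum>m=n..<k. 0)"
  proof (rule lyapunov[where W = "\<lambda>m u. - W m u"])
    fix m u assume nm: "n \<le> m" and u: "u \<in> comps m" and Nu: "N m u"
    let ?s = "real (\<sigma> (Suc m))"
    define p where "p = draw (\<theta> m u) j"
    define y where "y = real (u $ j)"
    have x: "\<theta> m u \<in> unit_simplex" by (rule \<theta>_unit_simplex[OF u])
    have p0: "0 \<le> p" using draw_nonneg[OF x] by (simp add: p_def)
    \<comment> \<open>As \<open>y\<close> is a natural number, \<open>y \<le> y\<^sup>2\<close>;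
      this lets the variance, which is linear in \<open>y\<close>, be absorbed into the
      square.\<close>
    have y0: "0 \<le> y" "y \<le> y\<^sup>2" by (cases "u $ j = 0"; simp add: y_def power2_eq_square)+
    have e: "0 \<le> e m" "e m \<le> 1 / 4" using e_nonneg e4[OF nm] by auto
    have sp: "?s * p \<le> 2 * \<kappa> * e m * y"
    proof -
      have "?s * p \<le> ?s * (\<kappa> * (y / real (\<tau> m)))"
        using N2[OF u Nu] by (intro mult_left_mono) (auto simp: p_def \<kappa>_def y_def \<theta>_def)
      also have "\<dots> = (?s / real (\<tau> m)) * (\<kappa> * y)" by simp
      also have "\<dots> \<le> (2 * e m) * (\<kappa> * y)"
        using ratio[OF nm] \<kappa> y0 by (intro mult_right_mono) auto
      finally show ?thesis by (simp only: mult_ac)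
    qed
    have "(y + ?s * p)\<^sup>2 + ?s * p \<le> (y + 2 * \<kappa> * e m * y)\<^sup>2 + 2 * \<kappa> * e m * y\<^sup>2"
    proof (intro add_mono power_mono)
      have "2 * \<kappa> * e m * y \<le> 2 * \<kappa> * e m * y\<^sup>2" using y0 \<kappa> e by (intro mult_left_mono) auto
      then show "?s * p \<le> 2 * \<kappa> * e m * y\<^sup>2" using sp by linarith
    qed (use sp y0 p0 in auto)
    also have "\<dots> = y\<^sup>2 * (1 + 6 * \<kappa> * e m + 4 * \<kappa> * e m * (\<kappa> * e m))"
      by (simp add: power2_eq_square algebra_simps)
    also have "\<dots> \<le> y\<^sup>2 * (1 + 8 * \<kappa> * e m)"
    proof (intro mult_left_mono)
      have "\<kappa> * e m \<le> 1 * (1 / 4)" using \<kappa> e by (intro mult_mono) auto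
      then have "4 * (\<kappa> * e m) * (\<kappa> * e m) \<le> 4 * (\<kappa> * e m) * (1 / 4)" using \<kappa> e by (intro mult_left_mono) auto
      then show "1 + 6 * \<kappa> * e m + 4 * \<kappa> * e m * (\<kappa> * e m) \<le> 1 + 8 * \<kappa> * e m"
        using mult_nonneg_nonneg[OF less_imp_le[OF \<kappa>(1)] e(1)] by linarith
    qed simp
    finally have sq: "(y + ?s * p)\<^sup>2 + ?s * p \<le> y\<^sup>2 * (1 + 8 * \<kappa> * e m)" .
    \<comment> \<open>The ratio of the two powers is \<open>(1 - e m) powr (\<beta> - 1)\<close>,
      bounded by its tangent as \<open>\<beta> - 1 = 16 * \<kappa>\<close> lies between 0 and
      1.\<close>
    have pw: "real (\<tau> (Suc m)) powr (1 - \<beta>) \<le> real (\<tau> m) powr (1 - \<beta>) * (1 - 16 * \<kappa> * e m)"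
    proof -
      have "1 - e m = real (\<tau> m) / real (\<tau> (Suc m))"
        using \<tau>_pos[of "Suc m"] by (simp add: e_def field_simps) (simp add: \<tau>_Suc)
      then have "real (\<tau> (Suc m)) powr (1 - \<beta>) = real (\<tau> m) powr (1 - \<beta>) * (1 - e m) powr (\<beta> - 1)"
        using \<tau>_pos[of m] \<tau>_pos[of "Suc m"] powr_minus_divide[of "real (\<tau> m)" "\<beta> - 1"]
          powr_minus_divide[of "real (\<tau> (Suc m))" "\<beta> - 1"]
        by (simp add: powr_divide)
      also have "\<dots> \<le> real (\<tau> m) powr (1 - \<beta>) * (1 + (\<beta> - 1) * ((1 - e m) - 1))"
        using e rf.\<beta>1 rf.\<beta>2 by (intro mult_left_mono powr_le_linear) auto
      finally show ?thesis by (simp add: \<kappa>(3))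
    qed
    have "avg (draw (\<theta> m u)) (\<sigma> (Suc m)) (W (Suc m)) u =
        real (\<tau> (Suc m)) powr (1 - \<beta>) * avg (draw (\<theta> m u)) (\<sigma> (Suc m)) (\<lambda>w. (real (w $ j))\<^sup>2) u"
      by (simp add: W_def mult.commute flip: avg_cmult)
    also have "\<dots> \<le> real (\<tau> (Suc m)) powr (1 - \<beta>) * ((y + ?s * p)\<^sup>2 + ?s * p)"
      using avg_count_square[OF u, of "\<sigma> (Suc m)" j] by (intro mult_left_mono) (auto simp: y_def p_def)
    also have "\<dots> \<le> (real (\<tau> m) powr (1 - \<beta>) * (1 - 16 * \<kappa> * e m)) * (y\<^sup>2 * (1 + 8 * \<kappa> * e m))"
      using pw sq p0 y0 by (intro mult_mono) (auto intro: order.trans[OF powr_ge_zero])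
    also have "\<dots> = W m u * ((1 - 16 * \<kappa> * e m) * (1 + 8 * \<kappa> * e m))"
      by (simp add: W_def y_def)
    also have "\<dots> \<le> W m u * (1 - 8 * \<kappa> * e m)"
    proof (intro mult_left_mono W0)
      have "0 \<le> 128 * (\<kappa> * e m) * (\<kappa> * e m)" using \<kappa> e by simp
      then show "(1 - 16 * \<kappa> * e m) * (1 + 8 * \<kappa> * e m) \<le> 1 - 8 * \<kappa> * e m"
        by (simp add: algebra_simps)
    qed
    finally have "avg (draw (\<theta> m u)) (\<sigma> (Suc m)) (W (Suc m)) u \<le> W m u - 8 * \<kappa> * e m * W m u"
      by (simp add: algebra_simps)
    then show "- W m u + 8 * \<kappa> * e m * W m u - 0 \<le> avg (draw (\<theta> m u)) (\<sigma> (Suc m)) (\<lambda>u. - W (Suc m) u) u"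
      using avg_cmult[of "draw (\<theta> m u)" "\<sigma> (Suc m)" "-1" "W (Suc m)" u] by simp
  qed (use W0 in auto)
  then obtain C where C: "\<And>k. n \<le> k \<Longrightarrow>
      (\<Sum>m=n..<k. expectation (\<lambda>\<omega>. indicator (stay N n m) \<omega> * (8 * \<kappa> * e m * W m (U m \<omega>)))) \<le> C" by auto
  \<comment> \<open>Shifted by \<open>n\<close>, because \<open>stay\<close> and its bounds concern
    times from \<open>n\<close> onwards.\<close>
  define g where "g = (\<lambda>m \<omega>. indicator (stay N n (m + n)) \<omega> * (real (U (Suc (m + n)) \<omega> $ j) - real (U (m + n) \<omega> $ j)))"
  \<comment> \<open>Makes \<open>A * (8 * \<kappa> * e m * W m u)\<close> equal to
    \<open>2 * e m * W m u / c\<close>, the bound for the expected number of new balls.\<close>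
  define A where "A = 1 / (4 * \<kappa> * c)"
  have int: "integrable M (\<lambda>\<omega>. indicator (stay N n m) \<omega> * real (U l \<omega> $ j))" if "n \<le> m" for l m
    using stay_sets[OF that] by (rule integrable_U[where \<phi> = "\<lambda>u. real (u $ j)"])
  have g_int: "integrable M (g m)" for m
    unfolding g_def right_diff_distrib by (intro Bochner_Integration.integrable_diff int) auto
  have Eg: "expectation (\<lambda>\<omega>. indicator (stay N n m) \<omega> * (real (U (Suc m) \<omega> $ j) - real (U m \<omega> $ j))) \<le>
      A * expectation (\<lambda>\<omega>. indicator (stay N n m) \<omega> * (8 * \<kappa> * e m * W m (U m \<omega>)))" if nm: "n \<le> m" for m
  proof -
    note sets = stay_sets[OF nm, of N]
    let ?p = "\<lambda>u. avg (draw (\<theta> m u)) (\<sigma> (Suc m)) (\<lambda>w. real (w $ j)) u"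
    have "expectation (\<lambda>\<omega>. indicator (stay N n m) \<omega> * (real (U (Suc m) \<omega> $ j) - real (U m \<omega> $ j))) =
        expectation (\<lambda>\<omega>. indicator (stay N n m) \<omega> * ?p (U m \<omega>)) -
        expectation (\<lambda>\<omega>. indicator (stay N n m) \<omega> * real (U m \<omega> $ j))"
      using expectation_step[OF stay_history[OF nm], of N "\<lambda>w. real (w $ j)"] int[OF nm]
      by (simp add: right_diff_distrib)
    also have "\<dots> = expectation (\<lambda>\<omega>. indicator (stay N n m) \<omega> * ?p (U m \<omega>) -
        indicator (stay N n m) \<omega> * real (U m \<omega> $ j))"
      using int[OF nm, of m] integrable_U[OF sets, of ?p m] by simp
    also have "\<dots> \<le> expectation (\<lambda>\<omega>. A * (indicator (stay N n m) \<omega> * (8 * \<kappa> * e m * W m (U m \<omega>))))"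
    proof (rule integral_mono_AE)
      show "integrable M (\<lambda>\<omega>. indicator (stay N n m) \<omega> * ?p (U m \<omega>) - indicator (stay N n m) \<omega> * real (U m \<omega> $ j))"
        using int[OF nm, of m] integrable_U[OF sets, of ?p m] by (rule Bochner_Integration.integrable_diff[rotated])
      show "integrable M (\<lambda>\<omega>. A * (indicator (stay N n m) \<omega> * (8 * \<kappa> * e m * W m (U m \<omega>))))"
        using integrable_U[OF sets, of "\<lambda>u. 8 * \<kappa> * e m * W m u" m] by simp
      show "AE \<omega> in M. indicator (stay N n m) \<omega> * ?p (U m \<omega>) - indicator (stay N n m) \<omega> * real (U m \<omega> $ j)
          \<le> A * (indicator (stay N n m) \<omega> * (8 * \<kappa> * e m * W m (U m \<omega>)))"
        using AE_comps[of m]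
      proof eventually_elim
        case (elim \<omega>)
        show ?case
        proof (cases "\<omega> \<in> stay N n m")
          case True
          define u where "u = U m \<omega>"
          have u: "u \<in> comps m" "N m u" using True elim nm by (auto simp: stay_def u_def)
          have t: "0 < real (\<tau> m)" using \<tau>_pos by simp
          have "?p u - real (u $ j) = \<sigma> (Suc m) * draw (\<theta> m u) j" by (simp add: avg_count[OF u(1)])
          also have "\<dots> \<le> \<sigma> (Suc m) * ((\<theta> m u $ j) powr \<beta> / c)" using N1[OF u] by (intro mult_left_mono) auto
          also have "\<dots> = (\<sigma> (Suc m) / real (\<tau> m)) * (real (u $ j) powr \<beta> * real (\<tau> m) powr (1 - \<beta>) / c)"
            using t by (simp add: \<theta>_def powr_divide powr_diff)
          also have "\<dots> \<le> (2 * e m) * ((real (u $ j))\<^sup>2 * real (\<tau> m) powr (1 - \<beta>) / c)"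
          proof (intro mult_mono ratio nm divide_right_mono mult_right_mono)
            show "real (u $ j) powr \<beta> \<le> (real (u $ j))\<^sup>2"
            proof (cases "u $ j = 0")
              case False
              then have "real (u $ j) powr \<beta> \<le> real (u $ j) powr 2"
                using rf.\<beta>2 by (intro powr_mono) auto
              then show ?thesis using False by (simp add: powr_numeral)
            qed simp
          qed (use e_nonneg c in auto)
          also have "\<dots> = A * (8 * \<kappa> * e m * W m u)" using \<kappa> c by (simp add: A_def W_def field_simps)
          finally show ?thesis using True by (simp add: u_def)
        qed simp
      qed
    qed
    also have "\<dots> = A * expectation (\<lambda>\<omega>. indicator (stay N n m) \<omega> * (8 * \<kappa> * e m * W m (U m \<omega>)))"
      by simp
    finally show ?thesis .
  qed
  have A: "0 \<le> A" using \<kappa> c by (simp add: A_def)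
  have "AE \<omega> in M. summable (\<lambda>m. g m \<omega>)"
  proof (rule AE_summable[OF g_int])
    show "AE \<omega> in M. 0 \<le> g m \<omega>" for m
      using AE_space by eventually_elim (simp add: g_def U_mono)
    fix k
    have "(\<Sum>m<k. expectation (g m)) = (\<Sum>m=n..<n + k. expectation (\<lambda>\<omega>. indicator (stay N n m) \<omega> * (real (U (Suc m) \<omega> $ j) - real (U m \<omega> $ j))))"
      using sum.shift_bounds_nat_ivl[of "\<lambda>m. expectation (\<lambda>\<omega>. indicator (stay N n m) \<omega> * (real (U (Suc m) \<omega> $ j) - real (U m \<omega> $ j)))" 0 n k]
      by (simp add: g_def atLeast0LessThan add.commute)
    also have "\<dots> \<le> (\<Sum>m=n..<n + k. A * expectation (\<lambda>\<omega>. indicator (stay N n m) \<omega> * (8 * \<kappa> * e m * W m (U m \<omega>))))"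
      by (intro sum_mono Eg) simp
    also have "\<dots> \<le> A * C"
      unfolding sum_distrib_left[symmetric] using C[of "n + k"] A by (intro mult_left_mono) auto
    finally show "(\<Sum>m<k. expectation (g m)) \<le> A * C" .
  qed
  then show ?thesis using AE_space
  proof eventually_elim
    case (elim \<omega>)
    show ?case
    proof
      assume N: "\<forall>m\<ge>n. N m (U m \<omega>)"
      \<comment> \<open>On a path that stays, \<open>g\<close> is an increment of natural numbers,
        so below 1 it vanishes.\<close>
      have "\<forall>\<^sub>F m in sequentially. g m \<omega> < 1"
        by (rule order_tendstoD[OF summable_LIMSEQ_zero[OF elim(1)]]) simp
      then obtain n1 where n1: "\<And>m. n1 \<le> m \<Longrightarrow> g m \<omega> < 1" by (auto simp: eventually_sequentially)
      have "U (Suc m) \<omega> $ j = U m \<omega> $ j" if "n1 + n \<le> m" for m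
      proof -
        have "\<omega> \<in> stay N n m" using N elim by (auto simp: stay_def)
        then have "real (U (Suc m) \<omega> $ j) - real (U m \<omega> $ j) < 1"
          using n1[of "m - n"] that by (simp add: g_def)
        then show ?thesis using U_mono[OF elim(2), of m j] by linarith
      qed
      then show "\<exists>n1. \<forall>m\<ge>n1. U (Suc m) \<omega> $ j = U m \<omega> $ j" by blast
    qed
  qed
qed

text \<open>Near the vertex colour \<open>i\<close> holds at least half of all balls, so the total
  weight is at least \<open>f (1 / 2)\<close>. Another colour is then drawn with probability of
  order \<open>(\<theta> m u $ j) powr \<beta>\<close>, negligible against its proportion because
  \<open>\<beta> > 1\<close>. Once every other colour has stopped, all new balls have colour
  \<open>i\<close>.\<close>

lemma AE_fix_vertex:
  assumes e: "summable (\<lambda>n. (e n)\<^sup>2)"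
    and z: "z \<in> unit_simplex" and i: "\<And>j. j \<noteq> i \<Longrightarrow> z $ j = 0"
  shows "\<exists>\<delta>>0. AE \<omega> in M. (\<exists>n0. \<forall>n\<ge>n0. dist (\<theta> n (U n \<omega>)) z < \<delta>) \<longrightarrow> \<omega> \<in> fixation M \<sigma> U"
proof -
  obtain n1 where n1: "\<And>m. n1 \<le> m \<Longrightarrow> e m \<le> 1 / 4" using eventually_e_le[OF e] by blast
  define c where "c = f (1 / 2)"
  have c: "0 < c" using rf.pos[of "1 / 2"] by (simp add: c_def)
  define \<kappa> where "\<kappa> = (\<beta> - 1) / 16"
  have \<kappa>: "0 < \<kappa>" using rf.\<beta>1 by (simp add: \<kappa>_def)
  \<comment> \<open>The power makes \<open>x powr (\<beta> - 1) \<le> c * \<kappa>\<close> for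
    proportions \<open>x\<close> below \<delta>; the bound 1/2 keeps colour \<open>i\<close> above
    one half.\<close>
  define \<delta> where "\<delta> = min (1 / 2) ((c * \<kappa>) powr (1 / (\<beta> - 1)))"
  have \<delta>: "0 < \<delta>" "\<delta> \<le> 1 / 2" using c \<kappa> by (auto simp: \<delta>_def)
  have "\<delta> powr (\<beta> - 1) \<le> ((c * \<kappa>) powr (1 / (\<beta> - 1))) powr (\<beta> - 1)"
    using rf.\<beta>1 \<delta> by (intro powr_mono2) (auto simp: \<delta>_def)
  then have \<delta>pw: "\<delta> powr (\<beta> - 1) \<le> c * \<kappa>" using rf.\<beta>1 c \<kappa> by (simp add: powr_powr)
  have "(\<Sum>j\<in>UNIV. z $ j) = z $ i + (\<Sum>j\<in>UNIV - {i}. z $ j)" by (simp add: sum.remove)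
  then have zi: "z $ i = 1" using z i by (simp add: unit_simplex_def)
  define N where "N = (\<lambda>m (u :: nat ^ 'd). dist (\<theta> m u) z < \<delta>)"
  have N1: "draw (\<theta> m u) j \<le> (\<theta> m u $ j) powr \<beta> / c"
    and N2: "draw (\<theta> m u) j \<le> (\<beta> - 1) / 16 * \<theta> m u $ j"
    if u: "u \<in> comps m" "N m u" and j: "j \<noteq> i" for m u j
  proof -
    define x where "x = \<theta> m u"
    have x: "x \<in> unit_simplex" using \<theta>_unit_simplex[OF u(1)] by (simp add: x_def)
    have x01: "0 \<le> x $ l" "x $ l \<le> 1" for l using x unit_simplex_le_1[OF x] by (auto simp: unit_simplex_def)
    have d: "\<bar>x $ l - z $ l\<bar> < \<delta>" for l
      using component_le_norm_cart[of "x - z" l] u(2) by (simp add: N_def x_def dist_norm)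
    have "1 / 2 \<le> x $ i" using d[of i] \<delta> zi by linarith
    then have "c \<le> f (x $ i)" unfolding c_def using x01 by (intro rf.mono) auto
    also have "\<dots> \<le> total_weight x"
      unfolding total_weight_def using f_nonneg[OF x] by (intro member_le_sum) auto
    finally have "draw x j \<le> f (x $ j) / c"
      unfolding draw_def using c f_nonneg[OF x] by (intro divide_left_mono mult_pos_pos) auto
    also have "\<dots> \<le> (x $ j) powr \<beta> / c"
      using c x01 by (intro divide_right_mono rf.le_powr) auto
    finally show 1: "draw (\<theta> m u) j \<le> (\<theta> m u $ j) powr \<beta> / c" by (simp add: x_def)
    have "(x $ j) powr \<beta> = x $ j * (x $ j) powr (\<beta> - 1)"
      using x01[of j] by (cases "x $ j = 0") (auto simp: powr_diff)
    also have "\<dots> \<le> x $ j * (c * \<kappa>)"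
    proof (intro mult_left_mono x01)
      have "(x $ j) powr (\<beta> - 1) \<le> \<delta> powr (\<beta> - 1)"
        using d[of j] i[OF j] x01[of j] rf.\<beta>1 by (intro powr_mono2) auto
      then show "(x $ j) powr (\<beta> - 1) \<le> c * \<kappa>" using \<delta>pw by linarith
    qed
    finally have "(x $ j) powr \<beta> / c \<le> \<kappa> * x $ j" using c by (simp add: field_simps)
    then show "draw (\<theta> m u) j \<le> (\<beta> - 1) / 16 * \<theta> m u $ j" using 1 unfolding x_def \<kappa>_def by linarith
  qed
  have minority: "AE \<omega> in M. (\<forall>m\<ge>max n0 n1. N m (U m \<omega>)) \<longrightarrow> (\<exists>n1. \<forall>m\<ge>n1. U (Suc m) \<omega> $ j = U m \<omega> $ j)"
    if j: "j \<noteq> i" for n0 j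
    using n1 c N1[OF _ _ j] N2[OF _ _ j] by (intro AE_minority_stops) auto
  have "AE \<omega> in M. \<forall>n0. \<forall>j\<in>UNIV - {i}. (\<forall>m\<ge>max n0 n1. N m (U m \<omega>)) \<longrightarrow>
      (\<exists>n1. \<forall>m\<ge>n1. U (Suc m) \<omega> $ j = U m \<omega> $ j)"
  proof (subst AE_all_countable, rule allI, rule AE_finite_allI)
    fix n0 j assume "j \<in> UNIV - {i}"
    then have "j \<noteq> i" by simp
    then show "AE \<omega> in M. (\<forall>m\<ge>max n0 n1. N m (U m \<omega>)) \<longrightarrow>
      (\<exists>n1. \<forall>m\<ge>n1. U (Suc m) \<omega> $ j = U m \<omega> $ j)" by (rule minority)
  qed simp
  moreover have "AE \<omega> in M. \<forall>n. U n \<omega> \<in> comps n" by (simp add: AE_all_countable AE_comps)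
  ultimately have "AE \<omega> in M. (\<exists>n0. \<forall>n\<ge>n0. dist (\<theta> n (U n \<omega>)) z < \<delta>) \<longrightarrow> \<omega> \<in> fixation M \<sigma> U"
    using AE_space
  proof eventually_elim
    case (elim \<omega>)
    show ?case
    proof
      assume "\<exists>n0. \<forall>n\<ge>n0. dist (\<theta> n (U n \<omega>)) z < \<delta>"
      then obtain n0 where "\<forall>m\<ge>max n0 n1. N m (U m \<omega>)" by (auto simp: N_def)
      then have "\<forall>j\<in>UNIV - {i}. \<exists>n1. \<forall>m\<ge>n1. U (Suc m) \<omega> $ j = U m \<omega> $ j" using elim(1) by blast
      then have "\<forall>j\<in>UNIV - {i}. \<forall>\<^sub>F m in sequentially. U (Suc m) \<omega> $ j = U m \<omega> $ j"
        by (simp add: eventually_sequentially)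
      then have "\<forall>\<^sub>F m in sequentially. \<forall>j\<in>UNIV - {i}. U (Suc m) \<omega> $ j = U m \<omega> $ j"
        by (intro eventually_ball_finite) auto
      then obtain n2 where n2: "\<And>m j. n2 \<le> m \<Longrightarrow> j \<noteq> i \<Longrightarrow> U (Suc m) \<omega> $ j = U m \<omega> $ j"
        by (auto simp: eventually_sequentially)
      \<comment> \<open>The total grows by \<open>\<sigma> (Suc m)\<close> while the other counts
        are constant.\<close>
      have "U (Suc m) \<omega> $ i = U m \<omega> $ i + \<sigma> (Suc m)" if "n2 \<le> m" for m
      proof -
        have split: "ball_count u = u $ i + (\<Sum>j\<in>UNIV - {i}. u $ j)" for u :: "nat ^ 'd"
          by (simp add: ball_count_def sum.remove)
        have "(\<Sum>j\<in>UNIV - {i}. U (Suc m) \<omega> $ j) = (\<Sum>j\<in>UNIV - {i}. U m \<omega> $ j)"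
          using n2[OF that] by (intro sum.cong) auto
        moreover have "ball_count (U (Suc m) \<omega>) = ball_count (U m \<omega>) + \<sigma> (Suc m)"
          using elim(2) by (simp add: comps_def \<tau>_Suc)
        ultimately show ?thesis unfolding split by simp
      qed
      then show "\<omega> \<in> fixation M \<sigma> U"
        using elim(3) unfolding fixation_def by (auto intro!: exI[of _ "max 1 n2"] exI[of _ i])
    qed
  qed
  then show ?thesis using \<delta> by blast
qed

section \<open>Measurability of fixation and conclusion\<close>

lemma sets_fixation: "fixation M \<sigma> U \<in> sets M"
proof -
  define P where "P = (\<lambda>n i. {\<omega>\<in>space M. U (Suc n) \<omega> $ i = U n \<omega> $ i + \<sigma> (Suc n)})"
  have P: "P n i \<in> sets M" for n i
  proof -
    have "{\<omega>\<in>space M. real (U (Suc n) \<omega> $ i) = real (U n \<omega> $ i) + real (\<sigma> (Suc n))} \<in> sets M"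
      by (intro borel_measurable_eq borel_measurable_add borel_measurable_const
          measurable_fun_U[where \<phi> = "\<lambda>u. real (u $ i)"])
    then show ?thesis unfolding P_def of_nat_add[symmetric] of_nat_eq_iff .
  qed
  have "fixation M \<sigma> U = (\<Union>N\<in>{1..}. \<Union>i\<in>UNIV. \<Inter>n\<in>{N..}. P n i)"
  proof (intro set_eqI iffI)
    fix \<omega> assume "\<omega> \<in> fixation M \<sigma> U"
    then obtain N i where "\<omega> \<in> space M" "1 \<le> N" "\<And>n. N \<le> n \<Longrightarrow> \<omega> \<in> P n i"
      unfolding fixation_def P_def by auto
    then show "\<omega> \<in> (\<Union>N\<in>{1..}. \<Union>i\<in>UNIV. \<Inter>n\<in>{N..}. P n i)" by auto
  next
    fix \<omega> assume "\<omega> \<in> (\<Union>N\<in>{1..}. \<Union>i\<in>UNIV. \<Inter>n\<in>{N..}. P n i)"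
    then obtain N i where N: "1 \<le> N" "\<And>n. N \<le> n \<Longrightarrow> \<omega> \<in> P n i" by auto
    then have "\<omega> \<in> space M" unfolding P_def by blast
    then show "\<omega> \<in> fixation M \<sigma> U"
      using N unfolding fixation_def P_def by (auto intro!: exI[of _ N] exI[of _ i])
  qed
  moreover have "(\<Inter>n\<in>{N..}. P n i) \<in> sets M" for N i
    by (intro sets.countable_INT') (use P in auto)
  ultimately show ?thesis
    by (auto intro!: sets.countable_UN' sets.finite_UN)
qed

text \<open>Each equilibrium has a neighbourhood in which staying forever almost surely entails
  fixation: vacuously at a mixed one, by \<open>AE_fix_vertex\<close> at a vertex. Finiteness of the
  set of equilibria allows the exceptional null sets to be united.\<close>

lemma AE_fixation:
  assumes e: "\<not> summable e" "summable (\<lambda>n. (e n)\<^sup>2)"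
  shows "AE \<omega> in M. \<omega> \<in> fixation M \<sigma> U"
proof -
  define Q where "Q = (\<lambda>z d. 0 < d \<and>
    (AE \<omega> in M. (\<exists>n0. \<forall>n\<ge>n0. dist (\<theta> n (U n \<omega>)) z < d) \<longrightarrow> \<omega> \<in> fixation M \<sigma> U))"
  define Z where "Z = {z \<in> unit_simplex. imbalance z = 0}"
  have "\<exists>d. Q z d" if "z \<in> Z" for z
  proof -
    have z: "z \<in> unit_simplex" "imbalance z = 0" using that by (auto simp: Z_def)
    obtain i where i: "0 < z $ i"
    proof -
      have "\<exists>i. z $ i \<noteq> 0" using z(1) by (rule_tac ccontr) (simp add: unit_simplex_def)
      then show ?thesis using that z(1) by (auto simp: unit_simplex_def less_le)
    qed
    show ?thesis
    proof (cases "\<exists>k. k \<noteq> i \<and> 0 < z $ k")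
      case True
      then obtain k where k: "i \<noteq> k" "0 < z $ k" by metis
      from AE_avoid_mixed[OF e z i k(2,1)] obtain d where
        "0 < d" "AE \<omega> in M. \<not> (\<exists>n0. \<forall>n\<ge>n0. dist (\<theta> n (U n \<omega>)) z < d)" by blast
      then show ?thesis unfolding Q_def by (intro exI[of _ d]) (auto elim: eventually_mono)
    next
      case False
      then have "z $ j = 0" if "j \<noteq> i" for j
        using that z(1) by (auto simp: unit_simplex_def less_le)
      from AE_fix_vertex[OF e(2) z(1) this] show ?thesis unfolding Q_def by blast
    qed
  qed
  then obtain \<delta> where \<delta>: "\<And>z. z \<in> Z \<Longrightarrow> Q z (\<delta> z)" by metis
  have "AE \<omega> in M. \<exists>z\<in>unit_simplex. imbalance z = 0 \<and> (\<exists>n0. \<forall>n\<ge>n0. dist (\<theta> n (U n \<omega>)) z < \<delta> z)"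
    by (rule AE_eventually_near_equilibrium[OF e]) (use \<delta> in \<open>auto simp: Q_def Z_def\<close>)
  moreover have "AE \<omega> in M. \<forall>z\<in>Z. (\<exists>n0. \<forall>n\<ge>n0. dist (\<theta> n (U n \<omega>)) z < \<delta> z) \<longrightarrow> \<omega> \<in> fixation M \<sigma> U"
    by (intro AE_finite_allI) (use finite_equilibria \<delta> in \<open>auto simp: Q_def Z_def\<close>)
  ultimately show ?thesis
    by eventually_elim (auto simp: Z_def)
qed

end

theorem theorem2:
  fixes M :: "'w measure"
    and f :: "real \<Rightarrow> real"
    and \<sigma> :: "nat \<Rightarrow> nat"
    and u0 :: "nat ^ 'd::finite"
    and X :: "nat \<Rightarrow> nat \<Rightarrow> 'w \<Rightarrow> nat ^ 'd"
    and U :: "nat \<Rightarrow> 'w \<Rightarrow> nat ^ 'd"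
  assumes "f \<in> reinforcement_class"
    and "\<And>n. n \<ge> 1 \<Longrightarrow> \<sigma> n > 0"
    and "polya_urn M f \<sigma> u0 X U"
    and "(\<Sum>n. ennreal (real (\<sigma> (Suc n)) / real (total_balls u0 \<sigma> (Suc n)))) = \<infinity>"
    and "(\<Sum>n. ennreal ((real (\<sigma> (Suc n)) / real (total_balls u0 \<sigma> (Suc n)))\<^sup>2)) < \<infinity>"
  shows "measure M (fixation M \<sigma> U) = 1"
proof -
  obtain \<beta> where "reinforcement f \<beta>" using reinforcement_classD[OF assms(1)] by blast
  then interpret convex_urn M f \<sigma> u0 X U \<beta>
    using assms(3) by (intro convex_urn.intro)
  have "\<not> summable e"
  proof
    assume "summable e"
    then have "(\<Sum>n. ennreal (e n)) = ennreal (suminf e)" by (rule suminf_ennreal2[OF e_nonneg])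
    then show False using assms(4) by (simp add: e_def)
  qed
  moreover have "summable (\<lambda>n. (e n)\<^sup>2)"
  proof (rule summable_suminf_not_top)
    show "(\<Sum>n. ennreal ((e n)\<^sup>2)) \<noteq> \<top>" using assms(5) by (simp add: e_def)
  qed simp
  ultimately show ?thesis
    by (subst prob_eq_1[OF sets_fixation]) (rule AE_fixation)
qed

end
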